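(* Let $\Omega\subset\mathbb{R}^d$ be compact with probability measure $\mu$, and let $\Psi=\{\psi_{\mathbf k}\}_{\mathbf k\in\mathbb{Z}^d}\subset\mathcal{C}(\Omega)$ be a uniformly bounded Riesz system with constants $0<R_1\le R_2<\infty$. Let $2\le p<\infty$, $\beta\in(0,1]$, $r>0$, and fix a weakness parameter $t\in(0,1]$. There exist an integer $c=c(t,R_1,R_2)\ge1$ and constants $c'=c'(r,\beta,p,R_1,R_2,d,t)$, $C'=C'(r,\beta,p,d)$ such that the following holds: if $v\in\mathbb{N}$, $u:=\lceil(1+c)v\rceil$ and $\Psi\in NI(2,p,H,u)$, then $$\varrho_m^o(\mathbf{A}^r_\beta(\Psi),L_p(\Omega,\mu))\le C'H\,v^{1/2-1/\beta-r/d}$$ for every $m\ge c'\,v(\log(2v))^4$.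
   Context: Uniformly bounded Riesz system: $\sup_{x\in\Omega}|\psi_{\mathbf k}(x)|\le1$ for all $\mathbf k$, and for every finite set $Q\subset\mathbb{Z}^d$ and coefficients $(a_{\mathbf k})_{\mathbf k\in Q}\subset\mathbb{C}$: $R_1(\sum_{Q}|a_{\mathbf k}|^2)^{1/2}\le\|\sum_{Q}a_{\mathbf k}\psi_{\mathbf k}\|_{L_2(\Omega,\mu)}\le R_2(\sum_Q|a_{\mathbf k}|^2)^{1/2}$. $\Psi\in NI(2,p,H,u)$ means $\|f\|_{L_p(\Omega,\mu)}\le H\|f\|_{L_2(\Omega,\mu)}$ for every linear combination $f$ of at most $u$ elements of $\Psi$. Class $\mathbf{A}^r_\beta(\Psi)$: all functions $f=\sum_{\mathbf k\in\mathbb{Z}^d}a_{\mathbf k}(f)\psi_{\mathbf k}$ with $\sum_{\mathbf k}|a_{\mathbf k}(f)|<\infty$ and $\big(\sum_{[2^{j-1}]\le\|\mathbf k\|_\infty<2^j}|a_{\mathbf k}(f)|^\beta\big)^{1/\beta}\le 2^{-rj}$ for $j=0,1,2,\dots$ ($[x]$ the integer part). For $\mathbf F\subset\mathcal{C}(\Omega)$: $\varrho_m^o(\mathbf F,L_p)=\inf_\xi\inf_{\mathcal M}\sup_{f\in\mathbf F}\|f-\mathcal M(f(\xi^1),\dots,f(\xi^m))\|_{L_p(\Omega,\mu)}$, the infima over all $m$-point sets $\xi\subset\Omega$ and all mappings $\mathcal M:\mathbb{C}^m\to L_p(\Omega,\mu)$. *)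

theory Defs
  imports "HOL-Analysis.Analysis" "HOL-Probability.Probability"
begin

text \<open>Points of R^d are represented as functions nat => real vanishing from index d on
  (product topology on nat => real); indices in Z^d as functions nat => int vanishing from d on.\<close>

definition Zd :: "nat \<Rightarrow> (nat \<Rightarrow> int) set" where
  "Zd d = {k. \<forall>i\<ge>d. k i = 0}"

definition Rd :: "nat \<Rightarrow> (nat \<Rightarrow> real) set" where
  "Rd d = {x. \<forall>i\<ge>d. x i = 0}"

definition norm_inf :: "nat \<Rightarrow> (nat \<Rightarrow> int) \<Rightarrow> nat" where
  "norm_inf d k = Max (insert 0 ((\<lambda>i. nat \<bar>k i\<bar>) ` {..<d}))"

definition Lp_norm :: "'a measure \<Rightarrow> real \<Rightarrow> ('a \<Rightarrow> complex) \<Rightarrow> ennreal" where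
  "Lp_norm \<mu> p f = (let I = (\<integral>\<^sup>+ x. ennreal (cmod (f x) powr p) \<partial>\<mu>)
     in if I = \<infinity> then \<infinity> else ennreal (enn2real I powr (1 / p)))"

definition unif_bounded_riesz ::
  "'a measure \<Rightarrow> 'a set \<Rightarrow> 'i set \<Rightarrow> ('i \<Rightarrow> 'a \<Rightarrow> complex) \<Rightarrow> real \<Rightarrow> real \<Rightarrow> bool" where
  "unif_bounded_riesz \<mu> \<Omega> I \<psi> R1 R2 \<longleftrightarrow>
     (\<forall>k\<in>I. \<forall>x\<in>\<Omega>. cmod (\<psi> k x) \<le> 1) \<and>
     (\<forall>Q a. finite Q \<and> Q \<subseteq> I \<longrightarrow>
        ennreal (R1 * sqrt (\<Sum>k\<in>Q. (cmod (a k))\<^sup>2)) \<le> Lp_norm \<mu> 2 (\<lambda>x. \<Sum>k\<in>Q. a k * \<psi> k x) \<and>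
        Lp_norm \<mu> 2 (\<lambda>x. \<Sum>k\<in>Q. a k * \<psi> k x) \<le> ennreal (R2 * sqrt (\<Sum>k\<in>Q. (cmod (a k))\<^sup>2)))"

definition NI :: "'a measure \<Rightarrow> 'i set \<Rightarrow> ('i \<Rightarrow> 'a \<Rightarrow> complex) \<Rightarrow> real \<Rightarrow> real \<Rightarrow> nat \<Rightarrow> bool" where
  "NI \<mu> I \<psi> p H u \<longleftrightarrow>
     (\<forall>Q a. finite Q \<and> Q \<subseteq> I \<and> card Q \<le> u \<longrightarrow>
        Lp_norm \<mu> p (\<lambda>x. \<Sum>k\<in>Q. a k * \<psi> k x) \<le> ennreal H * Lp_norm \<mu> 2 (\<lambda>x. \<Sum>k\<in>Q. a k * \<psi> k x))"

definition dyadic_block :: "nat \<Rightarrow> nat \<Rightarrow> (nat \<Rightarrow> int) set" where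
  "dyadic_block d j = {k \<in> Zd d. nat \<lfloor>(2::real) powr (real j - 1)\<rfloor> \<le> norm_inf d k \<and> norm_inf d k < 2 ^ j}"

definition A_class :: "nat \<Rightarrow> ((nat \<Rightarrow> int) \<Rightarrow> 'a \<Rightarrow> complex) \<Rightarrow> real \<Rightarrow> real \<Rightarrow> ('a \<Rightarrow> complex) set" where
  "A_class d \<psi> r \<beta> = {f. \<exists>a :: (nat \<Rightarrow> int) \<Rightarrow> complex.
      (\<lambda>k. cmod (a k)) summable_on Zd d \<and>
      (\<forall>j::nat. (\<Sum>k\<in>dyadic_block d j. cmod (a k) powr \<beta>) powr (1 / \<beta>) \<le> 2 powr (- r * real j)) \<and>
      f = (\<lambda>x. \<Sum>\<^sub>\<infinity>k\<in>Zd d. a k * \<psi> k x)}"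

definition rho_opt :: "('a \<Rightarrow> complex) set \<Rightarrow> 'a measure \<Rightarrow> real \<Rightarrow> nat \<Rightarrow> ennreal" where
  "rho_opt F \<mu> p m =
     (INF \<xi> \<in> {\<xi>. length \<xi> = m \<and> set \<xi> \<subseteq> space \<mu>}.
        INF M \<in> {M :: complex list \<Rightarrow> 'a \<Rightarrow> complex. \<forall>y. M y \<in> borel_measurable \<mu>}.
          SUP f \<in> F. Lp_norm \<mu> p (\<lambda>x. f x - M (map f \<xi>) x))"

end

theory Submission
  imports Defs
begin

text \<open>For a dictionary of \<open>N\<close> functions bounded by \<open>1\<close>, about \<open>\<delta>\<^sup>-\<^sup>1 log\<^sup>2 (1/\<delta>) log N\<close> points make
  the empirical and the true second moments of all convex combinations \<open>f\<close> comparable up to an additive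
  error \<open>\<delta>\<close>: split \<open>f\<^sup>2\<close> into dyadic level sets \<open>{\<bar>f\<bar> \<ge> T}\<close>. On the level \<open>T\<close>, Maurey's argument replaces
  \<open>f\<close> by the mean of about \<open>T\<^sup>-\<^sup>2 log (1/\<delta>)\<close> atoms, so few functions have to be controlled, and a Chernoff
  bound with additive slack of order \<open>\<delta> T\<^sup>-\<^sup>2 / log (1/\<delta>)\<close> allows a union bound over all levels.

  With \<open>\<delta>\<close> of order \<open>1/v\<close> this gives the restricted isometry property for \<open>v\<close>-sparse sums. A function of
  the class is recovered by (a truncation of) any function of the class with the same samples. The coefficients
  of the difference lie in a weak \<open>\<ell>\<^sub>q\<close> ball with \<open>1/q = 1/\<beta> + r/d\<close>; cutting them at the height
  \<open>\<theta> = (const \<cdot> c v)\<^sup>-\<^sup>1\<^sup>/\<^sup>q\<close> leaves a sparse part, controlled by its samples, and a small rest, controlled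
  blockwise. The Nikolskii inequality is applied to sums of at most \<open>c v\<close> terms, and
  \<open>c \<ge> (1 + R2)\<^sup>2\<close> absorbs the Riesz constants.\<close>

section \<open>Sampling with controlled frequencies\<close>

text \<open>The points must serve all functions at once, while the approximating tuple of atoms
  depends on the function; hence the union bound runs over all tuples. Tuple length and admissible
  slack both grow like T^-2, so every level asks for the same number of points. The frequencies are
  compared up to a factor 2, because then a slack \<tau> costs exp (- m \<tau>); a purely additive
  comparison would cost about exp (- m \<tau>^2) and spoil the linear dependence on v.

  For \<beta> < 1 the class need not be convex, so the difference of two members is not simply a
  multiple of a member. All information on coefficients is therefore carried by the sum of
  min(|a_k|, \<theta>): it is subadditive in a, and it bounds at once \<theta> times the number of
  coefficients above \<theta> and the l_1 norm of the others.

  Both directions of the moment comparison are used: from samples to integral for the sparse part,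
  from integral to samples for the small rest.\<close>

definition avg :: "'a list \<Rightarrow> ('a \<Rightarrow> real) \<Rightarrow> real" where
  "avg \<xi> F = (\<Sum>x\<leftarrow>\<xi>. F x) / real (length \<xi>)"

lemma avg_mono: "(\<And>x. x \<in> set \<xi> \<Longrightarrow> F x \<le> G x) \<Longrightarrow> avg \<xi> F \<le> avg \<xi> G"
  unfolding avg_def by (intro divide_right_mono sum_list_mono) auto

lemma avg_add: "avg \<xi> (\<lambda>x. F x + G x) = avg \<xi> F + avg \<xi> G"
  unfolding avg_def by (simp add: sum_list_addf add_divide_distrib)

lemma avg_cmult: "avg \<xi> (\<lambda>x. c * F x) = c * avg \<xi> F"
  unfolding avg_def by (simp add: sum_list_const_mult)

lemma avg_sum: "avg \<xi> (\<lambda>x. \<Sum>i\<in>I. F i x) = (\<Sum>i\<in>I. avg \<xi> (F i))"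
proof -
  have "(\<Sum>x\<leftarrow>\<xi>. \<Sum>i\<in>I. F i x) = (\<Sum>i\<in>I. \<Sum>x\<leftarrow>\<xi>. F i x)"
    by (induction \<xi>) (simp_all add: sum.distrib)
  then show ?thesis
    unfolding avg_def by (simp add: sum_divide_distrib)
qed

lemma avg_nonneg: "(\<And>x. x \<in> set \<xi> \<Longrightarrow> 0 \<le> F x) \<Longrightarrow> 0 \<le> avg \<xi> F"
  unfolding avg_def by (intro divide_nonneg_nonneg sum_list_nonneg) auto

lemma avg_const_le: "0 \<le> c \<Longrightarrow> avg \<xi> (\<lambda>x. c) \<le> c"
  unfolding avg_def by (cases "\<xi> = []") (simp_all add: sum_list_triv)

text \<open>When a centred variable is averaged the linear term disappears and only
  \<open>exp (y\<^sup>2)\<close> remains; this is the moment bound behind the sub-Gaussian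
  tails.\<close>

lemma exp_le_quadratic:
  fixes y :: real
  assumes "\<bar>y\<bar> \<le> 1"
  shows "exp y \<le> y + exp (y\<^sup>2)"
proof -
  have "exp y \<le> 1 + y + y\<^sup>2"
  proof (cases "0 \<le> y")
    case True
    then show ?thesis using exp_bound[of y] assms by simp
  next
    case False
    define z where "z = - y"
    have z: "0 \<le> z" "z \<le> 1" using False assms by (auto simp: z_def)
    \<comment> \<open>An upper bound for exp (- z) is obtained from the quadratic Taylor lower bound
      for exp z: the product exceeds 1 by a polynomial with nonnegative coefficients.\<close>
    have "1 \<le> (1 - z + z\<^sup>2) * (1 + z + z\<^sup>2 / 2)"
    proof -
      have "(1 - z + z\<^sup>2) * (1 + z + z\<^sup>2 / 2) = 1 + z\<^sup>2 / 2 + z^3 / 2 + z^4 / 2"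
        by (simp add: algebra_simps power2_eq_square power3_eq_cube power4_eq_xxxx add_divide_distrib diff_divide_distrib)
      then show ?thesis using z by simp
    qed
    also have "\<dots> \<le> (1 - z + z\<^sup>2) * exp z"
      using exp_lower_Taylor_quadratic[OF z(1)] z
      by (intro mult_left_mono) (auto simp: add_increasing2 add.assoc)
    finally have "exp (- z) \<le> 1 - z + z\<^sup>2"
      by (simp add: exp_minus inverse_eq_divide pos_divide_le_eq)
    then show ?thesis by (simp add: z_def)
  qed
  also have "\<dots> \<le> y + exp (y\<^sup>2)"
    using exp_ge_add_one_self[of "y\<^sup>2"] by simp
  finally show ?thesis .
qed

context prob_space
begin

lemma integrable_of_bounded:
  fixes F :: "'a \<Rightarrow> real"
  assumes "F \<in> borel_measurable M" "\<And>x. x \<in> space M \<Longrightarrow> \<bar>F x\<bar> \<le> B"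
  shows "integrable M F"
  using assms by (intro integrable_const_bound[where B=B]) auto

lemma exists_le_expectation:
  fixes F :: "'a \<Rightarrow> real"
  assumes "integrable M F" "expectation F \<le> c"
  shows "\<exists>x\<in>space M. F x \<le> c"
proof (rule ccontr)
  assume "\<not> ?thesis"
  then have "c < expectation F"
    using assms(1) by (intro expectation_greater AE_I2) (auto simp: not_le)
  with assms(2) show False by simp
qed

text \<open>The points are chosen one after another, each keeping the conditional
  expectation from growing, which replaces independent random sampling.\<close>

lemma exists_points_sum_prod_le:
  fixes Y :: "'g \<Rightarrow> 'a \<Rightarrow> real" and \<alpha> :: "'g \<Rightarrow> real"
  assumes "finite G"
    and Y: "\<And>g. g \<in> G \<Longrightarrow> integrable M (Y g)" "\<And>g. g \<in> G \<Longrightarrow> expectation (Y g) \<le> 1"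
      "\<And>g x. g \<in> G \<Longrightarrow> x \<in> space M \<Longrightarrow> 0 \<le> Y g x"
    and "\<And>g. g \<in> G \<Longrightarrow> 0 \<le> \<alpha> g"
  shows "\<exists>\<xi>. length \<xi> = m \<and> set \<xi> \<subseteq> space M \<and>
    (\<Sum>g\<in>G. \<alpha> g * prod_list (map (Y g) \<xi>)) \<le> sum \<alpha> G"
  using assms(5)
proof (induction m arbitrary: \<alpha>)
  case 0
  then show ?case by simp
next
  case (Suc m)
  have "expectation (\<lambda>x. \<Sum>g\<in>G. \<alpha> g * Y g x) = (\<Sum>g\<in>G. \<alpha> g * expectation (Y g))"
    using Y(1) by simp
  also have "\<dots> \<le> (\<Sum>g\<in>G. \<alpha> g * 1)"
    using Y(2) Suc.prems by (intro sum_mono mult_left_mono) auto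
  finally have "expectation (\<lambda>x. \<Sum>g\<in>G. \<alpha> g * Y g x) \<le> sum \<alpha> G" by simp
  then obtain x where x: "x \<in> space M" "(\<Sum>g\<in>G. \<alpha> g * Y g x) \<le> sum \<alpha> G"
    using exists_le_expectation[of "\<lambda>x. \<Sum>g\<in>G. \<alpha> g * Y g x" "sum \<alpha> G"] Y(1) by auto
  have "\<exists>\<xi>. length \<xi> = m \<and> set \<xi> \<subseteq> space M \<and>
    (\<Sum>g\<in>G. \<alpha> g * Y g x * prod_list (map (Y g) \<xi>)) \<le> (\<Sum>g\<in>G. \<alpha> g * Y g x)"
    using Suc.prems Y(3) x(1) by (intro Suc.IH) simp
  then obtain \<xi> where "length \<xi> = m" "set \<xi> \<subseteq> space M"
    "(\<Sum>g\<in>G. \<alpha> g * Y g x * prod_list (map (Y g) \<xi>)) \<le> (\<Sum>g\<in>G. \<alpha> g * Y g x)"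
    by blast
  with x show ?case
    by (intro exI[of _ "x # \<xi>"]) (auto simp: mult.assoc)
qed

text \<open>On [0, 1] the function exp b lies below 1 + 2 b and exp (- b) below 1 - b / 2. The
  resulting moment bounds involve only the mean, which is the origin of the factor 2 between
  frequency and probability.\<close>

lemma expectation_exp_le:
  fixes B :: "'a \<Rightarrow> real"
  assumes [measurable]: "B \<in> borel_measurable M" and B: "\<And>x. x \<in> space M \<Longrightarrow> 0 \<le> B x \<and> B x \<le> 1"
  shows "expectation (\<lambda>x. exp (B x)) \<le> exp (2 * expectation B)"
    and "expectation (\<lambda>x. exp (- B x)) \<le> exp (- expectation B / 2)"
    and "integrable M B" "integrable M (\<lambda>x. exp (B x))" "integrable M (\<lambda>x. exp (- B x))"
proof -
  show i: "integrable M B"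
  proof (rule integrable_of_bounded)
    show "\<bar>B x\<bar> \<le> 1" if "x \<in> space M" for x using B[OF that] by simp
  qed measurable
  show i1: "integrable M (\<lambda>x. exp (B x))"
  proof (rule integrable_of_bounded)
    show "\<bar>exp (B x)\<bar> \<le> exp 1" if "x \<in> space M" for x using B[OF that] by simp
  qed measurable
  show i2: "integrable M (\<lambda>x. exp (- B x))"
  proof (rule integrable_of_bounded)
    show "\<bar>exp (- B x)\<bar> \<le> 1" if "x \<in> space M" for x using B[OF that] by simp
  qed measurable
  have sq: "(B x)\<^sup>2 \<le> B x" if "x \<in> space M" for x
    using B[OF that] by (simp add: power2_eq_square mult_left_le)
  have "expectation (\<lambda>x. exp (B x)) \<le> expectation (\<lambda>x. 1 + 2 * B x)"
  proof (rule integral_mono[OF i1])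
    fix x assume x: "x \<in> space M"
    show "exp (B x) \<le> 1 + 2 * B x"
      using exp_bound[of "B x"] B[OF x] sq[OF x] by simp
  qed (use i in simp)
  also have "\<dots> = 1 + 2 * expectation B" using i by (simp add: prob_space)
  also have "\<dots> \<le> exp (2 * expectation B)" using exp_ge_add_one_self[of "2 * expectation B"] by simp
  finally show "expectation (\<lambda>x. exp (B x)) \<le> exp (2 * expectation B)" .
  have "expectation (\<lambda>x. exp (- B x)) \<le> expectation (\<lambda>x. 1 - B x / 2)"
  proof (rule integral_mono[OF i2])
    fix x assume x: "x \<in> space M"
    note b = B[OF x]
    have "1 \<le> (1 - B x / 2) * (1 + B x)"
      using sq[OF x] b by (simp add: algebra_simps power2_eq_square)
    also have "\<dots> \<le> (1 - B x / 2) * exp (B x)"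
      using b by (intro mult_left_mono) auto
    finally show "exp (- B x) \<le> 1 - B x / 2"
      by (simp add: exp_minus inverse_eq_divide pos_divide_le_eq)
  qed (use i in simp)
  also have "\<dots> = 1 - expectation B / 2" using i by (simp add: prob_space)
  also have "\<dots> \<le> exp (- expectation B / 2)" using exp_ge_add_one_self[of "- expectation B / 2"] by simp
  finally show "expectation (\<lambda>x. exp (- B x)) \<le> exp (- expectation B / 2)" .
qed

lemma prod_list_exp: "prod_list (map (\<lambda>x. exp (F x)) \<xi>) = exp (\<Sum>x\<leftarrow>\<xi>. F x :: real)"
  by (induction \<xi>) (auto simp: exp_add)

text \<open>Union bound in product form: once the weighted sum of all products is below 1, so is
  each summand, and the logarithm of a single summand is the wanted inequality. The lower estimate
  comes out for half the probability, which doubles its slack.\<close>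

lemma exists_points_frequency:
  fixes B :: "'g \<Rightarrow> 'a \<Rightarrow> real" and \<tau> :: "'g \<Rightarrow> real"
  assumes fin: "finite G" and m: "1 \<le> m"
    and meas: "\<And>g. g \<in> G \<Longrightarrow> B g \<in> borel_measurable M"
    and B: "\<And>g x. g \<in> G \<Longrightarrow> x \<in> space M \<Longrightarrow> 0 \<le> B g x \<and> B g x \<le> 1"
    and small: "(\<Sum>g\<in>G. 2 * exp (- real m * \<tau> g)) < 1"
  shows "\<exists>\<xi>. length \<xi> = m \<and> set \<xi> \<subseteq> space M \<and>
    (\<forall>g\<in>G. avg \<xi> (B g) \<le> 2 * expectation (B g) + \<tau> g \<and>
            expectation (B g) \<le> 2 * avg \<xi> (B g) + 2 * \<tau> g)"
proof -
  \<comment> \<open>The boolean selects the direction: \<open>True\<close> excludes a frequency that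
    is too high, \<open>False\<close> one that is too low. Each factor is normalised to have
    expectation at most 1.\<close>
  define Y where "Y = (\<lambda>(g, b) x. if b then exp (B g x) * exp (- 2 * expectation (B g))
      else exp (- B g x) * exp (expectation (B g) / 2))"
  define \<alpha> where "\<alpha> = (\<lambda>(g, b :: bool). exp (- real m * \<tau> g))"
  let ?G = "G \<times> (UNIV :: bool set)"
  have E: "expectation (\<lambda>x. exp (B g x)) \<le> exp (2 * expectation (B g))"
    "expectation (\<lambda>x. exp (- B g x)) \<le> exp (- expectation (B g) / 2)"
    "integrable M (\<lambda>x. exp (B g x))" "integrable M (\<lambda>x. exp (- B g x))" if "g \<in> G" for g
    using expectation_exp_le[of "B g"] meas[OF that] B[OF that] by blast+
  have "\<exists>\<xi>. length \<xi> = m \<and> set \<xi> \<subseteq> space M \<and>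
    (\<Sum>g\<in>?G. \<alpha> g * prod_list (map (Y g) \<xi>)) \<le> sum \<alpha> ?G"
  proof (rule exists_points_sum_prod_le)
    show "finite ?G" using fin by simp
    fix h assume "h \<in> ?G"
    then obtain g b where h: "h = (g, b)" "g \<in> G" by auto
    show "integrable M (Y h)"
      using E(3,4)[OF h(2)] unfolding h(1) Y_def by (cases b) simp_all
    show "expectation (Y h) \<le> 1"
    proof (cases b)
      case True
      have "expectation (Y h) = expectation (\<lambda>x. exp (B g x)) * exp (- 2 * expectation (B g))"
        unfolding h(1) Y_def using True by simp
      also have "\<dots> \<le> exp (2 * expectation (B g)) * exp (- 2 * expectation (B g))"
        using E(1)[OF h(2)] by (intro mult_right_mono) auto
      finally show ?thesis by (simp flip: exp_add)
    next
      case False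
      have "expectation (Y h) = expectation (\<lambda>x. exp (- B g x)) * exp (expectation (B g) / 2)"
        unfolding h(1) Y_def using False by simp
      also have "\<dots> \<le> exp (- expectation (B g) / 2) * exp (expectation (B g) / 2)"
        using E(2)[OF h(2)] by (intro mult_right_mono) auto
      finally show ?thesis by (simp flip: exp_add)
    qed
    show "0 \<le> Y h x" for x unfolding h(1) Y_def by simp
    show "0 \<le> \<alpha> h" unfolding h(1) \<alpha>_def by simp
  qed
  then obtain \<xi> where xi: "length \<xi> = m" "set \<xi> \<subseteq> space M"
    and le: "(\<Sum>g\<in>?G. \<alpha> g * prod_list (map (Y g) \<xi>)) \<le> sum \<alpha> ?G" by blast
  have "sum \<alpha> ?G = (\<Sum>g\<in>G. \<Sum>b\<in>(UNIV :: bool set). \<alpha> (g, b))"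
    by (simp add: sum.cartesian_product)
  also have "\<dots> < 1" using small by (simp add: \<alpha>_def UNIV_bool)
  finally have lt: "(\<Sum>g\<in>?G. \<alpha> g * prod_list (map (Y g) \<xi>)) < 1" using le by simp
  have one: "\<alpha> (g, b) * prod_list (map (Y (g, b)) \<xi>) < 1" if "g \<in> G" for g b
  proof -
    have "\<alpha> h * prod_list (map (Y h) \<xi>) \<ge> 0" for h
      unfolding \<alpha>_def Y_def
      by (cases h) (intro mult_nonneg_nonneg prod_list_nonneg, auto)
    then have "\<alpha> (g, b) * prod_list (map (Y (g, b)) \<xi>) \<le> (\<Sum>g\<in>?G. \<alpha> g * prod_list (map (Y g) \<xi>))"
      using that fin by (intro member_le_sum) auto
    with lt show ?thesis by simp
  qed
  have sub: "(\<Sum>x\<leftarrow>\<xi>. F x + c) = (\<Sum>x\<leftarrow>\<xi>. F x) + real m * c" for F :: "'a \<Rightarrow> real" and c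
    using xi(1) by (simp add: sum_list_addf sum_list_triv)
  show ?thesis
  proof (intro exI[of _ \<xi>] conjI ballI xi)
    fix g assume g: "g \<in> G"
    let ?S = "\<Sum>x\<leftarrow>\<xi>. B g x" and ?q = "expectation (B g)"
    have S: "?S = real m * avg \<xi> (B g)" using m xi(1) by (simp add: avg_def)
    have "map (Y (g, True)) \<xi> = map (\<lambda>x. exp (B g x + - 2 * ?q)) \<xi>"
      by (simp only: Y_def exp_add) simp
    from one[OF g, of True, unfolded this prod_list_exp sub \<alpha>_def prod.case, folded exp_add]
    have "exp (- real m * \<tau> g + (?S + real m * (- 2 * ?q))) < exp 0" by simp
    then have "real m * avg \<xi> (B g) < real m * (2 * ?q + \<tau> g)" by (simp add: S algebra_simps)
    then show "avg \<xi> (B g) \<le> 2 * ?q + \<tau> g" using m by simp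
    have "map (Y (g, False)) \<xi> = map (\<lambda>x. exp (- B g x + ?q / 2)) \<xi>"
      by (simp only: Y_def exp_add) simp
    from one[OF g, of False, unfolded this prod_list_exp sub \<alpha>_def prod.case, folded exp_add]
    have "exp (- real m * \<tau> g + (- ?S + real m * (?q / 2))) < exp 0"
      by (simp add: uminus_sum_list_map o_def)
    then have "real m * ?q < real m * (2 * avg \<xi> (B g) + 2 * \<tau> g)" by (simp add: S algebra_simps)
    then show "?q \<le> 2 * avg \<xi> (B g) + 2 * \<tau> g" using m by simp
  qed
qed

end

section \<open>Empirical approximation of convex combinations\<close>

lemma exists_le_weighted_mean:
  fixes w V :: "'i \<Rightarrow> real"
  assumes "finite I" "\<And>i. i \<in> I \<Longrightarrow> 0 \<le> w i" "sum w I = 1" "(\<Sum>i\<in>I. w i * V i) \<le> c"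
  shows "\<exists>i\<in>I. V i \<le> c"
proof (rule ccontr)
  assume "\<not> ?thesis"
  then have V: "\<And>i. i \<in> I \<Longrightarrow> c < V i" by auto
  have "\<exists>i\<in>I. 0 < w i"
  proof (rule ccontr)
    assume "\<not> ?thesis"
    then have "sum w I \<le> 0" by (intro sum_nonpos) auto
    with assms(3) show False by simp
  qed
  then obtain i where i: "i \<in> I" "0 < w i" by blast
  have "c = (\<Sum>i\<in>I. w i * c)" using assms(3) by (simp flip: sum_distrib_right)
  also have "\<dots> < (\<Sum>i\<in>I. w i * V i)"
    using assms(1,2) V i by (intro sum_strict_mono_ex1) (auto simp: less_imp_le mult_left_mono intro!: bexI[of _ i])
  finally show False using assms(4) by simp
qed

text \<open>Applied to the deviation of an atom from the convex combination, which has weighted mean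
  zero and size at most 2; this size gives the 4 in the exponent, and the condition on \<kappa>
  keeps \<kappa> y in the range of the quadratic bound.\<close>

lemma weighted_exp_le:
  fixes w y :: "'i \<Rightarrow> real"
  assumes "\<And>i. i \<in> I \<Longrightarrow> 0 \<le> w i" "sum w I = 1" "(\<Sum>i\<in>I. w i * y i) = 0"
    and y: "\<And>i. i \<in> I \<Longrightarrow> \<bar>y i\<bar> \<le> 2" and \<kappa>: "2 * \<bar>\<kappa>\<bar> \<le> 1"
  shows "(\<Sum>i\<in>I. w i * exp (\<kappa> * y i)) \<le> exp (4 * \<kappa>\<^sup>2)"
proof -
  have "(\<Sum>i\<in>I. w i * exp (\<kappa> * y i)) \<le> (\<Sum>i\<in>I. w i * (\<kappa> * y i + exp (4 * \<kappa>\<^sup>2)))"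
  proof (intro sum_mono mult_left_mono assms(1))
    fix i assume i: "i \<in> I"
    have le: "\<bar>\<kappa> * y i\<bar> \<le> \<bar>\<kappa>\<bar> * 2"
      unfolding abs_mult by (intro mult_left_mono y i) auto
    then have "(\<kappa> * y i)\<^sup>2 \<le> (\<bar>\<kappa>\<bar> * 2)\<^sup>2"
      by (intro power2_le_iff_abs_le[THEN iffD2]) auto
    then have "(\<kappa> * y i)\<^sup>2 \<le> 4 * \<kappa>\<^sup>2" by (simp add: power_mult_distrib)
    moreover have "exp (\<kappa> * y i) \<le> \<kappa> * y i + exp ((\<kappa> * y i)\<^sup>2)"
      using le \<kappa> by (intro exp_le_quadratic) simp
    ultimately show "exp (\<kappa> * y i) \<le> \<kappa> * y i + exp (4 * \<kappa>\<^sup>2)"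
      using exp_le_cancel_iff[of "(\<kappa> * y i)\<^sup>2" "4 * \<kappa>\<^sup>2"] by linarith
  qed
  also have "\<dots> = \<kappa> * (\<Sum>i\<in>I. w i * y i) + sum w I * exp (4 * \<kappa>\<^sup>2)"
    by (simp add: distrib_left sum.distrib sum_distrib_left sum_distrib_right mult.left_commute)
  finally show ?thesis using assms(2,3) by simp
qed

text \<open>The two-sided exponential Markov bound, stated at a point so that it can be integrated
  and averaged over the sample alike.\<close>

lemma of_bool_le_exp:
  fixes s \<kappa> a :: real
  assumes "0 \<le> \<kappa>"
  shows "of_bool (a \<le> \<bar>s\<bar>) \<le> exp (- \<kappa> * a) * (exp (\<kappa> * s) + exp (- \<kappa> * s))"
proof (cases "a \<le> \<bar>s\<bar>")
  case True
  have "exp (\<kappa> * a) \<le> exp (\<kappa> * \<bar>s\<bar>)"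
    using True assms by (simp add: mult_left_mono)
  also have "\<dots> \<le> exp (\<kappa> * s) + exp (- \<kappa> * s)"
    by (cases "0 \<le> s") (simp_all add: abs_if)
  finally have "exp (- \<kappa> * a) * exp (\<kappa> * a) \<le> exp (- \<kappa> * a) * (exp (\<kappa> * s) + exp (- \<kappa> * s))"
    by (intro mult_left_mono) auto
  with True show ?thesis by (simp flip: exp_add)
qed simp

context prob_space
begin

text \<open>Maurey's empirical approximation of a convex combination, with exponential tails
  both for the measure and for the sample; the atoms are chosen greedily.\<close>

lemma convex_combination_mean_exp:
  fixes \<phi> :: "'i \<Rightarrow> 'a \<Rightarrow> real" and w :: "'i \<Rightarrow> real"
  assumes fin: "finite I" and w: "\<And>i. i \<in> I \<Longrightarrow> 0 \<le> w i" "sum w I = 1"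
    and meas: "\<And>i. i \<in> I \<Longrightarrow> \<phi> i \<in> borel_measurable M"
    and bd: "\<And>i x. i \<in> I \<Longrightarrow> x \<in> space M \<Longrightarrow> \<bar>\<phi> i x\<bar> \<le> 1"
    and \<xi>: "set \<xi> \<subseteq> space M" and \<kappa>: "0 \<le> \<kappa>" "2 * \<kappa> \<le> 1"
  defines "f \<equiv> \<lambda>x. \<Sum>i\<in>I. w i * \<phi> i x"
  defines "F \<equiv> \<lambda>ks x. exp (\<kappa> * (\<Sum>k\<leftarrow>ks. \<phi> k x - f x)) + exp (- \<kappa> * (\<Sum>k\<leftarrow>ks. \<phi> k x - f x))"
  shows "\<exists>ks. length ks = n \<and> set ks \<subseteq> I \<and> integrable M (F ks) \<and>
    expectation (F ks) + avg \<xi> (F ks) \<le> 4 * exp (4 * real n * \<kappa>\<^sup>2)"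
proof -
  let ?S = "\<lambda>ks x. \<Sum>k\<leftarrow>ks. \<phi> k x - f x"
  have f: "f \<in> borel_measurable M" unfolding f_def using meas by measurable
  have fb: "\<bar>f x\<bar> \<le> 1" if "x \<in> space M" for x
  proof -
    have "\<bar>f x\<bar> \<le> (\<Sum>i\<in>I. w i * 1)"
      unfolding f_def using w(1) bd[OF _ that]
      by (intro order.trans[OF sum_abs] sum_mono) (simp add: abs_mult mult_left_le)
    then show ?thesis using w(2) by simp
  qed
  have S: "?S ks \<in> borel_measurable M" if "set ks \<subseteq> I" for ks
    using that by (induction ks) (use meas f in \<open>auto\<close>)
  have Sb: "\<bar>?S ks x\<bar> \<le> 2 * real (length ks)" if "set ks \<subseteq> I" "x \<in> space M" for ks x
    using that(1)
  proof (induction ks)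
    case (Cons k ks)
    then show ?case using bd[of k x] fb[of x] that(2) by (auto simp: abs_le_iff)
  qed simp
  have int: "integrable M (F ks)" if ks: "set ks \<subseteq> I" for ks
  proof (rule integrable_of_bounded)
    show "F ks \<in> borel_measurable M" unfolding F_def using S[OF ks] by measurable
    fix x assume "x \<in> space M"
    then have "\<kappa> * \<bar>?S ks x\<bar> \<le> \<kappa> * (2 * real (length ks))"
      using Sb[OF ks] \<kappa> by (intro mult_left_mono) auto
    then have "\<bar>\<kappa> * ?S ks x\<bar> \<le> \<kappa> * (2 * real (length ks))" using \<kappa> by (simp add: abs_mult)
    then have "exp (\<kappa> * ?S ks x) \<le> exp (\<kappa> * (2 * real (length ks)))"
      "exp (- \<kappa> * ?S ks x) \<le> exp (\<kappa> * (2 * real (length ks)))"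
      by (auto simp: abs_le_iff)
    moreover have "\<bar>F ks x\<bar> = exp (\<kappa> * ?S ks x) + exp (- \<kappa> * ?S ks x)"
      unfolding F_def by (intro abs_of_nonneg add_nonneg_nonneg) auto
    ultimately show "\<bar>F ks x\<bar> \<le> 2 * exp (\<kappa> * (2 * real (length ks)))" by linarith
  qed
  show ?thesis
  proof (induction n)
    case 0
    \<comment> \<open>For the empty tuple expectation and sample average contribute at most 2 each,
      hence the factor 4.\<close>
    have "F [] = (\<lambda>x. 2)" by (simp add: F_def fun_eq_iff)
    then show ?case using avg_const_le[of 2 \<xi>] int[of "[]"] by (simp add: prob_space)
  next
    case (Suc n)
    then obtain ks where ks: "length ks = n" "set ks \<subseteq> I"
      and le: "expectation (F ks) + avg \<xi> (F ks) \<le> 4 * exp (4 * real n * \<kappa>\<^sup>2)" by blast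
    let ?c = "exp (4 * \<kappa>\<^sup>2)"
    \<comment> \<open>Averaged over the next atom with the weights \<open>w\<close>, the exponential
      moment grows by at most the factor \<open>?c\<close> at every point. Some single atom
      therefore achieves this for the sum of expectation and sample average.\<close>
    have pt: "(\<Sum>i\<in>I. w i * F (i # ks) x) \<le> ?c * F ks x" if x: "x \<in> space M" for x
    proof -
      have mean: "(\<Sum>i\<in>I. w i * (\<phi> i x - f x)) = 0"
        using w(2) by (simp add: right_diff_distrib sum_subtractf f_def flip: sum_distrib_right)
      have y2: "\<And>i. i \<in> I \<Longrightarrow> \<bar>\<phi> i x - f x\<bar> \<le> 2"
        using bd[OF _ x] fb[OF x] by fastforce
      have le1: "(\<Sum>i\<in>I. w i * exp (\<kappa> * (\<phi> i x - f x))) \<le> ?c"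
        using \<kappa> by (intro weighted_exp_le w mean y2) auto
      have le2: "(\<Sum>i\<in>I. w i * exp (- \<kappa> * (\<phi> i x - f x))) \<le> ?c"
        using weighted_exp_le[OF w mean y2, of "- \<kappa>"] \<kappa> by simp
      have "(\<Sum>i\<in>I. w i * F (i # ks) x)
        = (\<Sum>i\<in>I. exp (\<kappa> * ?S ks x) * (w i * exp (\<kappa> * (\<phi> i x - f x)))
           + exp (- \<kappa> * ?S ks x) * (w i * exp (- \<kappa> * (\<phi> i x - f x))))"
      proof (rule sum.cong[OF refl])
        fix i
        have "exp (\<mu> * ?S (i # ks) x) = exp (\<mu> * ?S ks x) * exp (\<mu> * (\<phi> i x - f x))" for \<mu> :: real
          by (simp add: distrib_left flip: exp_add)
        then show "w i * F (i # ks) x = exp (\<kappa> * ?S ks x) * (w i * exp (\<kappa> * (\<phi> i x - f x)))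
           + exp (- \<kappa> * ?S ks x) * (w i * exp (- \<kappa> * (\<phi> i x - f x)))"
          unfolding F_def by (simp only: distrib_left mult.left_commute)
      qed
      also have "\<dots> = exp (\<kappa> * ?S ks x) * (\<Sum>i\<in>I. w i * exp (\<kappa> * (\<phi> i x - f x)))
           + exp (- \<kappa> * ?S ks x) * (\<Sum>i\<in>I. w i * exp (- \<kappa> * (\<phi> i x - f x)))"
        by (simp only: sum.distrib sum_distrib_left)
      also have "\<dots> \<le> exp (\<kappa> * ?S ks x) * ?c + exp (- \<kappa> * ?S ks x) * ?c"
        using le1 le2 by (intro add_mono mult_left_mono) auto
      finally show ?thesis by (simp add: F_def distrib_left distrib_right mult.commute)
    qed
    have Fi: "integrable M (F (i # ks))" if "i \<in> I" for i
      using int[of "i # ks"] ks(2) that by simp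
    have "(\<Sum>i\<in>I. w i * (expectation (F (i # ks)) + avg \<xi> (F (i # ks))))
      = expectation (\<lambda>x. \<Sum>i\<in>I. w i * F (i # ks) x) + avg \<xi> (\<lambda>x. \<Sum>i\<in>I. w i * F (i # ks) x)"
      using Fi by (simp add: avg_sum avg_cmult distrib_left sum.distrib)
    also have "\<dots> \<le> expectation (\<lambda>x. ?c * F ks x) + avg \<xi> (\<lambda>x. ?c * F ks x)"
      using Fi int[OF ks(2)] pt \<xi> by (intro add_mono integral_mono avg_mono) auto
    also have "\<dots> = ?c * (expectation (F ks) + avg \<xi> (F ks))"
      using int[OF ks(2)] by (simp add: avg_cmult distrib_left)
    also have "\<dots> \<le> ?c * (4 * exp (4 * real n * \<kappa>\<^sup>2))"
      using le by (intro mult_left_mono) auto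
    also have "\<dots> = 4 * exp (4 * real (Suc n) * \<kappa>\<^sup>2)"
      by (simp add: algebra_simps flip: exp_add)
    finally have "\<exists>i\<in>I. expectation (F (i # ks)) + avg \<xi> (F (i # ks)) \<le> 4 * exp (4 * real (Suc n) * \<kappa>\<^sup>2)"
      by (intro exists_le_weighted_mean[of I w] fin w)
    then obtain i where "i \<in> I"
      "expectation (F (i # ks)) + avg \<xi> (F (i # ks)) \<le> 4 * exp (4 * real (Suc n) * \<kappa>\<^sup>2)"
      by blast
    then show ?case using ks Fi by (intro exI[of _ "i # ks"]) auto
  qed
qed

text \<open>Markov's inequality for the exponential moment. One tuple serves both the measure and
  the sample, since the sum of two nonnegative quantities was controlled.\<close>

lemma convex_combination_approx:
  fixes \<phi> :: "'i \<Rightarrow> 'a \<Rightarrow> real" and w :: "'i \<Rightarrow> real"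
  assumes fin: "finite I" and w: "\<And>i. i \<in> I \<Longrightarrow> 0 \<le> w i" "sum w I = 1"
    and meas: "\<And>i. i \<in> I \<Longrightarrow> \<phi> i \<in> borel_measurable M"
    and bd: "\<And>i x. i \<in> I \<Longrightarrow> x \<in> space M \<Longrightarrow> \<bar>\<phi> i x\<bar> \<le> 1"
    and \<xi>: "set \<xi> \<subseteq> space M" and T: "0 < T" "T \<le> 1" and n: "1 \<le> n"
  defines "D \<equiv> \<lambda>ks x. of_bool (T / 4 \<le> \<bar>(\<Sum>i\<in>I. w i * \<phi> i x) - (\<Sum>k\<leftarrow>ks. \<phi> k x) / real n\<bar>) :: real"
  shows "\<exists>ks. length ks = n \<and> set ks \<subseteq> I \<and>
    expectation (D ks) \<le> 4 * exp (- real n * T\<^sup>2 / 256) \<and>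
    avg \<xi> (D ks) \<le> 4 * exp (- real n * T\<^sup>2 / 256)"
proof -
  define f where "f = (\<lambda>x. \<Sum>i\<in>I. w i * \<phi> i x)"
  \<comment> \<open>This value minimises the exponent 4 n \<kappa>^2 - \<kappa> n T / 4; the minimum
    is - n T^2 / 256.\<close>
  define \<kappa> where "\<kappa> = T / 32"
  define F where "F = (\<lambda>ks x. exp (\<kappa> * (\<Sum>k\<leftarrow>ks. \<phi> k x - f x)) + exp (- \<kappa> * (\<Sum>k\<leftarrow>ks. \<phi> k x - f x)))"
  have l: "0 \<le> \<kappa>" "2 * \<kappa> \<le> 1" using T by (auto simp: \<kappa>_def)
  have "\<exists>ks. length ks = n \<and> set ks \<subseteq> I \<and> integrable M (F ks) \<and>
    expectation (F ks) + avg \<xi> (F ks) \<le> 4 * exp (4 * real n * \<kappa>\<^sup>2)"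
    unfolding F_def f_def by (intro convex_combination_mean_exp fin w meas bd \<xi> l)
  then obtain ks where ks: "length ks = n" "set ks \<subseteq> I" and F: "integrable M (F ks)"
    and le: "expectation (F ks) + avg \<xi> (F ks) \<le> 4 * exp (4 * real n * \<kappa>\<^sup>2)"
    by blast
  let ?e = "exp (- \<kappa> * (real n * T / 4))"
  have f: "f \<in> borel_measurable M" unfolding f_def using meas by measurable
  have g: "(\<lambda>x. \<Sum>k\<leftarrow>ks. \<phi> k x) \<in> borel_measurable M"
    using ks(2) by (induction ks) (use meas in \<open>auto\<close>)
  have D: "D ks x \<le> ?e * F ks x" for x
  proof -
    have "(\<Sum>k\<leftarrow>ks. \<phi> k x - f x) = (\<Sum>k\<leftarrow>ks. \<phi> k x) - real n * f x"
      using ks(1) by (simp add: sum_list_subtractf sum_list_triv)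
    also have "\<dots> = - (real n * (f x - (\<Sum>k\<leftarrow>ks. \<phi> k x) / real n))"
      using n by (simp add: right_diff_distrib)
    finally have "\<bar>\<Sum>k\<leftarrow>ks. \<phi> k x - f x\<bar> = real n * \<bar>f x - (\<Sum>k\<leftarrow>ks. \<phi> k x) / real n\<bar>"
      by (simp add: abs_mult)
    then have "D ks x = of_bool (real n * T / 4 \<le> \<bar>\<Sum>k\<leftarrow>ks. \<phi> k x - f x\<bar>)"
      using n by (simp add: D_def f_def field_simps)
    then show ?thesis unfolding F_def by (simp only: of_bool_le_exp[OF l(1)])
  qed
  have pos: "0 \<le> F ks x" for x by (simp add: F_def)
  have Dm: "D ks \<in> borel_measurable M"
    using f g unfolding D_def f_def by measurable
  then have Di: "integrable M (D ks)"
    by (intro integrable_of_bounded[where B=1]) (auto simp: D_def)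
  have "?e * (4 * exp (4 * real n * \<kappa>\<^sup>2)) = 4 * exp (- real n * T\<^sup>2 / 256)"
    by (simp add: \<kappa>_def power2_eq_square field_simps flip: exp_add)
  moreover have "?e * (expectation (F ks) + avg \<xi> (F ks)) \<le> ?e * (4 * exp (4 * real n * \<kappa>\<^sup>2))"
    using le by (intro mult_left_mono) auto
  moreover have "expectation (D ks) \<le> ?e * expectation (F ks)"
    using integral_mono[OF Di, of "\<lambda>x. ?e * F ks x"] F D by simp
  moreover have "avg \<xi> (D ks) \<le> ?e * avg \<xi> (F ks)"
    using avg_mono[of \<xi> "D ks" "\<lambda>x. ?e * F ks x"] D by (simp add: avg_cmult)
  moreover have "0 \<le> ?e * expectation (F ks)" "0 \<le> ?e * avg \<xi> (F ks)"
    using pos avg_nonneg[of \<xi> "F ks"] by (auto intro!: mult_nonneg_nonneg)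
  ultimately show ?thesis using ks
    by (intro exI[of _ ks]) (auto simp: distrib_left)
qed

end

section \<open>Discretization of second moments\<close>

text \<open>If 2^-i is the largest level not above y, then y is at most 2 * 2^-i, so the single term
  4 * 4^-i dominates y^2. Below the last level the error is at most 4^-L.\<close>

lemma square_le_dyadic_levels:
  fixes y :: real
  assumes "0 \<le> y" "y \<le> 1"
  shows "y\<^sup>2 \<le> (1/4)^L + 4 * (\<Sum>i\<le>L. (1/4)^i * of_bool ((1/2)^i \<le> y))"
proof (induction L)
  case 0
  have "y\<^sup>2 \<le> 1" using assms by (simp add: power_le_one)
  then show ?case by simp
next
  case (Suc L)
  show ?case
  proof (cases "(1/2)^Suc L \<le> y")
    case True
    have "(1/4)^L = 4 * (1/4 :: real)^Suc L" by simp
    moreover have "0 \<le> (1/4 :: real)^Suc L" by simp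
    ultimately have "y\<^sup>2 \<le> (1/4)^Suc L + (4 * (\<Sum>i\<le>L. (1/4)^i * of_bool ((1/2)^i \<le> y)) + 4 * (1/4)^Suc L)"
      using Suc.IH by linarith
    then show ?thesis using True by (simp only: sum.atMost_Suc distrib_left of_bool_eq mult_1_right)
  next
    case False
    then have "y\<^sup>2 \<le> ((1/2)^Suc L)\<^sup>2" using assms by (intro power_mono) auto
    also have "\<dots> = (1/4)^Suc L" by (simp add: power2_eq_square flip: power_mult_distrib)
    finally show ?thesis by (rule order.trans) (simp add: sum_nonneg)
  qed
qed

text \<open>The halved thresholds leave room for replacing f by tuples. The levels with 2^-i at most
  2 y form a geometric series with sum at most 4/3 * (2 y)^2.\<close>

lemma dyadic_levels_le_square:
  fixes y :: real
  assumes "0 \<le> y"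
  shows "(\<Sum>i\<le>L. (1/4)^i * of_bool ((1/2)^i / 2 \<le> y)) \<le> 16/3 * y\<^sup>2"
proof -
  define s where "s = (\<lambda>L. \<Sum>i\<le>L. (1/4 :: real)^i * of_bool ((1/2)^i / 2 \<le> y))"
  have sq: "(1/4)^L / 4 \<le> y\<^sup>2" if "(1/2)^L / 2 \<le> y" for L
  proof -
    have "((1/2)^L / 2)\<^sup>2 \<le> y\<^sup>2" using that by (intro power_mono) auto
    moreover have "((1/2)^L / 2)\<^sup>2 = (1/4 :: real)^L / 4"
      by (simp add: power_divide power2_eq_square flip: power_mult_distrib)
    ultimately show ?thesis by simp
  qed
  \<comment> \<open>The subtracted term (1/4)^L / 3 is the tail of the series beyond L; carrying it
    along makes the bound inductive.\<close>
  have "if (1/2)^L / 2 \<le> y then s L \<le> 16/3 * y\<^sup>2 - 1/3 * (1/4)^L else s L = 0" for L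
  proof (induction L)
    case 0
    show ?case using sq[of 0] by (auto simp: s_def)
  next
    case (Suc L)
    have s: "s (Suc L) = s L + (1/4)^Suc L * of_bool ((1/2)^Suc L / 2 \<le> y)"
      unfolding s_def by (rule sum.atMost_Suc)
    have q: "(1/4 :: real)^Suc L = (1/4)^L / 4" "(1/2 :: real)^Suc L = (1/2)^L / 2"
      "0 < (1/2 :: real)^L" by auto
    show ?case
    proof (cases "(1/2)^Suc L / 2 \<le> y")
      case True
      show ?thesis
      proof (cases "(1/2)^L / 2 \<le> y")
        case T: True
        then have "s L \<le> 16/3 * y\<^sup>2 - 1/3 * (1/4)^L" using Suc.IH by simp
        then show ?thesis using True s q by simp
      next
        case False
        then have "s L = 0" using Suc.IH by simp
        then show ?thesis using True s sq[OF True] q by simp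
      qed
    next
      case False
      moreover have "\<not> (1/2)^L / 2 \<le> y" using False q by linarith
      ultimately show ?thesis using Suc.IH s by simp
    qed
  qed
  from this[of L] have "s L \<le> 16/3 * y\<^sup>2 - 1/3 * (1/4)^L \<or> s L = 0"
    by (auto split: if_splits)
  moreover have "0 \<le> 1/3 * (1/4 :: real)^L" "0 \<le> 16/3 * y\<^sup>2" by auto
  ultimately show ?thesis unfolding s_def by linarith
qed

text \<open>The constants: 4 * 2 * 16/3 is below 43, and the cut at level L, the slacks \<tau> and
  the approximation errors contribute \<delta> / 4 each.\<close>

lemma square_le_of_levels:
  fixes X Y \<delta> :: real and u v \<tau> :: "nat \<Rightarrow> real"
  assumes X: "X \<le> (1/4)^L + 4 * (\<Sum>i\<le>L. (1/4)^i * u i)"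
    and u: "\<And>i. i \<le> L \<Longrightarrow> u i \<le> 2 * v i + 2 * \<tau> i + 3 * \<delta> / 64"
    and Y: "(\<Sum>i\<le>L. (1/4)^i * v i) \<le> 16/3 * Y" "0 \<le> Y"
    and \<tau>: "\<And>i. (1/4)^i * \<tau> i = \<delta> / (32 * (real L + 1))"
    and L: "(1/4)^L \<le> \<delta> / 4" and \<delta>: "0 < \<delta>"
  shows "X \<le> 43 * Y + \<delta>"
proof -
  have "(\<Sum>i\<le>L. (1/4)^i * u i) \<le> (\<Sum>i\<le>L. (1/4)^i * (2 * v i + 2 * \<tau> i + 3 * \<delta> / 64))"
    by (intro sum_mono mult_left_mono u) auto
  also have "\<dots> = 2 * (\<Sum>i\<le>L. (1/4)^i * v i) + 2 * (\<Sum>i\<le>L. (1/4)^i * \<tau> i)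
      + 3 * \<delta> / 64 * (\<Sum>i\<le>L. (1/4)^i)"
    by (simp add: sum.distrib sum_distrib_left algebra_simps)
  also have "(\<Sum>i\<le>L. (1/4)^i * \<tau> i) = \<delta> / 32"
  proof -
    have "(\<Sum>i\<le>L. (1/4)^i * \<tau> i) = (real L + 1) * (\<delta> / (32 * (real L + 1)))"
      unfolding \<tau> by simp
    also have "\<dots> = \<delta> / 32"
      by (simp add: field_simps)
    finally show ?thesis .
  qed
  also have "(\<Sum>i\<le>L. (1/4 :: real)^i) \<le> 4/3"
  proof -
    have "(\<Sum>i\<le>L. (1/4 :: real)^i) = 4/3 - (1/4)^L / 3"
      by (induction L) simp_all
    moreover have "0 \<le> (1/4 :: real)^L" by simp
    ultimately show ?thesis by linarith
  qed
  finally have "(\<Sum>i\<le>L. (1/4)^i * u i) \<le> 2 * (16/3 * Y) + 2 * (\<delta> / 32) + 3 * \<delta> / 64 * (4/3)"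
    using Y(1) \<delta> by simp
  with X L Y(2) \<delta> show ?thesis by linarith
qed

lemma of_bool_le_add: "(P \<Longrightarrow> Q \<or> R) \<Longrightarrow> of_bool P \<le> (of_bool Q + of_bool R :: real)"
  by (cases P; cases Q; cases R) simp_all

lemma avg_le_affine_sum:
  fixes c :: "'i \<Rightarrow> real"
  assumes "0 \<le> a" "\<And>x. x \<in> set \<xi> \<Longrightarrow> F x \<le> a + b * (\<Sum>i\<in>I. c i * q i x)"
  shows "avg \<xi> F \<le> a + b * (\<Sum>i\<in>I. c i * avg \<xi> (q i))"
proof -
  have "avg \<xi> F \<le> avg \<xi> (\<lambda>x. a + b * (\<Sum>i\<in>I. c i * q i x))"
    by (intro avg_mono assms(2))
  also have "\<dots> = avg \<xi> (\<lambda>x. a) + b * (\<Sum>i\<in>I. c i * avg \<xi> (q i))"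
    by (simp add: avg_add avg_cmult avg_sum)
  finally show ?thesis using avg_const_le[OF assms(1), of \<xi>] by simp
qed

lemma sum_avg_le:
  fixes c :: "'i \<Rightarrow> real"
  assumes "\<And>x. (\<Sum>i\<in>I. c i * q i x) \<le> b * F x"
  shows "(\<Sum>i\<in>I. c i * avg \<xi> (q i)) \<le> b * avg \<xi> F"
proof -
  have "avg \<xi> (\<lambda>x. \<Sum>i\<in>I. c i * q i x) \<le> avg \<xi> (\<lambda>x. b * F x)"
    by (intro avg_mono assms)
  then show ?thesis by (simp add: avg_cmult avg_sum)
qed

section \<open>One sample for all linear combinations with bounded coefficient sum\<close>

context prob_space
begin

lemma expectation_le_affine_sum:
  fixes c :: "'i \<Rightarrow> real"
  assumes "integrable M F" "\<And>i. integrable M (q i)"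
    "\<And>x. x \<in> space M \<Longrightarrow> F x \<le> a + b * (\<Sum>i\<in>I. c i * q i x)"
  shows "expectation F \<le> a + b * (\<Sum>i\<in>I. c i * expectation (q i))"
proof -
  have "expectation F \<le> expectation (\<lambda>x. a + b * (\<Sum>i\<in>I. c i * q i x))"
    using assms by (intro integral_mono) auto
  also have "\<dots> = a + b * (\<Sum>i\<in>I. c i * expectation (q i))"
    using assms(2) by (simp add: prob_space)
  finally show ?thesis .
qed

lemma sum_expectation_le:
  fixes c :: "'i \<Rightarrow> real"
  assumes "integrable M F" "\<And>i. integrable M (q i)" "\<And>x. (\<Sum>i\<in>I. c i * q i x) \<le> b * F x"
  shows "(\<Sum>i\<in>I. c i * expectation (q i)) \<le> b * expectation F"
proof -
  have "expectation (\<lambda>x. \<Sum>i\<in>I. c i * q i x) \<le> expectation (\<lambda>x. b * F x)"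
    using assms by (intro integral_mono) auto
  then show ?thesis using assms(1,2) by simp
qed

text \<open>The sample is chosen for the finite family of all tuples of all levels. An arbitrary
  convex combination is then compared, level by level, with a tuple chosen afterwards.\<close>

lemma exists_points_discretization_convex:
  fixes \<phi> :: "'i \<Rightarrow> 'a \<Rightarrow> real" and \<delta> :: real
  assumes fin: "finite I" "I \<noteq> {}"
    and meas: "\<And>i. i \<in> I \<Longrightarrow> \<phi> i \<in> borel_measurable M"
    and bd: "\<And>i x. i \<in> I \<Longrightarrow> x \<in> space M \<Longrightarrow> \<bar>\<phi> i x\<bar> \<le> 1"
    and \<delta>: "0 < \<delta>" "\<delta> \<le> 1" and L: "(1/4)^L \<le> \<delta> / 4"
    and m: "32 * (real L + 1) * (257 * ln (256 / \<delta>) * ln (real (card I)) + ln (2 * (real L + 1)))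
      < real m * \<delta>"
  shows "\<exists>\<xi>. length \<xi> = m \<and> set \<xi> \<subseteq> space M \<and>
    (\<forall>w. (\<forall>i\<in>I. 0 \<le> w i) \<and> sum w I = 1 \<longrightarrow>
      expectation (\<lambda>x. (\<Sum>i\<in>I. w i * \<phi> i x)\<^sup>2) \<le> 43 * avg \<xi> (\<lambda>x. (\<Sum>i\<in>I. w i * \<phi> i x)\<^sup>2) + \<delta> \<and>
      avg \<xi> (\<lambda>x. (\<Sum>i\<in>I. w i * \<phi> i x)\<^sup>2) \<le> 43 * expectation (\<lambda>x. (\<Sum>i\<in>I. w i * \<phi> i x)\<^sup>2) + \<delta>)"
proof -
  define N where "N = card I"
  define l where "l = ln (256 / \<delta>)"
  \<comment> \<open>At T = 2^-i this length makes the approximation bound 4 exp (- n T^2 / 256) at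
    most \<delta> / 64.\<close>
  define n where "n = (\<lambda>i. nat \<lceil>256 * 4^i * l\<rceil>)"
  \<comment> \<open>Level i enters the second moment with weight 4^-i, so all L + 1 levels
    contribute the same slack, \<delta> / 32 in total.\<close>
  define \<tau> where "\<tau> = (\<lambda>i. 4^i * \<delta> / (32 * (real L + 1)))"
  define G where "G = (SIGMA i:{..L}. {ks. set ks \<subseteq> I \<and> length ks = n i})"
  \<comment> \<open>The threshold 3 T / 4 is intermediate: an error below T / 4 carries the level T
    of f to 3 T / 4 of the tuple, and 3 T / 4 of the tuple back to T / 2 of f.\<close>
  define B where "B = (\<lambda>(i, ks) x. of_bool (3/4 * (1/2)^i \<le> \<bar>(\<Sum>k\<leftarrow>ks. \<phi> k x) / real (n i)\<bar>) :: real)"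
  have N: "1 \<le> N" unfolding N_def using fin by (simp add: Suc_leI card_gt_0_iff)
  have "256 \<le> 256 / \<delta>" using \<delta> by (simp add: pos_le_divide_eq)
  then have "exp 1 \<le> 256 / \<delta>" using exp_le by linarith
  then have l1: "1 \<le> l" unfolding l_def using \<delta> by (subst ln_ge_iff) auto
  have n_ge: "256 * 4^i * l \<le> real (n i)" for i
    unfolding n_def by linarith
  have n_le: "real (n i) \<le> 257 * 4^i * l" for i
  proof -
    have "1 * 1 \<le> (4::real)^i * l" using l1 by (intro mult_mono) auto
    then have "0 \<le> 256 * 4^i * l" "256 * 4^i * l + 1 \<le> 257 * 4^i * l"
      unfolding mult.assoc by linarith+
    then show ?thesis unfolding n_def by linarith
  qed
  have n1: "1 \<le> n i" for i
  proof -
    have "0 < 256 * 4^i * l" using l1 by simp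
    then have "0 < real (n i)" using n_ge[of i] by linarith
    then show ?thesis by simp
  qed
  have lnN: "0 \<le> ln (real N)" using N by simp
  have m': "32 * (real L + 1) * (257 * l * ln (real N) + ln (2 * (real L + 1))) < real m * \<delta>"
    using m unfolding l_def N_def by simp
  have "0 \<le> 32 * (real L + 1) * (257 * l * ln (real N) + ln (2 * (real L + 1)))"
    using l1 lnN by (intro mult_nonneg_nonneg add_nonneg_nonneg) auto
  then have "0 < real m * \<delta>" using m' by linarith
  then have m1: "1 \<le> m" by (cases m) auto
  \<comment> \<open>Level i has N ^ n i tuples. Since n i and \<tau> i both scale with 4^i, one
    condition on m serves all levels, each with the share 1 / (L + 1) of the union bound.\<close>
  have small1: "real N ^ n i * (2 * exp (- real m * \<tau> i)) < 1 / (real L + 1)" for i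
  proof -
    have "257 * l * ln (real N) + ln (2 * (real L + 1)) < real m * \<delta> / (32 * (real L + 1))"
      using m' by (simp add: pos_less_divide_eq mult.commute)
    then have "4^i * (257 * l * ln (real N) + ln (2 * (real L + 1))) < 4^i * (real m * \<delta> / (32 * (real L + 1)))"
      by (intro mult_strict_left_mono) auto
    moreover have "4^i * (257 * l * ln (real N) + ln (2 * (real L + 1)))
      = 257 * 4^i * l * ln (real N) + 4^i * ln (2 * (real L + 1))"
      by (simp only: distrib_left mult_ac)
    moreover have "4^i * (real m * \<delta> / (32 * (real L + 1))) = real m * \<tau> i"
      by (simp add: \<tau>_def)
    moreover have "real (n i) * ln (real N) \<le> 257 * 4^i * l * ln (real N)"
      using n_le lnN by (intro mult_right_mono)
    moreover have "1 * ln (2 * (real L + 1)) \<le> 4^i * ln (2 * (real L + 1))"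
      by (intro mult_right_mono) auto
    ultimately have "real (n i) * ln (real N) + ln (2 * (real L + 1)) < real m * \<tau> i"
      by linarith
    then have "exp (real (n i) * ln (real N) + ln (2 * (real L + 1)) - real m * \<tau> i) < 1"
      by simp
    moreover have "exp (real (n i) * ln (real N) + ln (2 * (real L + 1)) - real m * \<tau> i)
      = real N ^ n i * (2 * (real L + 1)) * exp (- real m * \<tau> i)"
      using N by (simp add: exp_add exp_diff exp_minus exp_of_nat_mult divide_inverse)
    ultimately have "real N ^ n i * (2 * exp (- real m * \<tau> i)) * (real L + 1) < 1"
      by (simp only: mult_ac)
    then show ?thesis by (subst pos_less_divide_eq) auto
  qed
  have "(\<Sum>g\<in>G. 2 * exp (- real m * \<tau> (fst g)))
    = (\<Sum>i\<le>L. \<Sum>ks\<in>{ks. set ks \<subseteq> I \<and> length ks = n i}. 2 * exp (- real m * \<tau> i))"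
    unfolding G_def using fin(1)
    by (subst sum.Sigma) (simp_all add: finite_lists_length_eq case_prod_unfold)
  also have "\<dots> = (\<Sum>i\<le>L. real N ^ n i * (2 * exp (- real m * \<tau> i)))"
    using fin(1) by (simp add: card_lists_length_eq N_def)
  also have "\<dots> < (\<Sum>i\<le>L. 1 / (real L + 1))"
    by (intro sum_strict_mono small1) auto
  also have "\<dots> = 1" by (simp add: field_simps)
  finally have small: "(\<Sum>g\<in>G. 2 * exp (- real m * \<tau> (fst g))) < 1" .
  have gm: "(\<lambda>x. \<Sum>k\<leftarrow>ks. \<phi> k x) \<in> borel_measurable M" if "set ks \<subseteq> I" for ks
    using that by (induction ks) (use meas in auto)
  have Bm: "B g \<in> borel_measurable M" if gG: "g \<in> G" for g
  proof -
    obtain i ks where g: "g = (i, ks)" "set ks \<subseteq> I" using gG by (auto simp: G_def)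
    note [measurable] = gm[OF g(2)]
    show ?thesis unfolding B_def g(1) prod.case by measurable
  qed
  have "\<exists>\<xi>. length \<xi> = m \<and> set \<xi> \<subseteq> space M \<and>
    (\<forall>g\<in>G. avg \<xi> (B g) \<le> 2 * expectation (B g) + \<tau> (fst g) \<and>
            expectation (B g) \<le> 2 * avg \<xi> (B g) + 2 * \<tau> (fst g))"
  proof (rule exists_points_frequency)
    show "finite G" unfolding G_def using fin(1) by (auto simp: finite_lists_length_eq)
    show "0 \<le> B g x \<and> B g x \<le> 1" for g x by (cases g) (simp add: B_def)
  qed (use m1 Bm small in auto)
  then obtain \<xi> where \<xi>: "length \<xi> = m" "set \<xi> \<subseteq> space M"
    and freq: "\<And>g. g \<in> G \<Longrightarrow> avg \<xi> (B g) \<le> 2 * expectation (B g) + \<tau> (fst g)"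
      "\<And>g. g \<in> G \<Longrightarrow> expectation (B g) \<le> 2 * avg \<xi> (B g) + 2 * \<tau> (fst g)"
    by blast
  show ?thesis
  proof (intro exI[of _ \<xi>] conjI[OF \<xi>(1)] conjI[OF \<xi>(2)] allI impI)
    fix w :: "'i \<Rightarrow> real" assume "(\<forall>i\<in>I. 0 \<le> w i) \<and> sum w I = 1"
    then have w: "\<And>i. i \<in> I \<Longrightarrow> 0 \<le> w i" "sum w I = 1" by auto
    define f where "f = (\<lambda>x. \<Sum>i\<in>I. w i * \<phi> i x)"
    have fm [measurable]: "f \<in> borel_measurable M" unfolding f_def using meas by measurable
    have fb: "\<bar>f x\<bar> \<le> 1" if x: "x \<in> space M" for x
    proof -
      have "\<bar>f x\<bar> \<le> (\<Sum>i\<in>I. w i * 1)"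
        unfolding f_def using w(1) bd[OF _ x]
        by (intro order.trans[OF sum_abs] sum_mono) (simp add: abs_mult mult_left_le)
      then show ?thesis using w(2) by simp
    qed
    define Q where "Q = (\<lambda>T x. of_bool (T \<le> \<bar>f x\<bar>) :: real)"
    have Qi [simp]: "integrable M (Q T)" for T
      by (rule integrable_of_bounded[where B=1]) (auto simp: Q_def)
    \<comment> \<open>The approximation error \<delta> / 64 occurs once in passing from f to the
      tuple and once more, under the factor 2 of the frequency bound, in passing back: together 3
      \<delta> / 64.\<close>
    have level: "expectation (Q ((1/2)^i)) \<le> 2 * avg \<xi> (Q ((1/2)^i / 2)) + 2 * \<tau> i + 3 * \<delta> / 64"
      "avg \<xi> (Q ((1/2)^i)) \<le> 2 * expectation (Q ((1/2)^i / 2)) + 2 * \<tau> i + 3 * \<delta> / 64"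
      if i: "i \<le> L" for i
    proof -
      define T where "T = (1/2 :: real)^i"
      have T: "0 < T" "T \<le> 1" by (auto simp: T_def power_le_one)
      define D where "D = (\<lambda>ks x. of_bool (T / 4 \<le> \<bar>f x - (\<Sum>k\<leftarrow>ks. \<phi> k x) / real (n i)\<bar>) :: real)"
      \<comment> \<open>This tuple depends on \<open>w\<close> and on the sample, which is harmless
        because the sample controls every tuple in \<open>G\<close>.\<close>
      have "\<exists>ks. length ks = n i \<and> set ks \<subseteq> I \<and>
        expectation (D ks) \<le> 4 * exp (- real (n i) * T\<^sup>2 / 256) \<and>
        avg \<xi> (D ks) \<le> 4 * exp (- real (n i) * T\<^sup>2 / 256)"
        unfolding D_def f_def by (intro convex_combination_approx fin w meas bd \<xi> T n1)
      moreover have "4 * exp (- real (n i) * T\<^sup>2 / 256) \<le> \<delta> / 64"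
      proof -
        have "256 * 4^i * l * T\<^sup>2 \<le> real (n i) * T\<^sup>2" by (intro mult_right_mono n_ge) auto
        moreover have "4^i * T\<^sup>2 = 1"
          by (simp add: T_def power2_eq_square flip: power_mult_distrib)
        ultimately have "256 * l \<le> real (n i) * T\<^sup>2" by (metis mult.assoc mult.commute mult_1_right)
        then have "exp (- real (n i) * T\<^sup>2 / 256) \<le> exp (- l)" by simp
        also have "\<dots> = \<delta> / 256" using \<delta> by (simp add: l_def exp_minus)
        finally show ?thesis by simp
      qed
      ultimately obtain ks where ks: "length ks = n i" "set ks \<subseteq> I"
        and D: "expectation (D ks) \<le> \<delta> / 64" "avg \<xi> (D ks) \<le> \<delta> / 64"
        by force
      note [measurable] = gm[OF ks(2)]
      have g: "(i, ks) \<in> G" using ks i by (simp add: G_def)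
      have [simp]: "integrable M (D ks)"
        by (rule integrable_of_bounded[where B=1]) (auto simp: D_def)
      have [simp]: "integrable M (B (i, ks))"
        using Bm[OF g] by (rule integrable_of_bounded[where B=1]) (auto simp: B_def)
      have near: "T \<le> \<bar>a\<bar> \<Longrightarrow> 3/4 * T \<le> \<bar>b\<bar> \<or> T / 4 \<le> \<bar>a - b\<bar>"
        "3/4 * T \<le> \<bar>b\<bar> \<Longrightarrow> T / 2 \<le> \<bar>a\<bar> \<or> T / 4 \<le> \<bar>a - b\<bar>" for a b :: real
        by (rule disjCI; linarith)+
      have p1: "Q T x \<le> B (i, ks) x + D ks x" for x
        unfolding Q_def B_def D_def T_def[symmetric] prod.case by (rule of_bool_le_add near(1))+
      have p2: "B (i, ks) x \<le> Q (T / 2) x + D ks x" for x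
        unfolding Q_def B_def D_def T_def[symmetric] prod.case by (rule of_bool_le_add near(2))+
      have "expectation (Q T) \<le> expectation (B (i, ks)) + expectation (D ks)"
        using integral_mono[of M "Q T" "\<lambda>x. B (i, ks) x + D ks x"] p1 by simp
      moreover have "avg \<xi> (Q T) \<le> avg \<xi> (B (i, ks)) + avg \<xi> (D ks)"
        using avg_mono[of \<xi> "Q T" "\<lambda>x. B (i, ks) x + D ks x"] p1 by (simp add: avg_add)
      moreover have "expectation (B (i, ks)) \<le> expectation (Q (T / 2)) + expectation (D ks)"
        using integral_mono[of M "B (i, ks)" "\<lambda>x. Q (T / 2) x + D ks x"] p2 by simp
      moreover have "avg \<xi> (B (i, ks)) \<le> avg \<xi> (Q (T / 2)) + avg \<xi> (D ks)"
        using avg_mono[of \<xi> "B (i, ks)" "\<lambda>x. Q (T / 2) x + D ks x"] p2 by (simp add: avg_add)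
      moreover have "0 \<le> \<tau> i" using \<delta> by (simp add: \<tau>_def)
      moreover note freq[OF g] D
      ultimately show
        "expectation (Q ((1/2)^i)) \<le> 2 * avg \<xi> (Q ((1/2)^i / 2)) + 2 * \<tau> i + 3 * \<delta> / 64"
        "avg \<xi> (Q ((1/2)^i)) \<le> 2 * expectation (Q ((1/2)^i / 2)) + 2 * \<tau> i + 3 * \<delta> / 64"
        unfolding T_def[symmetric] by auto
    qed
    have f2i [simp]: "integrable M (\<lambda>x. (f x)\<^sup>2)"
      using fb by (intro integrable_of_bounded[where B=1]) (auto simp: abs_square_le_1)
    have up: "(f x)\<^sup>2 \<le> (1/4)^L + 4 * (\<Sum>i\<le>L. (1/4)^i * Q ((1/2)^i) x)" if "x \<in> space M" for x
      using square_le_dyadic_levels[OF abs_ge_zero fb[OF that], of L]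
      unfolding Q_def power2_abs .
    have low: "(\<Sum>i\<le>L. (1/4)^i * Q ((1/2)^i / 2) x) \<le> 16/3 * (f x)\<^sup>2" for x
      using dyadic_levels_le_square[OF abs_ge_zero, of "f x" L] unfolding Q_def power2_abs .
    have upE: "expectation (\<lambda>x. (f x)\<^sup>2) \<le> (1/4)^L + 4 * (\<Sum>i\<le>L. (1/4)^i * expectation (Q ((1/2)^i)))"
      by (rule expectation_le_affine_sum[OF f2i Qi up])
    have upA: "avg \<xi> (\<lambda>x. (f x)\<^sup>2) \<le> (1/4)^L + 4 * (\<Sum>i\<le>L. (1/4)^i * avg \<xi> (Q ((1/2)^i)))"
      using \<xi>(2) by (intro avg_le_affine_sum up) auto
    have lowE: "(\<Sum>i\<le>L. (1/4)^i * expectation (Q ((1/2)^i / 2))) \<le> 16/3 * expectation (\<lambda>x. (f x)\<^sup>2)"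
      by (rule sum_expectation_le[OF f2i Qi low])
    have lowA: "(\<Sum>i\<le>L. (1/4)^i * avg \<xi> (Q ((1/2)^i / 2))) \<le> 16/3 * avg \<xi> (\<lambda>x. (f x)\<^sup>2)"
      by (rule sum_avg_le[OF low])
    have \<tau>: "(1/4)^i * \<tau> i = \<delta> / (32 * (real L + 1))" for i
      by (simp add: \<tau>_def power_one_over)
    have "expectation (\<lambda>x. (f x)\<^sup>2) \<le> 43 * avg \<xi> (\<lambda>x. (f x)\<^sup>2) + \<delta>"
      by (rule square_le_of_levels[OF upE _ lowA _ \<tau> L \<delta>(1)], erule level(1), rule avg_nonneg, simp)
    moreover have "avg \<xi> (\<lambda>x. (f x)\<^sup>2) \<le> 43 * expectation (\<lambda>x. (f x)\<^sup>2) + \<delta>"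
      by (rule square_le_of_levels[OF upA _ lowE _ \<tau> L \<delta>(1)], erule level(2), simp)
    ultimately show "expectation (\<lambda>x. (\<Sum>i\<in>I. w i * \<phi> i x)\<^sup>2) \<le> 43 * avg \<xi> (\<lambda>x. (\<Sum>i\<in>I. w i * \<phi> i x)\<^sup>2) + \<delta> \<and>
      avg \<xi> (\<lambda>x. (\<Sum>i\<in>I. w i * \<phi> i x)\<^sup>2) \<le> 43 * expectation (\<lambda>x. (\<Sum>i\<in>I. w i * \<phi> i x)\<^sup>2) + \<delta>"
      unfolding f_def by simp
  qed
qed

text \<open>The l_1 unit ball is the convex hull of the atoms and their negatives, which doubles the
  number of atoms; scaling to l_1 norm A gives the factor A^2.\<close>

lemma exists_points_discretization_absconvex:
  fixes \<phi> :: "'i \<Rightarrow> 'a \<Rightarrow> real" and \<delta> :: real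
  assumes fin: "finite I" "I \<noteq> {}"
    and meas: "\<And>i. i \<in> I \<Longrightarrow> \<phi> i \<in> borel_measurable M"
    and bd: "\<And>i x. i \<in> I \<Longrightarrow> x \<in> space M \<Longrightarrow> \<bar>\<phi> i x\<bar> \<le> 1"
    and \<delta>: "0 < \<delta>" "\<delta> \<le> 1" and L: "(1/4)^L \<le> \<delta> / 4"
    and m: "32 * (real L + 1) * (257 * ln (256 / \<delta>) * ln (2 * real (card I)) + ln (2 * (real L + 1)))
      < real m * \<delta>"
  shows "\<exists>\<xi>. length \<xi> = m \<and> set \<xi> \<subseteq> space M \<and>
    (\<forall>c A. (\<Sum>i\<in>I. \<bar>c i\<bar>) \<le> A \<longrightarrow>
      expectation (\<lambda>x. (\<Sum>i\<in>I. c i * \<phi> i x)\<^sup>2) \<le> 43 * avg \<xi> (\<lambda>x. (\<Sum>i\<in>I. c i * \<phi> i x)\<^sup>2) + \<delta> * A\<^sup>2 \<and>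
      avg \<xi> (\<lambda>x. (\<Sum>i\<in>I. c i * \<phi> i x)\<^sup>2) \<le> 43 * expectation (\<lambda>x. (\<Sum>i\<in>I. c i * \<phi> i x)\<^sup>2) + \<delta> * A\<^sup>2)"
proof -
  define S where "S = {1, -1 :: real}"
  define \<phi>' where "\<phi>' = (\<lambda>(i, s) x. s * \<phi> i x)"
  have card: "real (card (I \<times> S)) = 2 * real (card I)"
    using fin(1) by (simp add: S_def card_cartesian_product)
  have "\<exists>\<xi>. length \<xi> = m \<and> set \<xi> \<subseteq> space M \<and>
    (\<forall>w. (\<forall>i\<in>I \<times> S. 0 \<le> w i) \<and> sum w (I \<times> S) = 1 \<longrightarrow>
      expectation (\<lambda>x. (\<Sum>i\<in>I \<times> S. w i * \<phi>' i x)\<^sup>2) \<le> 43 * avg \<xi> (\<lambda>x. (\<Sum>i\<in>I \<times> S. w i * \<phi>' i x)\<^sup>2) + \<delta> \<and>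
      avg \<xi> (\<lambda>x. (\<Sum>i\<in>I \<times> S. w i * \<phi>' i x)\<^sup>2) \<le> 43 * expectation (\<lambda>x. (\<Sum>i\<in>I \<times> S. w i * \<phi>' i x)\<^sup>2) + \<delta>)"
  proof (rule exists_points_discretization_convex[OF _ _ _ _ \<delta> L])
    show "finite (I \<times> S)" "I \<times> S \<noteq> {}" using fin by (auto simp: S_def)
    show "\<phi>' i \<in> borel_measurable M" if "i \<in> I \<times> S" for i
      using that meas by (auto simp: \<phi>'_def)
    show "\<bar>\<phi>' i x\<bar> \<le> 1" if "i \<in> I \<times> S" "x \<in> space M" for i x
      using that bd by (auto simp: \<phi>'_def S_def)
  qed (use m card in simp)
  then obtain \<xi> where \<xi>: "length \<xi> = m" "set \<xi> \<subseteq> space M"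
    and conv: "\<forall>w. (\<forall>i\<in>I \<times> S. 0 \<le> w i) \<and> sum w (I \<times> S) = 1 \<longrightarrow>
      expectation (\<lambda>x. (\<Sum>i\<in>I \<times> S. w i * \<phi>' i x)\<^sup>2) \<le> 43 * avg \<xi> (\<lambda>x. (\<Sum>i\<in>I \<times> S. w i * \<phi>' i x)\<^sup>2) + \<delta> \<and>
      avg \<xi> (\<lambda>x. (\<Sum>i\<in>I \<times> S. w i * \<phi>' i x)\<^sup>2) \<le> 43 * expectation (\<lambda>x. (\<Sum>i\<in>I \<times> S. w i * \<phi>' i x)\<^sup>2) + \<delta>"
    by (elim exE conjE)
  have unit: "expectation (\<lambda>x. (\<Sum>i\<in>I. c i * \<phi> i x)\<^sup>2) \<le> 43 * avg \<xi> (\<lambda>x. (\<Sum>i\<in>I. c i * \<phi> i x)\<^sup>2) + \<delta> \<and>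
      avg \<xi> (\<lambda>x. (\<Sum>i\<in>I. c i * \<phi> i x)\<^sup>2) \<le> 43 * expectation (\<lambda>x. (\<Sum>i\<in>I. c i * \<phi> i x)\<^sup>2) + \<delta>"
    if c: "(\<Sum>i\<in>I. \<bar>c i\<bar>) \<le> 1" for c
  proof -
    define e where "e = (1 - (\<Sum>i\<in>I. \<bar>c i\<bar>)) / (2 * real (card I))"
    \<comment> \<open>the missing mass \<open>e\<close> is spread over pairs of opposite atoms, where it cancels\<close>
    define w where "w = (\<lambda>(i, s). (\<bar>c i\<bar> + s * c i) / 2 + e)"
    have e: "0 \<le> e" using c by (simp add: e_def)
    have "0 \<le> w i" if "i \<in> I \<times> S" for i
      using that e by (auto simp: w_def S_def)
    moreover have "sum w (I \<times> S) = 1"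
    proof -
      have "sum w (I \<times> S) = (\<Sum>i\<in>I. \<Sum>s\<in>S. w (i, s))"
        by (simp add: sum.cartesian_product)
      also have "\<dots> = (\<Sum>i\<in>I. \<bar>c i\<bar> + 2 * e)"
        by (intro sum.cong refl) (simp add: S_def w_def field_simps)
      also have "\<dots> = (\<Sum>i\<in>I. \<bar>c i\<bar>) + real (card I) * (2 * e)" by (simp add: sum.distrib)
      also have "real (card I) * (2 * e) = 1 - (\<Sum>i\<in>I. \<bar>c i\<bar>)" using fin by (simp add: e_def)
      finally show ?thesis by simp
    qed
    moreover have "(\<Sum>i\<in>I \<times> S. w i * \<phi>' i x) = (\<Sum>i\<in>I. c i * \<phi> i x)" for x
    proof -
      have "(\<Sum>i\<in>I \<times> S. w i * \<phi>' i x) = (\<Sum>i\<in>I. \<Sum>s\<in>S. w (i, s) * \<phi>' (i, s) x)"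
        by (simp add: sum.cartesian_product)
      also have "\<dots> = (\<Sum>i\<in>I. c i * \<phi> i x)"
        by (intro sum.cong refl) (simp add: S_def w_def \<phi>'_def field_simps)
      finally show ?thesis .
    qed
    ultimately show ?thesis using conv[rule_format, of w] by simp
  qed
  show ?thesis
  proof (intro exI[of _ \<xi>] conjI[OF \<xi>(1)] conjI[OF \<xi>(2)] allI impI)
    fix c :: "'i \<Rightarrow> real" and A :: real
    assume A: "(\<Sum>i\<in>I. \<bar>c i\<bar>) \<le> A"
    show "expectation (\<lambda>x. (\<Sum>i\<in>I. c i * \<phi> i x)\<^sup>2) \<le> 43 * avg \<xi> (\<lambda>x. (\<Sum>i\<in>I. c i * \<phi> i x)\<^sup>2) + \<delta> * A\<^sup>2 \<and>
      avg \<xi> (\<lambda>x. (\<Sum>i\<in>I. c i * \<phi> i x)\<^sup>2) \<le> 43 * expectation (\<lambda>x. (\<Sum>i\<in>I. c i * \<phi> i x)\<^sup>2) + \<delta> * A\<^sup>2"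
    proof (cases "0 < A")
      case True
      define f where "f = (\<lambda>x. \<Sum>i\<in>I. c i / A * \<phi> i x)"
      have "(\<Sum>i\<in>I. \<bar>c i / A\<bar>) \<le> 1"
        using A True by (simp flip: sum_divide_distrib)
      note u = unit[OF this, folded f_def]
      have "(\<Sum>i\<in>I. c i * \<phi> i x) = A * f x" for x
        using True by (simp add: f_def sum_distrib_left)
      then have sq: "(\<lambda>x. (\<Sum>i\<in>I. c i * \<phi> i x)\<^sup>2) = (\<lambda>x. A\<^sup>2 * (f x)\<^sup>2)"
        by (simp add: power_mult_distrib)
      have fold: "(\<lambda>x. (\<Sum>i\<in>I. c i / A * \<phi> i x)\<^sup>2) = (\<lambda>x. (f x)\<^sup>2)" by (simp add: f_def)
      have A2: "0 \<le> A\<^sup>2" by simp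
      have "expectation (\<lambda>x. (f x)\<^sup>2) \<le> 43 * avg \<xi> (\<lambda>x. (f x)\<^sup>2) + \<delta>"
        "avg \<xi> (\<lambda>x. (f x)\<^sup>2) \<le> 43 * expectation (\<lambda>x. (f x)\<^sup>2) + \<delta>"
        using u unfolding fold by auto
      from this[THEN mult_left_mono[OF _ A2]] show ?thesis
        unfolding sq by (simp add: avg_cmult algebra_simps)
    next
      case False
      have nn: "0 \<le> (\<Sum>i\<in>I. \<bar>c i\<bar>)" by (simp add: sum_nonneg)
      then have A0: "A = 0" "(\<Sum>i\<in>I. \<bar>c i\<bar>) = 0" using A False by linarith+
      then have "\<forall>i\<in>I. c i = 0" using fin(1) by (simp add: sum_nonneg_eq_0_iff)
      then have "(\<Sum>i\<in>I. c i * \<phi> i x) = 0" for x by simp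
      then show ?thesis using A0(1) by (simp add: avg_def)
    qed
  qed
qed

text \<open>Real and imaginary parts of \<psi> serve as real atoms, so with signs there are 4 card I
  of them. Real and imaginary part of the sum both have coefficient sum at most 2 A and add an error
  \<delta> (2 A)^2 each.\<close>

lemma exists_points_discretization_complex:
  fixes \<psi> :: "'i \<Rightarrow> 'a \<Rightarrow> complex" and \<delta> :: real
  assumes fin: "finite I" "I \<noteq> {}"
    and meas: "\<And>i. i \<in> I \<Longrightarrow> \<psi> i \<in> borel_measurable M"
    and bd: "\<And>i x. i \<in> I \<Longrightarrow> x \<in> space M \<Longrightarrow> cmod (\<psi> i x) \<le> 1"
    and \<delta>: "0 < \<delta>" "\<delta> \<le> 1" and L: "(1/4)^L \<le> \<delta> / 4"
    and m: "32 * (real L + 1) * (257 * ln (256 / \<delta>) * ln (4 * real (card I)) + ln (2 * (real L + 1)))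
      < real m * \<delta>"
  shows "\<exists>\<xi>. length \<xi> = m \<and> set \<xi> \<subseteq> space M \<and>
    (\<forall>a A. (\<Sum>i\<in>I. cmod (a i)) \<le> A \<longrightarrow>
      expectation (\<lambda>x. (cmod (\<Sum>i\<in>I. a i * \<psi> i x))\<^sup>2)
        \<le> 43 * avg \<xi> (\<lambda>x. (cmod (\<Sum>i\<in>I. a i * \<psi> i x))\<^sup>2) + 8 * \<delta> * A\<^sup>2 \<and>
      avg \<xi> (\<lambda>x. (cmod (\<Sum>i\<in>I. a i * \<psi> i x))\<^sup>2)
        \<le> 43 * expectation (\<lambda>x. (cmod (\<Sum>i\<in>I. a i * \<psi> i x))\<^sup>2) + 8 * \<delta> * A\<^sup>2)"
proof -
  define \<phi> where "\<phi> = (\<lambda>(i, b) x. if b then Re (\<psi> i x) else Im (\<psi> i x))"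
  let ?I = "I \<times> (UNIV :: bool set)"
  have card: "real (card ?I) = 2 * real (card I)"
    by (simp add: card_cartesian_product)
  have \<phi>m: "\<phi> i \<in> borel_measurable M" if i': "i \<in> ?I" for i
  proof -
    obtain k b where i: "i = (k, b)" "k \<in> I" using i' by (cases i) auto
    note [measurable] = meas[OF i(2)]
    show ?thesis unfolding \<phi>_def i(1) prod.case by (cases b) simp_all
  qed
  have \<phi>b: "\<bar>\<phi> i x\<bar> \<le> 1" if i': "i \<in> ?I" and x: "x \<in> space M" for i x
  proof -
    obtain k b where i: "i = (k, b)" "k \<in> I" using i' by (cases i) auto
    show ?thesis
      using bd[OF i(2) x] abs_Re_le_cmod[of "\<psi> k x"] abs_Im_le_cmod[of "\<psi> k x"]
      unfolding \<phi>_def i(1) prod.case by (cases b) simp_all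
  qed
  have "\<exists>\<xi>. length \<xi> = m \<and> set \<xi> \<subseteq> space M \<and>
    (\<forall>c A. (\<Sum>i\<in>?I. \<bar>c i\<bar>) \<le> A \<longrightarrow>
      expectation (\<lambda>x. (\<Sum>i\<in>?I. c i * \<phi> i x)\<^sup>2) \<le> 43 * avg \<xi> (\<lambda>x. (\<Sum>i\<in>?I. c i * \<phi> i x)\<^sup>2) + \<delta> * A\<^sup>2 \<and>
      avg \<xi> (\<lambda>x. (\<Sum>i\<in>?I. c i * \<phi> i x)\<^sup>2) \<le> 43 * expectation (\<lambda>x. (\<Sum>i\<in>?I. c i * \<phi> i x)\<^sup>2) + \<delta> * A\<^sup>2)"
    by (rule exists_points_discretization_absconvex[OF _ _ \<phi>m \<phi>b \<delta> L]) (use fin m card in auto)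
  then obtain \<xi> where \<xi>: "length \<xi> = m" "set \<xi> \<subseteq> space M"
    and disc: "\<forall>c A. (\<Sum>i\<in>?I. \<bar>c i\<bar>) \<le> A \<longrightarrow>
      expectation (\<lambda>x. (\<Sum>i\<in>?I. c i * \<phi> i x)\<^sup>2) \<le> 43 * avg \<xi> (\<lambda>x. (\<Sum>i\<in>?I. c i * \<phi> i x)\<^sup>2) + \<delta> * A\<^sup>2 \<and>
      avg \<xi> (\<lambda>x. (\<Sum>i\<in>?I. c i * \<phi> i x)\<^sup>2) \<le> 43 * expectation (\<lambda>x. (\<Sum>i\<in>?I. c i * \<phi> i x)\<^sup>2) + \<delta> * A\<^sup>2"
    by (elim exE conjE)
  show ?thesis
  proof (intro exI[of _ \<xi>] conjI[OF \<xi>(1)] conjI[OF \<xi>(2)] allI impI)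
    fix a :: "'i \<Rightarrow> complex" and A :: real
    assume A: "(\<Sum>i\<in>I. cmod (a i)) \<le> A"
    define h where "h = (\<lambda>x. \<Sum>i\<in>I. a i * \<psi> i x)"
    have split: "(\<Sum>i\<in>?I. F i) = (\<Sum>i\<in>I. F (i, True) + F (i, False))" for F :: "'i \<times> bool \<Rightarrow> real"
    proof -
      have "(\<Sum>i\<in>?I. F i) = (\<Sum>i\<in>I. \<Sum>b\<in>UNIV. F (i, b))" by (simp add: sum.cartesian_product)
      then show ?thesis by (simp add: UNIV_bool add.commute)
    qed
    define c1 where "c1 = (\<lambda>(i, b). if b then Re (a i) else - Im (a i))"
    define c2 where "c2 = (\<lambda>(i, b). if b then Im (a i) else Re (a i))"
    have h1: "(\<Sum>i\<in>?I. c1 i * \<phi> i x) = Re (h x)" for x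
      unfolding split by (simp add: c1_def \<phi>_def h_def)
    have h2: "(\<Sum>i\<in>?I. c2 i * \<phi> i x) = Im (h x)" for x
      unfolding split by (simp add: c2_def \<phi>_def h_def add.commute)
    have le: "(\<Sum>i\<in>I. \<bar>Re (a i)\<bar> + \<bar>Im (a i)\<bar>) \<le> 2 * A"
    proof -
      have "(\<Sum>i\<in>I. \<bar>Re (a i)\<bar> + \<bar>Im (a i)\<bar>) \<le> (\<Sum>i\<in>I. cmod (a i) + cmod (a i))"
        by (intro sum_mono add_mono abs_Re_le_cmod abs_Im_le_cmod)
      also have "\<dots> = 2 * (\<Sum>i\<in>I. cmod (a i))" unfolding sum.distrib by simp
      finally show ?thesis using A by linarith
    qed
    have n1: "(\<Sum>i\<in>?I. \<bar>c1 i\<bar>) \<le> 2 * A" unfolding split using le by (simp add: c1_def)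
    have n2: "(\<Sum>i\<in>?I. \<bar>c2 i\<bar>) \<le> 2 * A" unfolding split using le by (simp add: c2_def add.commute)
    have hm: "h \<in> borel_measurable M" unfolding h_def using meas by measurable
    have hb: "cmod (h x) \<le> A" if "x \<in> space M" for x
    proof -
      have "cmod (h x) \<le> (\<Sum>i\<in>I. cmod (a i) * 1)"
        unfolding h_def using bd that
        by (intro order.trans[OF norm_sum] sum_mono) (simp add: norm_mult mult_left_le)
      with A show ?thesis by simp
    qed
    have A2: "y\<^sup>2 \<le> A\<^sup>2" if "\<bar>y\<bar> \<le> cmod (h x)" "x \<in> space M" for x y
      using that hb[OF that(2)] by (intro power2_le_iff_abs_le[THEN iffD2]) auto
    have i1: "integrable M (\<lambda>x. (Re (h x))\<^sup>2)"
      by (rule integrable_of_bounded[where B="A\<^sup>2"]) (use hm A2 abs_Re_le_cmod in auto)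
    have i2: "integrable M (\<lambda>x. (Im (h x))\<^sup>2)"
      by (rule integrable_of_bounded[where B="A\<^sup>2"]) (use hm A2 abs_Im_le_cmod in auto)
    have "expectation (\<lambda>x. (cmod (h x))\<^sup>2) = expectation (\<lambda>x. (Re (h x))\<^sup>2) + expectation (\<lambda>x. (Im (h x))\<^sup>2)"
      using i1 i2 by (simp add: cmod_power2)
    moreover have "avg \<xi> (\<lambda>x. (cmod (h x))\<^sup>2) = avg \<xi> (\<lambda>x. (Re (h x))\<^sup>2) + avg \<xi> (\<lambda>x. (Im (h x))\<^sup>2)"
      by (simp add: cmod_power2 avg_add)
    moreover have "(2 * A)\<^sup>2 = 4 * A\<^sup>2" by (simp add: power_mult_distrib)
    ultimately have "expectation (\<lambda>x. (cmod (h x))\<^sup>2) \<le> 43 * avg \<xi> (\<lambda>x. (cmod (h x))\<^sup>2) + 8 * \<delta> * A\<^sup>2 \<and>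
      avg \<xi> (\<lambda>x. (cmod (h x))\<^sup>2) \<le> 43 * expectation (\<lambda>x. (cmod (h x))\<^sup>2) + 8 * \<delta> * A\<^sup>2"
      using disc[rule_format, OF n1] disc[rule_format, OF n2] unfolding h1 h2 by auto
    then show "expectation (\<lambda>x. (cmod (\<Sum>i\<in>I. a i * \<psi> i x))\<^sup>2)
        \<le> 43 * avg \<xi> (\<lambda>x. (cmod (\<Sum>i\<in>I. a i * \<psi> i x))\<^sup>2) + 8 * \<delta> * A\<^sup>2 \<and>
      avg \<xi> (\<lambda>x. (cmod (\<Sum>i\<in>I. a i * \<psi> i x))\<^sup>2)
        \<le> 43 * expectation (\<lambda>x. (cmod (\<Sum>i\<in>I. a i * \<psi> i x))\<^sup>2) + 8 * \<delta> * A\<^sup>2"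
      unfolding h_def .
  qed
qed

end

section \<open>Coefficients of the smoothness class\<close>

lemma norm_inf_less_iff: "1 \<le> n \<Longrightarrow> norm_inf d k < n \<longleftrightarrow> (\<forall>i<d. nat \<bar>k i\<bar> < n)"
  unfolding norm_inf_def by (subst Max_less_iff) auto

lemma card_cube:
  assumes n: "1 \<le> n"
  shows "finite {k \<in> Zd d. norm_inf d k < n}" "card {k \<in> Zd d. norm_inf d k < n} \<le> (2 * n) ^ d"
proof -
  let ?Q = "{k \<in> Zd d. norm_inf d k < n}"
  let ?P = "PiE {..<d} (\<lambda>_. {- int n<..<int n})"
  have inj: "inj_on (\<lambda>k. restrict k {..<d}) ?Q"
  proof (rule inj_onI)
    fix k l assume kl: "k \<in> ?Q" "l \<in> ?Q" and eq: "restrict k {..<d} = restrict l {..<d}"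
    show "k = l"
    proof
      fix i
      show "k i = l i"
        using kl fun_cong[OF eq, of i] by (cases "i < d") (auto simp: Zd_def)
    qed
  qed
  have sub: "(\<lambda>k. restrict k {..<d}) ` ?Q \<subseteq> ?P"
  proof (rule image_subsetI)
    fix k assume "k \<in> ?Q"
    then have k: "\<And>i. i < d \<Longrightarrow> nat \<bar>k i\<bar> < n" using norm_inf_less_iff[OF n] by simp
    have "k i \<in> {- int n<..<int n}" if "i < d" for i using k[OF that] by auto
    then show "restrict k {..<d} \<in> ?P" by (simp add: restrict_PiE_iff)
  qed
  have fin: "finite ?P" by (intro finite_PiE) auto
  show "finite ?Q" using inj sub fin by (rule inj_on_finite)
  have "card ?Q \<le> card ?P" using inj sub fin by (rule card_inj_on_le)
  also have "\<dots> = nat (2 * int n - 1) ^ d" by (simp add: card_PiE)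
  also have "\<dots> \<le> (2 * n) ^ d" by (intro power_mono) auto
  finally show "card ?Q \<le> (2 * n) ^ d" .
qed

text \<open>Kept as a union because the class controls coefficients blockwise; the size estimate
  comes from the inclusion in the indices of norm below 2^J.\<close>

definition dyadic_cube :: "nat \<Rightarrow> nat \<Rightarrow> (nat \<Rightarrow> int) set" where
  "dyadic_cube d J = (\<Union>j\<le>J. dyadic_block d j)"

lemma dyadic_block_subset_cube: "j \<le> J \<Longrightarrow> dyadic_block d j \<subseteq> {k \<in> Zd d. norm_inf d k < 2 ^ J}"
  unfolding dyadic_block_def by (auto elim: less_le_trans intro!: power_increasing)

lemma finite_dyadic_block: "finite (dyadic_block d j)"
  and card_dyadic_block: "real (card (dyadic_block d j)) \<le> 2 ^ d * (2 ^ j) ^ d"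
proof -
  have 1: "1 \<le> (2::nat) ^ j" by simp
  show "finite (dyadic_block d j)"
    using card_cube(1)[OF 1] dyadic_block_subset_cube[OF order_refl] by (rule finite_subset[rotated])
  have "card (dyadic_block d j) \<le> (2 * 2 ^ j) ^ d"
    using card_mono[OF card_cube(1)[OF 1] dyadic_block_subset_cube[OF order_refl]] card_cube(2)[OF 1]
    by (rule order_trans)
  then have "real (card (dyadic_block d j)) \<le> real ((2 * 2 ^ j) ^ d)" by (simp only: of_nat_le_iff)
  then show "real (card (dyadic_block d j)) \<le> 2 ^ d * (2 ^ j) ^ d" by (simp add: power_mult_distrib)
qed

lemma dyadic_cube_subset: "dyadic_cube d J \<subseteq> Zd d"
  by (auto simp: dyadic_cube_def dyadic_block_def)

lemma finite_dyadic_cube: "finite (dyadic_cube d J)"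
  by (simp add: dyadic_cube_def finite_dyadic_block)

lemma card_dyadic_cube: "card (dyadic_cube d J) \<le> (2 * 2 ^ J) ^ d"
proof -
  have sub: "dyadic_cube d J \<subseteq> {k \<in> Zd d. norm_inf d k < 2 ^ J}"
    using dyadic_block_subset_cube by (auto simp: dyadic_cube_def)
  have 1: "1 \<le> (2::nat) ^ J" by simp
  show ?thesis using card_mono[OF card_cube(1)[OF 1] sub] card_cube(2)[OF 1] by (rule order_trans)
qed

lemma zero_in_dyadic_block: "(\<lambda>_. 0) \<in> dyadic_block d 0"
proof -
  have "norm_inf d (\<lambda>_. 0) < 1" by (subst norm_inf_less_iff) auto
  then show ?thesis by (simp add: dyadic_block_def Zd_def powr_minus)
qed

lemma dyadic_cube_nonempty: "dyadic_cube d J \<noteq> {}"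
  using zero_in_dyadic_block unfolding dyadic_cube_def by blast

lemma Zd_in_dyadic_block:
  assumes "k \<in> Zd d"
  shows "\<exists>j. k \<in> dyadic_block d j"
proof -
  define j where "j = (LEAST j. norm_inf d k < 2 ^ j)"
  have j: "norm_inf d k < 2 ^ j"
    unfolding j_def by (rule LeastI[of _ "norm_inf d k"]) (rule less_exp)
  have "nat \<lfloor>(2::real) powr (real j - 1)\<rfloor> \<le> norm_inf d k"
  proof (cases j)
    case 0
    \<comment> \<open>The integer part of 1/2 is 0, so block 0 consists of the zero index and its
      lower bound is trivial.\<close>
    have "\<lfloor>(2::real) powr (- 1)\<rfloor> = 0" by (simp add: powr_minus)
    then show ?thesis using 0 by simp
  next
    case (Suc i)
    then have "\<not> norm_inf d k < 2 ^ i"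
      using not_less_Least[of i "\<lambda>j. norm_inf d k < 2 ^ j"] unfolding j_def by simp
    moreover have "\<lfloor>(2::real) powr real i\<rfloor> = 2 ^ i"
      by (simp add: powr_realpow floor_eq_iff)
    ultimately show ?thesis using Suc by (simp add: nat_power_eq)
  qed
  with j assms have "k \<in> dyadic_block d j" by (simp add: dyadic_block_def)
  then show ?thesis by blast
qed

lemma sum_UN_le:
  fixes f :: "'a \<Rightarrow> real"
  assumes "finite I" "\<And>i. i \<in> I \<Longrightarrow> finite (A i)" "\<And>x. 0 \<le> f x"
  shows "sum f (\<Union>i\<in>I. A i) \<le> (\<Sum>i\<in>I. sum f (A i))"
  using assms(1,2)
proof (induction I)
  case (insert i I)
  have "sum f (A i \<union> (\<Union>i\<in>I. A i)) \<le> sum f (A i) + sum f (\<Union>i\<in>I. A i)"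
    using sum.union_inter[of "A i" "\<Union>i\<in>I. A i" f] insert.hyps insert.prems assms(3)
      sum_nonneg[of "A i \<inter> (\<Union>i\<in>I. A i)" f] by auto
  also have "\<dots> \<le> sum f (A i) + (\<Sum>i\<in>I. sum f (A i))"
    using insert.IH insert.prems by simp
  finally show ?case using insert.hyps by simp
qed simp

lemma sum_power_tail_le:
  fixes \<rho> :: real
  assumes "0 < \<rho>" "\<rho> < 1"
  shows "(\<Sum>j=J..K. \<rho> ^ j) \<le> \<rho> ^ J / (1 - \<rho>)"
proof (cases "J \<le> K")
  case True
  then have "(1 - \<rho>) * (\<Sum>j=J..K. \<rho> ^ j) = \<rho> ^ J - \<rho> ^ Suc K" by (rule sum_gp_multiplied)
  also have "\<dots> \<le> \<rho> ^ J" using assms by simp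
  finally show ?thesis using assms by (simp add: pos_le_divide_eq mult.commute)
qed (use assms in simp)

text \<open>Dyadic blocks of small index will be counted by their size, those of large index by their \<open>\<ell>\<^sub>\<beta>\<close> quasi-norm.\<close>

lemma sum_geometric_below:
  fixes y :: real
  assumes "0 < y"
  shows "(\<Sum>j\<le>J. of_bool (2 ^ j * y \<le> 1) * (2 ^ j * y)) \<le> 2"
proof -
  define s where "s = (\<lambda>n. \<Sum>j<n. of_bool (2 ^ j * y \<le> 1) * (2 ^ j * y))"
  have "s n \<le> 2 ^ n * y \<and> s n \<le> 2" for n
  proof (induction n)
    case (Suc n)
    have "s (Suc n) = s n + of_bool (2 ^ n * y \<le> 1) * (2 ^ n * y)"
      unfolding s_def by (rule sum.lessThan_Suc)
    with Suc assms show ?case by (cases "2 ^ n * y \<le> 1") (simp_all add: mult.commute)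
  qed (use assms in \<open>simp add: s_def\<close>)
  then have "s (Suc J) \<le> 2" by blast
  then show ?thesis by (simp add: s_def lessThan_Suc_atMost)
qed

text \<open>The first term that is counted is at most 1, and each later one is smaller by the factor
  2^-\<rho>.\<close>

lemma sum_geometric_above:
  fixes y \<rho> :: real
  assumes y: "0 < y" and \<rho>: "0 < \<rho>"
  shows "(\<Sum>j\<le>J. of_bool (\<not> 2 ^ j * y \<le> 1) * (2 ^ j * y) powr (- \<rho>)) \<le> 1 / (1 - 2 powr (- \<rho>))"
proof -
  define q where "q = 2 powr (- \<rho>)"
  have q: "0 < q" "q < 1" using \<rho> by (auto simp: q_def powr_less_one)
  define s where "s = (\<lambda>n. \<Sum>j<n. of_bool (\<not> 2 ^ j * y \<le> 1) * (2 ^ j * y) powr (- \<rho>))"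
  have s: "s (Suc n) = s n + of_bool (\<not> 2 ^ n * y \<le> 1) * (2 ^ n * y) powr (- \<rho>)" for n
    unfolding s_def by (rule sum.lessThan_Suc)
  have step: "(2 ^ Suc n * y) powr (- \<rho>) = q * (2 ^ n * y) powr (- \<rho>)" for n
  proof -
    have "2 ^ Suc n * y = 2 * (2 ^ n * y)" by simp
    then show ?thesis using y unfolding q_def by (simp only: powr_mult)
  qed
  define K where "K = 1 / (1 - q)"
  have K: "0 < K" using q by (simp add: K_def)
  have "1 + q * K = (1 - q) / (1 - q) + q / (1 - q)" using q by (simp add: K_def)
  also have "\<dots> = K" unfolding K_def add_divide_distrib[symmetric] by simp
  finally have fix1: "1 + q * K = K" .
  have above: "(2 ^ n * y) powr (- \<rho>) * K \<le> K" if "\<not> 2 ^ n * y \<le> 1" for n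
  proof -
    have "(2 ^ n * y) powr (- \<rho>) \<le> 1"
      using that \<rho> powr_mono2'[of "- \<rho>" 1 "2 ^ n * y"] by simp
    then show ?thesis using K by simp
  qed
  \<comment> \<open>\<open>K\<close> times the next term bounds the whole tail still to come;
    including it makes the estimate inductive through K = 1 + q K.\<close>
  have inv: "(2 ^ n * y \<le> 1 \<longrightarrow> s n = 0) \<and> (\<not> 2 ^ n * y \<le> 1 \<longrightarrow> s n + (2 ^ n * y) powr (- \<rho>) * K \<le> K)" for n
  proof (induction n)
    case 0
    then show ?case using above[of 0] by (auto simp: s_def)
  next
    case (Suc n)
    show ?case
    proof (cases "2 ^ n * y \<le> 1")
      case True
      then have "s (Suc n) = 0" using Suc.IH s[of n] by simp
      then show ?thesis using above[of "Suc n"] by simp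
    next
      case False
      have "0 < 2 ^ n * y" using y by simp
      then have "\<not> 2 ^ Suc n * y \<le> 1" using False by simp
      moreover have "s (Suc n) + (2 ^ Suc n * y) powr (- \<rho>) * K
        = s n + (2 ^ n * y) powr (- \<rho>) * (1 + q * K)"
        unfolding step s using False by (simp add: distrib_left distrib_right mult_ac)
      ultimately show ?thesis using Suc.IH False unfolding fix1 by simp
    qed
  qed
  have "s (Suc J) \<le> K"
  proof (cases "2 ^ Suc J * y \<le> 1")
    case False
    have "0 \<le> (2 ^ Suc J * y) powr (- \<rho>) * K" using K by simp
    with inv[of "Suc J"] False show ?thesis by linarith
  qed (use K inv[of "Suc J"] in simp)
  then show ?thesis unfolding s_def q_def K_def lessThan_Suc_atMost .
qed

section \<open>Coefficient sums of one member of the class\<close>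

context
  fixes d :: nat and a :: "(nat \<Rightarrow> int) \<Rightarrow> complex" and r \<beta> :: real
  assumes r: "0 < r" and \<beta>: "0 < \<beta>" "\<beta> \<le> 1" and d: "1 \<le> d"
    and block: "\<And>j. (\<Sum>k\<in>dyadic_block d j. cmod (a k) powr \<beta>) powr (1 / \<beta>) \<le> 2 powr (- r * real j)"
begin

lemma block_powr_sum: "(\<Sum>k\<in>dyadic_block d j. cmod (a k) powr \<beta>) \<le> 2 powr (- r * \<beta> * real j)"
proof -
  let ?S = "\<Sum>k\<in>dyadic_block d j. cmod (a k) powr \<beta>"
  have S: "0 \<le> ?S" by (simp add: sum_nonneg)
  have "(?S powr (1 / \<beta>)) powr \<beta> \<le> (2 powr (- r * real j)) powr \<beta>"
    using block \<beta> by (intro powr_mono2) auto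
  then show ?thesis using \<beta> S by (simp add: powr_powr mult_ac)
qed

text \<open>For \<beta> at most 1 the l_\<beta> quasi-norm dominates the l_1 norm: every coefficient
  is at most \<open>?\<rho>\<close>, so |a| is at most |a|^\<beta> times \<open>?\<rho>\<close> to
  the power 1 - \<beta>.\<close>

lemma block_sum: "(\<Sum>k\<in>dyadic_block d j. cmod (a k)) \<le> 2 powr (- r * real j)"
proof -
  let ?\<rho> = "2 powr (- r * real j)"
  have "cmod (a k) \<le> cmod (a k) powr \<beta> * ?\<rho> powr (1 - \<beta>)" if k: "k \<in> dyadic_block d j" for k
  proof -
    have "cmod (a k) powr \<beta> \<le> (\<Sum>k\<in>dyadic_block d j. cmod (a k) powr \<beta>)"
      using k finite_dyadic_block by (intro member_le_sum) auto
    also have "\<dots> \<le> 2 powr (- r * \<beta> * real j)" by (rule block_powr_sum)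
    finally have "(cmod (a k) powr \<beta>) powr (1 / \<beta>) \<le> (2 powr (- r * \<beta> * real j)) powr (1 / \<beta>)"
      using \<beta> by (intro powr_mono2) auto
    then have le: "cmod (a k) \<le> ?\<rho>" using \<beta> by (simp add: powr_powr)
    have "cmod (a k) = cmod (a k) powr \<beta> * cmod (a k) powr (1 - \<beta>)"
      by (simp flip: powr_add)
    also have "\<dots> \<le> cmod (a k) powr \<beta> * ?\<rho> powr (1 - \<beta>)"
      using \<beta> le by (intro mult_left_mono powr_mono2) auto
    finally show ?thesis .
  qed
  then have "(\<Sum>k\<in>dyadic_block d j. cmod (a k)) \<le> (\<Sum>k\<in>dyadic_block d j. cmod (a k) powr \<beta>) * ?\<rho> powr (1 - \<beta>)"
    unfolding sum_distrib_right by (rule sum_mono)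
  also have "\<dots> \<le> 2 powr (- r * \<beta> * real j) * ?\<rho> powr (1 - \<beta>)"
    by (intro mult_right_mono block_powr_sum) auto
  also have "\<dots> = ?\<rho>" by (simp add: powr_powr algebra_simps flip: powr_add)
  finally show ?thesis .
qed

lemma tail_sum:
  assumes "(\<lambda>k. cmod (a k)) summable_on Zd d"
  shows "(\<Sum>\<^sub>\<infinity>k\<in>Zd d - dyadic_cube d J. cmod (a k)) \<le> 2 powr (- r * real J) / (1 - 2 powr (- r))"
proof (rule infsum_le_finite_sums)
  show "(\<lambda>k. cmod (a k)) summable_on Zd d - dyadic_cube d J"
    using assms by (rule summable_on_subset_banach) auto
  define \<rho> where "\<rho> = 2 powr (- r)"
  have \<rho>: "0 < \<rho>" "\<rho> < 1" using r by (auto simp: \<rho>_def powr_less_one)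
  have pw: "2 powr (- r * real j) = \<rho> ^ j" for j
    unfolding powr_realpow[OF \<rho>(1), symmetric] by (simp add: \<rho>_def powr_powr)
  fix F assume F: "finite F" "F \<subseteq> Zd d - dyadic_cube d J"
  have "\<exists>j. k \<in> dyadic_block d j" if "k \<in> F" for k
    using that F(2) by (intro Zd_in_dyadic_block) auto
  then obtain \<iota> where \<iota>: "\<And>k. k \<in> F \<Longrightarrow> k \<in> dyadic_block d (\<iota> k)" by metis
  define K where "K = Max (insert 0 (\<iota> ` F))"
  \<comment> \<open>Outside the cube only blocks beyond J occur; block J is included as well, which
    gives the geometric bound the exponent r J.\<close>
  have "F \<subseteq> (\<Union>j\<in>{J..K}. dyadic_block d j)"
  proof
    fix k assume k: "k \<in> F"
    have "\<iota> k \<le> K" unfolding K_def using F(1) k by (intro Max_ge) auto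
    moreover have "J \<le> \<iota> k"
    proof (rule ccontr)
      assume "\<not> J \<le> \<iota> k"
      then have "k \<in> dyadic_cube d J" unfolding dyadic_cube_def using \<iota>[OF k] by (intro UN_I[of "\<iota> k"]) auto
      with F(2) k show False by blast
    qed
    ultimately show "k \<in> (\<Union>j\<in>{J..K}. dyadic_block d j)" using \<iota>[OF k] by auto
  qed
  then have "(\<Sum>k\<in>F. cmod (a k)) \<le> (\<Sum>k\<in>(\<Union>j\<in>{J..K}. dyadic_block d j). cmod (a k))"
    by (intro sum_mono2) (auto simp: finite_dyadic_block)
  also have "\<dots> \<le> (\<Sum>j=J..K. \<Sum>k\<in>dyadic_block d j. cmod (a k))"
    by (intro sum_UN_le) (auto simp: finite_dyadic_block)
  also have "\<dots> \<le> (\<Sum>j=J..K. \<rho> ^ j)"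
    using block_sum unfolding pw by (intro sum_mono)
  also have "\<dots> \<le> \<rho> ^ J / (1 - \<rho>)" by (rule sum_power_tail_le[OF \<rho>])
  finally show "(\<Sum>k\<in>F. cmod (a k)) \<le> 2 powr (- r * real J) / (1 - 2 powr (- r))"
    unfolding pw \<rho>_def[symmetric] .
qed

text \<open>A block with 2^(j d) up to X is bounded by \<theta> times its size, a later one through
  min(|a|, \<theta>) \<le> |a|^\<beta> \<theta>^(1 - \<beta>). The exponent 1/\<beta> + r/d in
  \<theta> is the one for which both bounds are of order X \<theta> at the crossover 2^(j d) =
  X.\<close>

lemma sum_min_threshold:
  assumes X: "0 < X"
  defines "\<theta> \<equiv> X powr (- (1 / \<beta> + r / real d))"
  shows "(\<Sum>k\<in>dyadic_cube d J. min (cmod (a k)) \<theta>)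
    \<le> (2 * 2 ^ d + 1 / (1 - 2 powr (- (r * \<beta>)))) * X * \<theta>"
proof -
  \<comment> \<open>In this scale the crossover 2^(j d) = X reads 2^j y = 1.\<close>
  define y where "y = X powr (- 1 / real d)"
  have y: "0 < y" using X by (simp add: y_def)
  have \<theta>: "0 < \<theta>" using X by (simp add: \<theta>_def)
  have yd: "X * y ^ d = 1"
  proof -
    have "y ^ d = y powr real d" using y by (simp add: powr_realpow)
    also have "\<dots> = X powr (- 1)" using d by (simp add: y_def powr_powr)
    finally show ?thesis using X by (simp add: powr_minus)
  qed
  have small: "(\<Sum>k\<in>dyadic_block d j. min (cmod (a k)) \<theta>) \<le> 2 ^ d * (2 ^ j * y) * X * \<theta>"
    if "2 ^ j * y \<le> 1" for j
  proof -
    have "(\<Sum>k\<in>dyadic_block d j. min (cmod (a k)) \<theta>) \<le> real (card (dyadic_block d j)) * \<theta>"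
      by (rule sum_bounded_above) auto
    also have "\<dots> \<le> (2 ^ d * (2 ^ j) ^ d) * \<theta>"
      using card_dyadic_block \<theta> by (intro mult_right_mono) auto
    also have "(2 ^ j) ^ d = (2 ^ j * y) ^ d * X"
      using yd by (simp add: power_mult_distrib mult_ac)
    \<comment> \<open>As 2^j y is at most 1, its d-th power is at most 2^j y itself; the sum over j
      then has ratio 2 in every dimension.\<close>
    also have "2 ^ d * ((2 ^ j * y) ^ d * X) * \<theta> \<le> 2 ^ d * ((2 ^ j * y) * X) * \<theta>"
      using that y X \<theta> d power_decreasing[of 1 d "2 ^ j * y"]
      by (intro mult_right_mono mult_left_mono) auto
    finally show ?thesis by (simp add: mult_ac)
  qed
  have large: "(\<Sum>k\<in>dyadic_block d j. min (cmod (a k)) \<theta>) \<le> (2 ^ j * y) powr (- (r * \<beta>)) * X * \<theta>" for j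
  proof -
    have "min (cmod (a k)) \<theta> \<le> cmod (a k) powr \<beta> * \<theta> powr (1 - \<beta>)" for k
    proof -
      have "min (cmod (a k)) \<theta> = min (cmod (a k)) \<theta> powr \<beta> * min (cmod (a k)) \<theta> powr (1 - \<beta>)"
        using \<theta> by (simp flip: powr_add)
      also have "\<dots> \<le> cmod (a k) powr \<beta> * \<theta> powr (1 - \<beta>)"
        using \<beta> \<theta> by (intro mult_mono powr_mono2) auto
      finally show ?thesis .
    qed
    then have "(\<Sum>k\<in>dyadic_block d j. min (cmod (a k)) \<theta>)
      \<le> (\<Sum>k\<in>dyadic_block d j. cmod (a k) powr \<beta>) * \<theta> powr (1 - \<beta>)"
      unfolding sum_distrib_right by (rule sum_mono)
    also have "\<dots> \<le> 2 powr (- r * \<beta> * real j) * \<theta> powr (1 - \<beta>)"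
      by (intro mult_right_mono block_powr_sum) auto
    also have "\<theta> powr (1 - \<beta>) = \<theta> * \<theta> powr (- \<beta>)"
      using \<theta> powr_add[of \<theta> 1 "- \<beta>"] by simp
    also have "\<theta> powr (- \<beta>) = X * y powr (- (r * \<beta>))"
    proof -
      have "\<theta> powr (- \<beta>) = X powr ((1 / \<beta> + r / real d) * \<beta>)"
        unfolding \<theta>_def powr_powr by (simp only: minus_mult_minus)
      also have "(1 / \<beta> + r / real d) * \<beta> = 1 + r * \<beta> / real d"
        using \<beta> by (simp add: distrib_right)
      also have "X powr (1 + r * \<beta> / real d) = X * X powr (r * \<beta> / real d)" using X by (simp add: powr_add)
      also have "X powr (r * \<beta> / real d) = y powr (- (r * \<beta>))" by (simp add: y_def powr_powr)
      finally show ?thesis .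
    qed
    also have "2 powr (- r * \<beta> * real j) * (\<theta> * (X * y powr (- (r * \<beta>))))
      = (2 powr (- r * \<beta> * real j) * y powr (- (r * \<beta>))) * X * \<theta>" by (simp only: mult_ac)
    also have "2 powr (- r * \<beta> * real j) * y powr (- (r * \<beta>)) = (2 ^ j * y) powr (- (r * \<beta>))"
    proof -
      have "(2::real) ^ j = 2 powr real j" by (simp add: powr_realpow)
      then show ?thesis using y by (simp add: powr_mult powr_powr mult_ac)
    qed
    finally show ?thesis .
  qed
  let ?s = "\<lambda>j. of_bool (2 ^ j * y \<le> 1) * (2 ^ j * y)"
  let ?l = "\<lambda>j. of_bool (\<not> 2 ^ j * y \<le> 1) * (2 ^ j * y) powr (- (r * \<beta>))"
  have "(\<Sum>k\<in>dyadic_cube d J. min (cmod (a k)) \<theta>) \<le> (\<Sum>j\<le>J. \<Sum>k\<in>dyadic_block d j. min (cmod (a k)) \<theta>)"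
    unfolding dyadic_cube_def using \<theta> by (intro sum_UN_le) (auto simp: finite_dyadic_block)
  also have "\<dots> \<le> (\<Sum>j\<le>J. (2 ^ d * ?s j + ?l j) * X * \<theta>)"
  proof (rule sum_mono)
    fix j
    show "(\<Sum>k\<in>dyadic_block d j. min (cmod (a k)) \<theta>) \<le> (2 ^ d * ?s j + ?l j) * X * \<theta>"
      using small[of j] large[of j] by (cases "2 ^ j * y \<le> 1") simp_all
  qed
  also have "\<dots> = (2 ^ d * (\<Sum>j\<le>J. ?s j) + (\<Sum>j\<le>J. ?l j)) * X * \<theta>"
    unfolding sum_distrib_right[symmetric] sum.distrib sum_distrib_left[symmetric] ..
  also have "\<dots> \<le> (2 ^ d * 2 + 1 / (1 - 2 powr (- (r * \<beta>)))) * X * \<theta>"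
    using X \<theta> sum_geometric_below[OF y] sum_geometric_above[OF y, of "r * \<beta>"] r \<beta>
    by (intro mult_right_mono add_mono mult_left_mono) auto
  finally show ?thesis by (simp add: mult.commute)
qed

end

section \<open>Integral norms and sparse sums\<close>

lemma bernoulli_powr:
  fixes y q :: real
  assumes "0 \<le> y" "1 \<le> q"
  shows "1 + q * (y - 1) \<le> y powr q"
proof (cases "y = 0")
  case True
  then show ?thesis using assms by simp
next
  case False
  then have y: "0 < y" using assms by simp
  have "(y powr q) powr (1 / q) * 1 powr (1 - 1 / q) \<le> 1 / q * y powr q + (1 - 1 / q) * 1"
    using assms y by (intro Youngs_inequality_0) auto
  then have "y \<le> 1 / q * y powr q + (1 - 1 / q)" using assms y by (simp add: powr_powr)
  then have "q * y \<le> q * (1 / q * y powr q + (1 - 1 / q))"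
    using assms by (intro mult_left_mono) auto
  also have "\<dots> = y powr q + (q - 1)" using assms by (simp add: distrib_left right_diff_distrib)
  finally show ?thesis by (simp add: algebra_simps)
qed

text \<open>Jensen's inequality from the tangent at the mean \<open>w\<close>: Bernoulli's
  inequality for z / w says that z^p lies above this tangent.\<close>

lemma powr_convex_combination:
  fixes u v p l :: real
  assumes "0 \<le> u" "0 \<le> v" "1 \<le> p" "0 \<le> l" "l \<le> 1"
  shows "(l * u + (1 - l) * v) powr p \<le> l * u powr p + (1 - l) * v powr p"
proof (cases "l * u + (1 - l) * v = 0")
  case True
  then show ?thesis using assms by simp
next
  case False
  define w where "w = l * u + (1 - l) * v"
  have "0 \<le> w" unfolding w_def using assms by (intro add_nonneg_nonneg mult_nonneg_nonneg) auto
  then have w: "0 < w" using False w_def by simp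
  have b: "w powr p * (1 + p * (z / w - 1)) \<le> z powr p" if "0 \<le> z" for z
  proof -
    have "w powr p * (1 + p * (z / w - 1)) \<le> w powr p * (z / w) powr p"
      using bernoulli_powr[of "z / w" p] that w assms(3) by (intro mult_left_mono) auto
    also have "\<dots> = z powr p" using w that by (simp add: powr_divide)
    finally show ?thesis .
  qed
  have "l * (u / w - 1) + (1 - l) * (v / w - 1) = (l * u + (1 - l) * v) / w - 1"
    by (simp add: add_divide_distrib diff_divide_distrib algebra_simps)
  then have "l * (u / w - 1) + (1 - l) * (v / w - 1) = 0"
    using w unfolding w_def[symmetric] by simp
  then have "w powr p = w powr p * (1 + p * (l * (u / w - 1) + (1 - l) * (v / w - 1)))" by simp
  also have "\<dots> = l * (w powr p * (1 + p * (u / w - 1))) + (1 - l) * (w powr p * (1 + p * (v / w - 1)))"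
    by (simp add: algebra_simps)
  also have "\<dots> \<le> l * u powr p + (1 - l) * v powr p"
    using assms b by (intro add_mono mult_left_mono) auto
  finally show ?thesis unfolding w_def .
qed

text \<open>Removes the root, \<open>enn2real\<close> and the case distinction of
  \<open>Lp_norm\<close>, so that estimates can be made on the integral itself.\<close>

lemma Lp_norm_le_iff:
  assumes "0 < p" "0 \<le> A"
  shows "Lp_norm \<mu> p f \<le> ennreal A \<longleftrightarrow> (\<integral>\<^sup>+ x. ennreal (cmod (f x) powr p) \<partial>\<mu>) \<le> ennreal (A powr p)"
proof (cases "(\<integral>\<^sup>+ x. ennreal (cmod (f x) powr p) \<partial>\<mu>) = \<infinity>")
  case True
  then show ?thesis by (simp add: Lp_norm_def Let_def top_unique)
next
  case False
  define y where "y = enn2real (\<integral>\<^sup>+ x. ennreal (cmod (f x) powr p) \<partial>\<mu>)"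
  have I: "(\<integral>\<^sup>+ x. ennreal (cmod (f x) powr p) \<partial>\<mu>) = ennreal y" and y: "0 \<le> y"
    using False by (auto simp: y_def less_top)
  have "y powr (1 / p) \<le> A \<longleftrightarrow> y \<le> A powr p"
  proof
    assume "y powr (1 / p) \<le> A"
    then have "(y powr (1 / p)) powr p \<le> A powr p" using assms by (intro powr_mono2) auto
    then show "y \<le> A powr p" using assms y by (simp add: powr_powr)
  next
    assume "y \<le> A powr p"
    then have "y powr (1 / p) \<le> (A powr p) powr (1 / p)" using assms y by (intro powr_mono2) auto
    then show "y powr (1 / p) \<le> A" using assms by (simp add: powr_powr)
  qed
  then show ?thesis using False assms y by (simp add: Lp_norm_def Let_def I)
qed

text \<open>Minkowski's inequality with prescribed bounds in place of the norms: |f| + |g| is A + B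
  times the convex combination of |f| / A and |g| / B with weights A / (A + B) and B / (A +
  B).\<close>

lemma Lp_norm_triangle_pos:
  assumes meas [measurable]: "f \<in> borel_measurable \<mu>" "g \<in> borel_measurable \<mu>"
    and p: "1 \<le> p" and A: "0 < A" "Lp_norm \<mu> p f \<le> ennreal A" and B: "0 < B" "Lp_norm \<mu> p g \<le> ennreal B"
    and h: "\<And>x. x \<in> space \<mu> \<Longrightarrow> cmod (h x) \<le> cmod (f x) + cmod (g x)"
  shows "Lp_norm \<mu> p h \<le> ennreal (A + B)"
proof -
  define S where "S = (A + B) powr p"
  define l where "l = A / (A + B)"
  have l: "0 \<le> l" "l \<le> 1" "1 - l = B / (A + B)" using A B by (auto simp: l_def field_simps)
  let ?a = "S * l / A powr p" and ?b = "S * (1 - l) / B powr p"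
  have ab: "0 \<le> ?a" "0 \<le> ?b" using l(1,2)
    by (auto intro!: divide_nonneg_nonneg mult_nonneg_nonneg simp: S_def)
  have pt: "cmod (h x) powr p \<le> ?a * cmod (f x) powr p + ?b * cmod (g x) powr p" if "x \<in> space \<mu>" for x
  proof -
    have "cmod (h x) powr p \<le> (cmod (f x) + cmod (g x)) powr p"
      using h[OF that] p by (intro powr_mono2) auto
    also have "cmod (f x) + cmod (g x) = (A + B) * (l * (cmod (f x) / A) + (1 - l) * (cmod (g x) / B))"
      using A B l(3) by (simp add: l_def distrib_left)
    also have "\<dots> powr p = S * (l * (cmod (f x) / A) + (1 - l) * (cmod (g x) / B)) powr p"
      using A B l by (simp add: S_def powr_mult)
    also have "\<dots> \<le> S * (l * (cmod (f x) / A) powr p + (1 - l) * (cmod (g x) / B) powr p)"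
      using A B p l by (intro mult_left_mono powr_convex_combination) (auto simp: S_def)
    also have "\<dots> = ?a * cmod (f x) powr p + ?b * cmod (g x) powr p"
      using A B by (simp add: powr_divide distrib_left)
    finally show ?thesis .
  qed
  have "(\<integral>\<^sup>+ x. ennreal (cmod (h x) powr p) \<partial>\<mu>)
    \<le> (\<integral>\<^sup>+ x. ennreal ?a * ennreal (cmod (f x) powr p) + ennreal ?b * ennreal (cmod (g x) powr p) \<partial>\<mu>)"
  proof (rule nn_integral_mono)
    fix x assume "x \<in> space \<mu>"
    from pt[OF this] show "ennreal (cmod (h x) powr p)
      \<le> ennreal ?a * ennreal (cmod (f x) powr p) + ennreal ?b * ennreal (cmod (g x) powr p)"
      using ab by (simp flip: ennreal_mult ennreal_plus del: times_divide_eq_left)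
  qed
  also have "\<dots> = ennreal ?a * (\<integral>\<^sup>+ x. ennreal (cmod (f x) powr p) \<partial>\<mu>)
      + ennreal ?b * (\<integral>\<^sup>+ x. ennreal (cmod (g x) powr p) \<partial>\<mu>)"
    by (simp add: nn_integral_add nn_integral_cmult)
  also have "\<dots> \<le> ennreal ?a * ennreal (A powr p) + ennreal ?b * ennreal (B powr p)"
    using A B p by (intro add_mono mult_left_mono) (auto simp flip: Lp_norm_le_iff)
  also have "\<dots> = ennreal (?a * A powr p + ?b * B powr p)"
    using ab by (simp flip: ennreal_mult ennreal_plus del: times_divide_eq_left)
  also have "?a * A powr p + ?b * B powr p = (A + B) powr p"
    using A B by (simp add: S_def flip: distrib_left)
  finally show ?thesis using A B p by (subst Lp_norm_le_iff) auto
qed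

text \<open>Bounds that may be zero are made positive by adding e / 2 to each.\<close>

lemma Lp_norm_triangle:
  assumes "f \<in> borel_measurable \<mu>" "g \<in> borel_measurable \<mu>"
    and "1 \<le> p" and A: "0 \<le> A" "Lp_norm \<mu> p f \<le> ennreal A" and B: "0 \<le> B" "Lp_norm \<mu> p g \<le> ennreal B"
    and "\<And>x. x \<in> space \<mu> \<Longrightarrow> cmod (h x) \<le> cmod (f x) + cmod (g x)"
  shows "Lp_norm \<mu> p h \<le> ennreal (A + B)"
proof (rule ennreal_le_epsilon)
  fix e :: real assume e: "0 < e"
  have f: "Lp_norm \<mu> p f \<le> ennreal (A + e / 2)"
    using A(2) by (rule order_trans) (use e in \<open>simp add: ennreal_leI\<close>)
  have g: "Lp_norm \<mu> p g \<le> ennreal (B + e / 2)"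
    using B(2) by (rule order_trans) (use e in \<open>simp add: ennreal_leI\<close>)
  have "Lp_norm \<mu> p h \<le> ennreal ((A + e / 2) + (B + e / 2))"
  proof (rule Lp_norm_triangle_pos[OF assms(1-3) _ f _ g])
    show "0 < A + e / 2" "0 < B + e / 2" using A(1) B(1) e by auto
  qed (rule assms(8))
  also have "\<dots> = ennreal (A + B) + ennreal e" using A B e by (simp flip: ennreal_plus)
  finally show "Lp_norm \<mu> p h \<le> ennreal (A + B) + ennreal e" .
qed

lemma exists_largest_subset:
  fixes f :: "'a \<Rightarrow> real"
  assumes "finite Q" "s \<le> card Q"
  shows "\<exists>P\<subseteq>Q. card P = s \<and> (\<forall>k\<in>P. \<forall>l\<in>Q - P. f l \<le> f k)"
  using assms(2)
proof (induction s)
  case 0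
  then show ?case by (intro exI[of _ "{}"]) auto
next
  case (Suc s)
  then obtain P where P: "P \<subseteq> Q" "card P = s" "\<forall>k\<in>P. \<forall>l\<in>Q - P. f l \<le> f k" by auto
  have finP: "finite P" using P(1) assms(1) by (rule finite_subset)
  have "Q - P \<noteq> {}" using P Suc.prems by auto
  then have "Max (f ` (Q - P)) \<in> f ` (Q - P)" using assms(1) by (intro Max_in) auto
  then obtain q where q: "q \<in> Q - P" "f q = Max (f ` (Q - P))" by auto
  have "f l \<le> f q" if "l \<in> Q - P" for l
    unfolding q(2) using assms(1) that by (intro Max_ge) auto
  with P q finP show ?case by (intro exI[of _ "insert q P"]) auto
qed

context prob_space
begin

lemma Lp_norm_2_eq:
  assumes [measurable]: "f \<in> borel_measurable M" and "\<And>x. x \<in> space M \<Longrightarrow> cmod (f x) \<le> B"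
  shows "Lp_norm M 2 f = ennreal (sqrt (expectation (\<lambda>x. (cmod (f x))\<^sup>2)))"
proof -
  have i: "integrable M (\<lambda>x. (cmod (f x))\<^sup>2)"
  proof (rule integrable_of_bounded)
    show "\<bar>(cmod (f x))\<^sup>2\<bar> \<le> B\<^sup>2" if "x \<in> space M" for x
      using assms(2)[OF that] by (simp add: power_mono)
  qed measurable
  have "(\<integral>\<^sup>+ x. ennreal (cmod (f x) powr 2) \<partial>M) = (\<integral>\<^sup>+ x. ennreal ((cmod (f x))\<^sup>2) \<partial>M)"
    by simp
  also have "\<dots> = ennreal (expectation (\<lambda>x. (cmod (f x))\<^sup>2))"
    using i by (intro nn_integral_eq_integral) auto
  finally show ?thesis
    by (simp add: Lp_norm_def powr_half_sqrt)
qed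

lemma Lp_norm_bounded:
  assumes "0 < p" "0 \<le> A" "\<And>x. x \<in> space M \<Longrightarrow> cmod (f x) \<le> A"
  shows "Lp_norm M p f \<le> ennreal A"
proof -
  have "(\<integral>\<^sup>+ x. ennreal (cmod (f x) powr p) \<partial>M) \<le> (\<integral>\<^sup>+ x. ennreal (A powr p) \<partial>M)"
    using assms by (intro nn_integral_mono ennreal_leI powr_mono2) auto
  also have "\<dots> = ennreal (A powr p)" by (simp add: emeasure_space_1)
  finally show ?thesis using assms by (simp add: Lp_norm_le_iff)
qed

text \<open>Jensen's inequality for the power p / 2: Bernoulli's inequality at |f|^2 / s, with s the
  mean of |f|^2, is integrated, and its linear term has mean zero.\<close>

lemma Lp_norm_2_le:
  assumes meas [measurable]: "f \<in> borel_measurable M" and bd: "\<And>x. x \<in> space M \<Longrightarrow> cmod (f x) \<le> B"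
    and p: "2 \<le> p"
  shows "Lp_norm M 2 f \<le> Lp_norm M p f"
proof -
  define s where "s = expectation (\<lambda>x. (cmod (f x))\<^sup>2)"
  have s0: "0 \<le> s" by (simp add: s_def)
  have i: "integrable M (\<lambda>x. (cmod (f x))\<^sup>2)"
  proof (rule integrable_of_bounded)
    show "\<bar>(cmod (f x))\<^sup>2\<bar> \<le> B\<^sup>2" if "x \<in> space M" for x
      using bd[OF that] by (simp add: power_mono)
  qed measurable
  have ip: "integrable M (\<lambda>x. cmod (f x) powr p)"
  proof (rule integrable_of_bounded)
    show "\<bar>cmod (f x) powr p\<bar> \<le> B powr p" if "x \<in> space M" for x
      using bd[OF that] p by (simp add: powr_mono2)
  qed measurable
  have L2: "Lp_norm M 2 f = ennreal (sqrt s)"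
    unfolding s_def using meas bd by (rule Lp_norm_2_eq)
  show ?thesis
  proof (cases "s = 0")
    case True
    then show ?thesis by (simp add: L2)
  next
    case False
    then have s: "0 < s" using s0 by simp
    have "expectation (\<lambda>x. s powr (p / 2) * (1 + p / 2 * ((cmod (f x))\<^sup>2 / s - 1))) \<le> expectation (\<lambda>x. cmod (f x) powr p)"
    proof (rule integral_mono)
      fix x
      have "s powr (p / 2) * (1 + p / 2 * ((cmod (f x))\<^sup>2 / s - 1)) \<le> s powr (p / 2) * ((cmod (f x))\<^sup>2 / s) powr (p / 2)"
        using s p by (intro mult_left_mono bernoulli_powr) auto
      also have "\<dots> = ((cmod (f x))\<^sup>2) powr (p / 2)" using s by (simp add: powr_divide)
      also have "\<dots> = (cmod (f x) powr 2) powr (p / 2)" by simp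
      also have "\<dots> = cmod (f x) powr p" unfolding powr_powr by simp
      finally show "s powr (p / 2) * (1 + p / 2 * ((cmod (f x))\<^sup>2 / s - 1)) \<le> cmod (f x) powr p" .
    qed (use i ip in simp_all)
    also have "expectation (\<lambda>x. s powr (p / 2) * (1 + p / 2 * ((cmod (f x))\<^sup>2 / s - 1)))
      = s powr (p / 2) * (1 + p / 2 * (s / s - 1))"
      using i by (simp add: prob_space s_def)
    finally have le: "s powr (p / 2) \<le> expectation (\<lambda>x. cmod (f x) powr p)" using s by simp
    have I: "(\<integral>\<^sup>+ x. ennreal (cmod (f x) powr p) \<partial>M) = ennreal (expectation (\<lambda>x. cmod (f x) powr p))"
      using ip by (intro nn_integral_eq_integral) auto
    have "sqrt s = (s powr (p / 2)) powr (1 / p)" using s p by (simp add: powr_powr powr_half_sqrt)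
    also have "\<dots> \<le> expectation (\<lambda>x. cmod (f x) powr p) powr (1 / p)"
      using le p by (intro powr_mono2) auto
    finally show ?thesis
      unfolding L2 by (simp add: Lp_norm_def I ennreal_leI)
  qed
qed

end

section \<open>Sparse sums and small coefficients in a Riesz system\<close>

locale nikolskii_riesz_system = prob_space M for M :: "'a measure" +
  fixes I :: "'i set" and \<psi> :: "'i \<Rightarrow> 'a \<Rightarrow> complex" and R1 R2 p H :: real and u :: nat
  assumes meas: "\<And>k. k \<in> I \<Longrightarrow> \<psi> k \<in> borel_measurable M"
    and R: "0 < R1" "R1 \<le> R2" and p: "2 \<le> p" and u: "1 \<le> u" and I: "I \<noteq> {}"
    and riesz: "unif_bounded_riesz M (space M) I \<psi> R1 R2"
    and NI: "NI M I \<psi> p H u"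
begin

abbreviation lin :: "'i set \<Rightarrow> ('i \<Rightarrow> complex) \<Rightarrow> 'a \<Rightarrow> complex" where
  "lin Q a x \<equiv> \<Sum>k\<in>Q. a k * \<psi> k x"

lemma bounded: "k \<in> I \<Longrightarrow> x \<in> space M \<Longrightarrow> cmod (\<psi> k x) \<le> 1"
  using riesz by (simp add: unif_bounded_riesz_def)

lemma lin_measurable: "Q \<subseteq> I \<Longrightarrow> lin Q a \<in> borel_measurable M"
  using meas by (intro borel_measurable_sum borel_measurable_times) auto

lemma lin_bounded:
  assumes "Q \<subseteq> I" "x \<in> space M"
  shows "cmod (lin Q a x) \<le> (\<Sum>k\<in>Q. cmod (a k))"
proof (rule order.trans[OF norm_sum], rule sum_mono)
  fix k assume "k \<in> Q"
  then have "cmod (\<psi> k x) \<le> 1" using assms bounded by blast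
  then show "cmod (a k * \<psi> k x) \<le> cmod (a k)" by (simp add: norm_mult mult_left_le)
qed

lemma Lp_norm_2_lin:
  assumes "Q \<subseteq> I"
  shows "Lp_norm M 2 (lin Q a) = ennreal (sqrt (expectation (\<lambda>x. (cmod (lin Q a x))\<^sup>2)))"
  using lin_measurable[OF assms] lin_bounded[OF assms] by (rule Lp_norm_2_eq)

lemma energy_bounds:
  assumes "finite Q" "Q \<subseteq> I"
  shows "R1\<^sup>2 * (\<Sum>k\<in>Q. (cmod (a k))\<^sup>2) \<le> expectation (\<lambda>x. (cmod (lin Q a x))\<^sup>2)"
    and "expectation (\<lambda>x. (cmod (lin Q a x))\<^sup>2) \<le> R2\<^sup>2 * (\<Sum>k\<in>Q. (cmod (a k))\<^sup>2)"
proof -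
  let ?S = "\<Sum>k\<in>Q. (cmod (a k))\<^sup>2" and ?E = "expectation (\<lambda>x. (cmod (lin Q a x))\<^sup>2)"
  have S: "0 \<le> ?S" by (simp add: sum_nonneg)
  have "ennreal (R1 * sqrt ?S) \<le> ennreal (sqrt ?E)" "ennreal (sqrt ?E) \<le> ennreal (R2 * sqrt ?S)"
    using riesz assms by (auto simp: unif_bounded_riesz_def Lp_norm_2_lin)
  then have le: "R1 * sqrt ?S \<le> sqrt ?E" "sqrt ?E \<le> R2 * sqrt ?S"
    using R S by (auto simp: ennreal_le_iff)
  have "(R1 * sqrt ?S)\<^sup>2 \<le> (sqrt ?E)\<^sup>2"
    using le(1) R S by (intro power_mono) auto
  then show "R1\<^sup>2 * ?S \<le> ?E" using S by (simp add: power_mult_distrib)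
  have "(sqrt ?E)\<^sup>2 \<le> (R2 * sqrt ?S)\<^sup>2"
    using le(2) by (intro power_mono) auto
  then show "?E \<le> R2\<^sup>2 * ?S" using S by (simp add: power_mult_distrib)
qed

text \<open>The lower Riesz bound provides a one-term sum of positive L_2 norm, and on a probability
  space its L_p norm is no smaller. Later this lets errors that carry no factor H be
  absorbed.\<close>

lemma one_le_H: "1 \<le> H"
proof (rule ccontr)
  assume H: "\<not> 1 \<le> H"
  obtain k where k: "k \<in> I" using I by blast
  define L where "L = sqrt (expectation (\<lambda>x. (cmod (lin {k} (\<lambda>_. 1) x))\<^sup>2))"
  have sub: "{k} \<subseteq> I" using k by simp
  have "R1\<^sup>2 * (\<Sum>k\<in>{k}. (cmod 1)\<^sup>2) \<le> expectation (\<lambda>x. (cmod (lin {k} (\<lambda>_. 1) x))\<^sup>2)"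
    using sub by (intro energy_bounds) auto
  moreover have "0 < R1\<^sup>2 * (\<Sum>k\<in>{k}. (cmod 1)\<^sup>2)" using R by simp
  ultimately have "0 < expectation (\<lambda>x. (cmod (lin {k} (\<lambda>_. 1) x))\<^sup>2)" by linarith
  then have L: "0 < L" unfolding L_def by (rule real_sqrt_gt_zero)
  have "Lp_norm M 2 (lin {k} (\<lambda>_. 1)) \<le> Lp_norm M p (lin {k} (\<lambda>_. 1))"
    using lin_measurable[OF sub] lin_bounded[OF sub] p by (rule Lp_norm_2_le)
  also have "\<dots> \<le> ennreal H * Lp_norm M 2 (lin {k} (\<lambda>_. 1))"
    using NI[unfolded NI_def, rule_format, of "{k}" "\<lambda>_. 1"] k u by simp
  finally have "ennreal L \<le> ennreal H * ennreal L" unfolding Lp_norm_2_lin[OF sub] L_def .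
  \<comment> \<open>\<open>ennreal\<close> sends negative numbers to 0, so a negative H has to be
    treated as 0.\<close>
  also have "\<dots> = ennreal (max 0 H * L)" using L by (simp add: ennreal_mult'' max_def ennreal_neg)
  finally have "L \<le> max 0 H * L" using L by (subst (asm) ennreal_le_iff) auto
  with L H show False by (auto simp: max_def split: if_splits)
qed

lemma Lp_norm_lin_le:
  assumes Q: "finite Q" "Q \<subseteq> I" "card Q \<le> u"
    and B: "0 \<le> B" "expectation (\<lambda>x. (cmod (lin Q a x))\<^sup>2) \<le> B\<^sup>2"
  shows "Lp_norm M p (lin Q a) \<le> ennreal (H * B)"
proof -
  have "Lp_norm M p (lin Q a) \<le> ennreal H * Lp_norm M 2 (lin Q a)"
    using NI Q by (simp add: NI_def)
  also have "\<dots> = ennreal (H * sqrt (expectation (\<lambda>x. (cmod (lin Q a x))\<^sup>2)))"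
    unfolding Lp_norm_2_lin[OF Q(2)] using one_le_H by (simp add: ennreal_mult)
  also have "\<dots> \<le> ennreal (H * B)"
    using B one_le_H by (intro ennreal_leI mult_left_mono real_le_lsqrt) auto
  finally show ?thesis .
qed

text \<open>Blocks of decreasing coefficients: the largest coefficient of a block is at most the
  average over the preceding one.\<close>

lemma Lp_norm_small_coefficients:
  assumes s: "1 \<le> s" "s \<le> u" and Q: "finite Q" "Q \<subseteq> I"
    and \<theta>: "0 \<le> \<theta>" "\<And>k. k \<in> Q \<Longrightarrow> cmod (a k) \<le> \<theta>"
  shows "Lp_norm M p (lin Q a) \<le> ennreal (H * (R2 * (sqrt s * \<theta> + (\<Sum>k\<in>Q. cmod (a k)) / sqrt s)))"
  using Q \<theta>
proof (induction "card Q" arbitrary: Q \<theta> rule: less_induct)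
  case less
  have small: "Lp_norm M p (lin P a) \<le> ennreal (H * (R2 * (sqrt s * \<theta>)))"
    if P: "P \<subseteq> Q" "card P \<le> s" for P
  proof (rule Lp_norm_lin_le)
    show "finite P" "P \<subseteq> I" "card P \<le> u"
      using P less.prems s by (auto intro: finite_subset)
    have "expectation (\<lambda>x. (cmod (lin P a x))\<^sup>2) \<le> R2\<^sup>2 * (\<Sum>k\<in>P. (cmod (a k))\<^sup>2)"
      using \<open>finite P\<close> \<open>P \<subseteq> I\<close> by (rule energy_bounds(2))
    also have "\<dots> \<le> R2\<^sup>2 * (real (card P) * \<theta>\<^sup>2)"
      using P less.prems by (intro mult_left_mono sum_bounded_above power_mono) auto
    also have "\<dots> \<le> R2\<^sup>2 * (real s * \<theta>\<^sup>2)"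
      using P by (intro mult_left_mono mult_right_mono) auto
    also have "\<dots> = (R2 * (sqrt s * \<theta>))\<^sup>2" by (simp add: power_mult_distrib)
    finally show "expectation (\<lambda>x. (cmod (lin P a x))\<^sup>2) \<le> (R2 * (sqrt s * \<theta>))\<^sup>2" .
    show "0 \<le> R2 * (sqrt s * \<theta>)" using R less.prems by simp
  qed
  have R2: "0 < R2" "0 < H" using R one_le_H by auto
  show ?case
  proof (cases "card Q \<le> s")
    case True
    have "Lp_norm M p (lin Q a) \<le> ennreal (H * (R2 * (sqrt s * \<theta>)))"
      using True by (intro small) auto
    also have "\<dots> \<le> ennreal (H * (R2 * (sqrt s * \<theta> + (\<Sum>k\<in>Q. cmod (a k)) / sqrt s)))"
      using R2 by (intro ennreal_leI mult_left_mono) (auto simp: sum_nonneg)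
    finally show ?thesis .
  next
    case False
    then obtain P where P: "P \<subseteq> Q" "card P = s" "\<forall>k\<in>P. \<forall>l\<in>Q - P. cmod (a l) \<le> cmod (a k)"
      using exists_largest_subset[of Q s "\<lambda>k. cmod (a k)"] less.prems(1) by auto
    have fin: "finite P" "finite (Q - P)" using P(1) less.prems(1) by (auto intro: finite_subset)
    have ne: "Q - P \<noteq> {}" using False P fin(1) by (metis Diff_eq_empty_iff card_mono)
    define \<theta>' where "\<theta>' = Max ((\<lambda>l. cmod (a l)) ` (Q - P))"
    have le: "cmod (a l) \<le> \<theta>'" if "l \<in> Q - P" for l
      unfolding \<theta>'_def using fin that by (intro Max_ge) auto
    have "\<theta>' \<in> (\<lambda>l. cmod (a l)) ` (Q - P)"
      unfolding \<theta>'_def using fin ne by (intro Max_in) auto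
    then have "0 \<le> \<theta>'" and "\<And>k. k \<in> P \<Longrightarrow> \<theta>' \<le> cmod (a k)" using P(3) by auto
    then have "real s * \<theta>' \<le> (\<Sum>k\<in>P. cmod (a k))"
      using sum_bounded_below[of P \<theta>' "\<lambda>k. cmod (a k)"] P(2) by simp
    then have "real s * \<theta>' / sqrt s \<le> (\<Sum>k\<in>P. cmod (a k)) / sqrt s"
      by (intro divide_right_mono) auto
    moreover have "real s * \<theta>' / sqrt s = sqrt s * \<theta>'"
      by (simp add: real_div_sqrt flip: times_divide_eq_left)
    \<comment> \<open>The height \<theta>' of the remaining coefficients is paid for by the l_1 mass
      of the removed block, so \<theta> itself is charged for the first block only.\<close>
    ultimately have head: "sqrt s * \<theta>' \<le> (\<Sum>k\<in>P. cmod (a k)) / sqrt s" by simp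
    have "card (Q - P) < card Q"
      using card_Diff_subset[OF fin(1) P(1)] P(2) s(1) False by linarith
    then have IH: "Lp_norm M p (lin (Q - P) a)
      \<le> ennreal (H * (R2 * (sqrt s * \<theta>' + (\<Sum>k\<in>Q - P. cmod (a k)) / sqrt s)))"
      using less.prems fin \<open>0 \<le> \<theta>'\<close> le by (intro less.hyps) auto
    have sum: "(\<Sum>k\<in>Q. cmod (a k)) = (\<Sum>k\<in>P. cmod (a k)) + (\<Sum>k\<in>Q - P. cmod (a k))"
      using sum.subset_diff[OF P(1) less.prems(1), of "\<lambda>k. cmod (a k)"] by simp
    have "Lp_norm M p (lin Q a) \<le> ennreal (H * (R2 * (sqrt s * \<theta>))
      + H * (R2 * (sqrt s * \<theta>' + (\<Sum>k\<in>Q - P. cmod (a k)) / sqrt s)))"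
    proof (rule Lp_norm_triangle[OF _ _ _ _ small _ IH])
      show "lin P a \<in> borel_measurable M" "lin (Q - P) a \<in> borel_measurable M"
        using P(1) less.prems by (auto intro!: lin_measurable)
      fix x
      have "lin Q a x = lin P a x + lin (Q - P) a x"
        using sum.subset_diff[OF P(1) less.prems(1), of "\<lambda>k. a k * \<psi> k x"] by simp
      then show "cmod (lin Q a x) \<le> cmod (lin P a x) + cmod (lin (Q - P) a x)"
        by (simp add: norm_triangle_ineq)
    qed (use P p R2 less.prems \<open>0 \<le> \<theta>'\<close> in \<open>auto simp: sum_nonneg\<close>)
    also have "\<dots> = ennreal (H * (R2 * (sqrt s * \<theta> + (sqrt s * \<theta>' + (\<Sum>k\<in>Q - P. cmod (a k)) / sqrt s))))"
      by (simp add: distrib_left)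
    also have "\<dots> \<le> ennreal (H * (R2 * (sqrt s * \<theta> + (\<Sum>k\<in>Q. cmod (a k)) / sqrt s)))"
      using head R2 unfolding sum add_divide_distrib
      by (intro ennreal_leI mult_left_mono) auto
    finally show ?thesis .
  qed
qed

text \<open>The coefficients above \<theta> form an s-sparse part, for which the additive error of
  the discretization can be absorbed; its samples are those of the whole sum up to the samples of
  the rest. The rest has energy at most R2^2 s \<theta>^2.\<close>

lemma Lp_norm_le_of_small_samples:
  assumes s: "1 \<le> s" "s \<le> u" and B: "finite B" "B \<subseteq> I"
    and \<delta>: "0 < \<delta>" "16 * \<delta> * real s \<le> R1\<^sup>2" and \<xi>: "set \<xi> \<subseteq> space M"
    and disc: "\<And>a A. (\<Sum>k\<in>B. cmod (a k)) \<le> A \<Longrightarrow>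
      expectation (\<lambda>x. (cmod (lin B a x))\<^sup>2) \<le> 43 * avg \<xi> (\<lambda>x. (cmod (lin B a x))\<^sup>2) + 8 * \<delta> * A\<^sup>2 \<and>
      avg \<xi> (\<lambda>x. (cmod (lin B a x))\<^sup>2) \<le> 43 * expectation (\<lambda>x. (cmod (lin B a x))\<^sup>2) + 8 * \<delta> * A\<^sup>2"
    and \<theta>: "0 < \<theta>" "(\<Sum>k\<in>B. min (cmod (a k)) \<theta>) \<le> real s * \<theta>"
    and small: "\<And>x. x \<in> set \<xi> \<Longrightarrow> cmod (lin B a x) \<le> 2 * \<theta> * sqrt s"
  shows "Lp_norm M p (lin B a) \<le> ennreal (89 * H * (1 + R2) * \<theta> * sqrt s)"
proof -
  define Q where "Q = {k \<in> B. \<theta> < cmod (a k)}"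
  let ?V = "\<lambda>Q. expectation (\<lambda>x. (cmod (lin Q a x))\<^sup>2)"
  let ?W = "\<lambda>Q. avg \<xi> (\<lambda>x. (cmod (lin Q a x))\<^sup>2)"
  have QB: "Q \<subseteq> B" "Q \<subseteq> I" "B - Q \<subseteq> I" "finite Q" "finite (B - Q)"
    using B by (auto simp: Q_def)
  have R2: "0 < R2" "0 < H" using R one_le_H by auto
  have disc': "?V P \<le> 43 * ?W P + 8 * \<delta> * A\<^sup>2" "?W P \<le> 43 * ?V P + 8 * \<delta> * A\<^sup>2"
    if P: "P \<subseteq> B" and A: "(\<Sum>k\<in>P. cmod (a k)) \<le> A" for P A
  proof -
    \<comment> \<open>Extension by zero makes \<open>disc\<close>, stated for sums over
      \<open>B\<close>, available for both parts.\<close>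
    define b where "b = (\<lambda>k. if k \<in> P then a k else 0)"
    have "lin B b = lin P a"
    proof
      fix x show "lin B b x = lin P a x"
        using B(1) P by (intro sum.mono_neutral_cong_right) (auto simp: b_def)
    qed
    moreover have "(\<Sum>k\<in>B. cmod (b k)) = (\<Sum>k\<in>P. cmod (a k))"
      using B(1) P by (intro sum.mono_neutral_cong_right) (auto simp: b_def)
    ultimately show "?V P \<le> 43 * ?W P + 8 * \<delta> * A\<^sup>2" "?W P \<le> 43 * ?V P + 8 * \<delta> * A\<^sup>2"
      using disc[of b A] A by (simp_all add: fun_eq_iff)
  qed
  have split: "(\<Sum>k\<in>B. min (cmod (a k)) \<theta>) = real (card Q) * \<theta> + (\<Sum>k\<in>B - Q. cmod (a k))"
  proof -
    have "(\<Sum>k\<in>Q. min (cmod (a k)) \<theta>) = (\<Sum>k\<in>Q. \<theta>)"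
      by (intro sum.cong) (auto simp: Q_def)
    moreover have "(\<Sum>k\<in>B - Q. min (cmod (a k)) \<theta>) = (\<Sum>k\<in>B - Q. cmod (a k))"
      by (intro sum.cong) (auto simp: Q_def)
    ultimately show ?thesis
      using sum.subset_diff[OF QB(1) B(1), of "\<lambda>k. min (cmod (a k)) \<theta>"] by simp
  qed
  have nn: "0 \<le> (\<Sum>k\<in>B - Q. cmod (a k))" "0 \<le> real (card Q) * \<theta>"
    using \<theta> by (auto simp: sum_nonneg)
  have "real (card Q) * \<theta> \<le> real s * \<theta>" using split nn \<theta>(2) by linarith
  then have card: "card Q \<le> s" using \<theta>(1) by simp
  have l1: "(\<Sum>k\<in>B - Q. cmod (a k)) \<le> real s * \<theta>" using split nn \<theta>(2) by linarith
  have l2: "(\<Sum>k\<in>B - Q. (cmod (a k))\<^sup>2) \<le> real s * \<theta>\<^sup>2"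
  proof -
    have "(\<Sum>k\<in>B - Q. (cmod (a k))\<^sup>2) \<le> (\<Sum>k\<in>B - Q. \<theta> * cmod (a k))"
      unfolding power2_eq_square by (intro sum_mono mult_right_mono) (auto simp: Q_def)
    also have "\<dots> \<le> \<theta> * (real s * \<theta>)"
      unfolding sum_distrib_left[symmetric] using l1 \<theta>(1) by (intro mult_left_mono) auto
    finally show ?thesis by (simp add: power2_eq_square mult_ac)
  qed
  let ?T = "real s * \<theta>\<^sup>2"
  have T: "0 \<le> ?T" by simp
  have \<delta>s: "8 * \<delta> * real s \<le> R1\<^sup>2 / 2" using \<delta>(2) by simp
  \<comment> \<open>By Cauchy-Schwarz the squared l_1 norm of at most s coefficients is at most s
    times their sum of squares. With 16 \<delta> s at most R1^2 the additive error is at most half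
    of the left-hand side; absorbing it doubles 43 to 86.\<close>
  have V0: "?V Q \<le> 86 * ?W Q"
  proof -
    let ?l1 = "\<Sum>k\<in>Q. cmod (a k)" and ?l2 = "\<Sum>k\<in>Q. (cmod (a k))\<^sup>2"
    have "?l1\<^sup>2 \<le> real (card Q) * ?l2"
      using sum_squared_le_sum_of_squares[of "\<lambda>k. cmod (a k)" Q] by (simp add: mult.commute)
    also have "\<dots> \<le> real s * ?l2"
      using card by (intro mult_right_mono) (auto simp: sum_nonneg)
    finally have "8 * \<delta> * ?l1\<^sup>2 \<le> 8 * \<delta> * (real s * ?l2)"
      using \<delta>(1) by (intro mult_left_mono) auto
    also have "\<dots> = (8 * \<delta> * real s) * ?l2" by simp
    also have "\<dots> \<le> R1\<^sup>2 / 2 * ?l2"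
      using \<delta>s by (intro mult_right_mono) (auto simp: sum_nonneg)
    also have "\<dots> \<le> ?V Q / 2" using energy_bounds(1)[OF QB(4,2), of a] by simp
    finally show ?thesis using disc'(1)[OF QB(1) order_refl] by linarith
  qed
  \<comment> \<open>43 comes from the comparison, 1 from the additive error, because 8 \<delta> s is
    at most R1^2 / 2 and hence at most R2^2.\<close>
  have W1: "?W (B - Q) \<le> 44 * R2\<^sup>2 * ?T"
  proof -
    have "?W (B - Q) \<le> 43 * ?V (B - Q) + 8 * \<delta> * (real s * \<theta>)\<^sup>2"
      using l1 by (intro disc'(2)) auto
    also have "?V (B - Q) \<le> R2\<^sup>2 * (\<Sum>k\<in>B - Q. (cmod (a k))\<^sup>2)"
      by (rule energy_bounds(2)[OF QB(5,3)])
    also have "R2\<^sup>2 * (\<Sum>k\<in>B - Q. (cmod (a k))\<^sup>2) \<le> R2\<^sup>2 * ?T"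
      using l2 by (intro mult_left_mono) auto
    also have "8 * \<delta> * (real s * \<theta>)\<^sup>2 = (8 * \<delta> * real s) * ?T"
      by (simp add: power2_eq_square)
    also have "\<dots> \<le> R2\<^sup>2 * ?T"
    proof (rule mult_right_mono[OF _ T])
      have "R1\<^sup>2 \<le> R2\<^sup>2" using R by (intro power_mono) auto
      then show "8 * \<delta> * real s \<le> R2\<^sup>2" using \<delta>s zero_le_power2[of R1] by linarith
    qed
    finally show ?thesis by (simp add: mult_ac)
  qed
  have W0: "?W Q \<le> 2 * (4 * ?T) + 2 * ?W (B - Q)"
  proof -
    have "?W Q \<le> avg \<xi> (\<lambda>x. 2 * (4 * ?T) + 2 * (cmod (lin (B - Q) a x))\<^sup>2)"
    proof (rule avg_mono)
      fix x assume x: "x \<in> set \<xi>"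
      have "lin B a x = lin (B - Q) a x + lin Q a x"
        by (rule sum.subset_diff[OF QB(1) B(1)])
      then have "cmod (lin Q a x) \<le> cmod (lin B a x) + cmod (lin (B - Q) a x)"
        by (metis add_diff_cancel_left' norm_triangle_ineq4)
      then have "(cmod (lin Q a x))\<^sup>2 \<le> (cmod (lin B a x) + cmod (lin (B - Q) a x))\<^sup>2"
        by (intro power_mono) auto
      also have "\<dots> \<le> 2 * (cmod (lin B a x))\<^sup>2 + 2 * (cmod (lin (B - Q) a x))\<^sup>2"
        using zero_le_power2[of "cmod (lin B a x) - cmod (lin (B - Q) a x)"]
        by (simp add: power2_sum power2_diff)
      also have "(cmod (lin B a x))\<^sup>2 \<le> (2 * \<theta> * sqrt s)\<^sup>2"
        using small[OF x] by (intro power_mono) auto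
      also have "(2 * \<theta> * sqrt s)\<^sup>2 = 4 * ?T" by (simp add: power_mult_distrib)
      finally show "(cmod (lin Q a x))\<^sup>2 \<le> 2 * (4 * ?T) + 2 * (cmod (lin (B - Q) a x))\<^sup>2" by simp
    qed
    also have "\<dots> = avg \<xi> (\<lambda>x. 2 * (4 * ?T)) + 2 * ?W (B - Q)"
      by (simp only: avg_add avg_cmult)
    also have "avg \<xi> (\<lambda>x. 2 * (4 * ?T)) \<le> 2 * (4 * ?T)"
      using T by (intro avg_const_le) auto
    finally show ?thesis by simp
  qed
  \<comment> \<open>Combining the three estimates gives 86 * (8 + 88 R2^2) = 688 + 7568 R2^2, and
    87^2 = 7569 covers both terms.\<close>
  have "?V Q \<le> (87 * (1 + R2) * \<theta> * sqrt s)\<^sup>2"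
  proof -
    have "x \<le> 86 * (2 * (4 * t) + 2 * z')" if "x \<le> 86 * y" "y \<le> 2 * (4 * t) + 2 * z" "z \<le> z'"
      for x y z z' t :: real using that by simp
    from this[OF V0 W0 W1] have "?V Q \<le> 86 * (2 * (4 * ?T) + 2 * (44 * R2\<^sup>2 * ?T))" .
    also have "\<dots> = (688 + 7568 * R2\<^sup>2) * ?T" by (simp add: algebra_simps)
    also have "\<dots> \<le> (7569 * (1 + R2)\<^sup>2) * ?T"
    proof (rule mult_right_mono[OF _ T])
      show "688 + 7568 * R2\<^sup>2 \<le> 7569 * (1 + R2)\<^sup>2"
        using R2(1) zero_le_power2[of R2] by (simp add: power2_sum)
    qed
    also have "\<dots> = (87 * (1 + R2) * \<theta> * sqrt s)\<^sup>2" by (simp only: power_mult_distrib) simp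
    finally show ?thesis .
  qed
  then have big: "Lp_norm M p (lin Q a) \<le> ennreal (H * (87 * (1 + R2) * \<theta> * sqrt s))"
    using QB card s R2 \<theta> by (intro Lp_norm_lin_le) auto
  have "Lp_norm M p (lin (B - Q) a)
    \<le> ennreal (H * (R2 * (sqrt s * \<theta> + (\<Sum>k\<in>B - Q. cmod (a k)) / sqrt s)))"
    using s QB \<theta>(1) by (intro Lp_norm_small_coefficients) (auto simp: Q_def)
  also have "\<dots> \<le> ennreal (H * (R2 * (sqrt s * \<theta> + real s * \<theta> / sqrt s)))"
    using l1 R2 by (intro ennreal_leI mult_left_mono add_left_mono divide_right_mono) auto
  also have "real s * \<theta> / sqrt s = sqrt s * \<theta>"
    by (simp add: real_div_sqrt flip: times_divide_eq_left)
  finally have rest: "Lp_norm M p (lin (B - Q) a) \<le> ennreal (H * (R2 * (2 * (\<theta> * sqrt s))))"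
    by (simp add: mult_ac)
  have "Lp_norm M p (lin B a) \<le> ennreal (H * (87 * (1 + R2) * \<theta> * sqrt s) + H * (R2 * (2 * (\<theta> * sqrt s))))"
  proof (rule Lp_norm_triangle[OF lin_measurable[OF QB(2)] lin_measurable[OF QB(3)] _ _ big _ rest])
    fix x
    have "lin B a x = lin (B - Q) a x + lin Q a x"
      by (rule sum.subset_diff[OF QB(1) B(1)])
    then show "cmod (lin B a x) \<le> cmod (lin Q a x) + cmod (lin (B - Q) a x)"
      by (metis add.commute norm_triangle_ineq)
  qed (use p R2 \<theta> in auto)
  \<comment> \<open>The rest contributes 2 R2, at most 2 (1 + R2), which raises 87 to 89.\<close>
  also have "\<dots> \<le> ennreal (89 * H * (1 + R2) * \<theta> * sqrt s)"
  proof (rule ennreal_leI)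
    have "0 \<le> H * (\<theta> * sqrt s)" using R2 \<theta> by simp
    moreover have "H * (87 * (1 + R2) * \<theta> * sqrt s) + H * (R2 * (2 * (\<theta> * sqrt s))) + 2 * (H * (\<theta> * sqrt s))
      = 89 * H * (1 + R2) * \<theta> * sqrt s"
      by (simp add: algebra_simps)
    ultimately show "H * (87 * (1 + R2) * \<theta> * sqrt s) + H * (R2 * (2 * (\<theta> * sqrt s)))
      \<le> 89 * H * (1 + R2) * \<theta> * sqrt s" by linarith
  qed
  finally show ?thesis .
qed

end

section \<open>The number of points\<close>

text \<open>ln (2 v) is at least ln 2, also at v = 1, and therefore absorbs constants, which ln v
  could not do.\<close>

lemma affine_ln_le:
  fixes v :: nat
  assumes "1 \<le> v"
  shows "a + b * ln (real v) \<le> (2 * \<bar>a\<bar> + \<bar>b\<bar>) * ln (2 * real v)"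
proof -
  have l: "ln (2 * real v) = ln 2 + ln (real v)" using assms by (simp add: ln_mult)
  have v: "0 \<le> ln (real v)" using assms by simp
  have ln2: "1 / 2 \<le> ln (2 :: real)" using ln2_ge_two_thirds by linarith
  have "a \<le> \<bar>a\<bar> * 1" by simp
  also have "\<dots> \<le> \<bar>a\<bar> * (2 * ln (2 * real v))" using l v ln2 by (intro mult_left_mono) auto
  finally have "a \<le> 2 * \<bar>a\<bar> * ln (2 * real v)" by simp
  moreover have "b * ln (real v) \<le> \<bar>b\<bar> * ln (2 * real v)"
    using l v ln2 by (intro mult_mono) auto
  ultimately show ?thesis by (simp add: distrib_right)
qed

lemma nat_ceiling_affine_ln_le:
  fixes v :: nat
  assumes v: "1 \<le> v"
  shows "real (nat \<lceil>a + b * ln (real v)\<rceil>) \<le> (2 * \<bar>a\<bar> + \<bar>b\<bar> + 2) * ln (2 * real v)"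
proof -
  have l: "0 \<le> ln (2 * real v)" "1 \<le> 2 * ln (2 * real v)"
  proof -
    have "ln 2 \<le> ln (2 * real v)" using v by simp
    then show "0 \<le> ln (2 * real v)" "1 \<le> 2 * ln (2 * real v)"
      using ln2_ge_two_thirds by linarith+
  qed
  have "0 \<le> (2 * \<bar>a\<bar> + \<bar>b\<bar>) * ln (2 * real v)" using l by simp
  then have "real (nat \<lceil>a + b * ln (real v)\<rceil>) \<le> (2 * \<bar>a\<bar> + \<bar>b\<bar>) * ln (2 * real v) + 1"
    using affine_ln_le[OF v, of a b] by linarith
  then show ?thesis using l by (simp add: distrib_right)
qed

text \<open>In logarithmic form the conditions on J and L are lower bounds affine in ln v. So J, L,
  ln (1/\<delta>) and the logarithm of the dictionary size are all bounded by multiples of ln (2 v),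
  with factors independent of v and m.\<close>

lemma sample_size_sufficient:
  fixes r E C0 \<kappa> :: real and c d :: nat
  assumes r: "0 < r" and C0: "0 < C0" and c: "1 \<le> c" and \<kappa>: "0 < \<kappa>"
  defines "\<delta> \<equiv> \<lambda>v :: nat. \<kappa> / (16 * real (c * v))"
  shows "\<exists>c'. \<forall>v m. 1 \<le> v \<and> c' * real v * ln (2 * real v) ^ 4 \<le> real m \<longrightarrow>
    (\<exists>J L. 2 powr (- r * real J) / (1 - 2 powr (- r))
         \<le> (real (c * v) / (2 * C0)) powr (- E) * sqrt (real (c * v)) \<and>
       (1/4) ^ L \<le> \<delta> v / 4 \<and>
       32 * (real L + 1) * (257 * ln (256 / \<delta> v) * ln (4 * (2 * 2 ^ J) ^ d) + ln (2 * (real L + 1)))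
         < real m * \<delta> v)"
proof -
  let ?l = "\<lambda>v :: nat. ln (2 * real v)"
  define w where "w = 1 - 2 powr (- r)"
  have w: "0 < w" using r by (simp add: w_def powr_less_one)
  \<comment> \<open>\<open>aJ + bJ * ln v\<close> is the real J at which 2^(- r J) equals
    \<open>w\<close> times the right-hand side of the tail condition.\<close>
  define aJ where "aJ = - (ln w + E * ln (2 * C0) + (1/2 - E) * ln (real c)) / (r * ln 2)"
  define bJ where "bJ = - (1/2 - E) / (r * ln 2)"
  define J where "J = (\<lambda>v :: nat. nat \<lceil>aJ + bJ * ln (real v)\<rceil>)"
  \<comment> \<open>The level condition is 4^L \<ge> 4 / \<delta> v = 64 c v / \<kappa>; its
    logarithm to base 4 is the affine function used for \<open>L\<close>.\<close>
  define aL where "aL = ln (64 * real c / \<kappa>) / ln 4"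
  define L where "L = (\<lambda>v :: nat. nat \<lceil>aL + 1 / ln 4 * ln (real v)\<rceil>)"
  define KJ where "KJ = 2 * \<bar>aJ\<bar> + \<bar>bJ\<bar> + 2"
  define KL where "KL = 2 * \<bar>aL\<bar> + \<bar>1 / ln 4\<bar> + 4"
  define KN where "KN = 4 + real d * (KJ + 2)"
  define KD where "KD = 2 * \<bar>ln (4096 * real c / \<kappa>)\<bar> + 1"
  define K where "K = 32 * KL * (514 * KD * KN + 8 * KL)"
  \<comment> \<open>Since \<delta> v = \<kappa> / (16 c v), the product of c' v and \<delta> v is K
    + 1; the surplus 1 makes the final inequality strict.\<close>
  define c' where "c' = 16 * real c * (K + 1) / \<kappa>"
  have Kpos: "0 < KJ" "0 < KL" "0 < KN" "0 < KD"
  proof -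
    show KJ: "0 < KJ" unfolding KJ_def by simp
    show "0 < KL" unfolding KL_def using abs_ge_zero[of aL] abs_ge_zero[of "1 / ln 4 :: real"] by linarith
    show "0 < KD" unfolding KD_def by simp
    show "0 < KN" unfolding KN_def using KJ by (simp add: add_pos_nonneg)
  qed
  have K: "0 < K" unfolding K_def using Kpos by (intro mult_pos_pos add_pos_pos) auto
  show ?thesis
  proof (intro exI[of _ c'] allI impI)
    fix v m :: nat
    assume vm: "1 \<le> v \<and> c' * real v * ?l v ^ 4 \<le> real m"
    then have v: "1 \<le> v" "0 < real v" by auto
    have lv: "ln (real (c * v)) = ln (real c) + ln (real v)"
      using c v by (simp add: ln_mult)
    have l1: "1 \<le> 2 * ?l v" "0 < ?l v"
    proof -
      have "ln 2 \<le> ?l v" using v by simp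
      then show "1 \<le> 2 * ?l v" "0 < ?l v" using ln2_ge_two_thirds by linarith+
    qed
    have ln2: "0 < ln (2 :: real)" by simp
    have cv: "0 < real (c * v)" using c v by simp
    have tail: "2 powr (- r * real (J v)) / (1 - 2 powr (- r))
         \<le> (real (c * v) / (2 * C0)) powr (- E) * sqrt (real (c * v))"
    proof -
      let ?G = "(real (c * v) / (2 * C0)) powr (- E) * sqrt (real (c * v))"
      have G: "0 < ?G" using cv C0 by (intro mult_pos_pos) (simp_all del: of_nat_mult)
      have "ln ?G = - E * (ln (real (c * v)) - ln (2 * C0)) + ln (real (c * v)) / 2"
      proof -
        have "ln ((z / (2 * C0)) powr (- E) * sqrt z) = - E * (ln z - ln (2 * C0)) + ln z / 2"
          if "0 < z" for z
          using that C0 by (simp add: ln_mult ln_powr ln_div ln_sqrt)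
        from this[OF cv] show ?thesis .
      qed
      then have lnG: "ln ?G = E * ln (2 * C0) + (1/2 - E) * (ln (real c) + ln (real v))"
        unfolding lv by (simp add: algebra_simps)
      have "aJ + bJ * ln (real v) \<le> real (J v)" unfolding J_def by linarith
      then have "(aJ + bJ * ln (real v)) * (r * ln 2) \<le> real (J v) * (r * ln 2)"
        using r ln2 by (intro mult_right_mono) auto
      moreover have "(aJ + bJ * ln (real v)) * (r * ln 2) = aJ * (r * ln 2) + bJ * (r * ln 2) * ln (real v)"
        by (simp add: algebra_simps)
      moreover have a: "aJ * (r * ln 2) = - (ln w + E * ln (2 * C0) + (1/2 - E) * ln (real c))"
        and b: "bJ * (r * ln 2) = - (1/2 - E)"
        using r ln2 by (simp_all add: aJ_def bJ_def)
      ultimately have "- (ln w + E * ln (2 * C0) + (1/2 - E) * ln (real c)) + - (1/2 - E) * ln (real v)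
        \<le> real (J v) * (r * ln 2)"
        unfolding a b by linarith
      then have "- r * real (J v) * ln 2 \<le> ln w + ln ?G"
        unfolding lnG by (simp add: algebra_simps)
      also have "\<dots> = ln (w * ?G)" by (rule ln_mult_pos[OF w G, symmetric])
      finally have "exp (- r * real (J v) * ln 2) \<le> w * ?G"
        using w G by (subst ln_ge_iff[symmetric]) auto
      then have "2 powr (- r * real (J v)) \<le> w * ?G" by (simp add: powr_def)
      then show ?thesis unfolding w_def[symmetric] using w by (simp add: pos_divide_le_eq mult.commute)
    qed
    have \<delta>: "0 < \<delta> v" using \<kappa> cv by (simp add: \<delta>_def)
    have level: "(1/4) ^ L v \<le> \<delta> v / 4"
    proof -
      have "ln (4 / \<delta> v) = ln (64 * real c / \<kappa>) + ln (real v)"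
        using \<kappa> c v by (simp add: \<delta>_def ln_mult ln_div)
      then have "ln (4 / \<delta> v) / ln 4 = aL + 1 / ln 4 * ln (real v)"
        by (simp add: aL_def add_divide_distrib)
      then have "ln (4 / \<delta> v) / ln 4 \<le> real (L v)" unfolding L_def by linarith
      then have "ln (4 / \<delta> v) \<le> real (L v) * ln 4" by (simp add: pos_divide_le_eq)
      then have "ln (4 / \<delta> v) \<le> ln (4 ^ L v)" by (simp add: ln_realpow)
      then have "4 / \<delta> v \<le> 4 ^ L v" using \<delta> by (subst (asm) ln_le_cancel_iff) auto
      then have "4 \<le> 4 ^ L v * \<delta> v" using \<delta> by (simp add: pos_divide_le_eq)
      then have "(1/4) ^ L v * 4 \<le> (1/4) ^ L v * (4 ^ L v * \<delta> v)" by (intro mult_left_mono) auto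
      also have "\<dots> = ((1/4) ^ L v * 4 ^ L v) * \<delta> v" by (simp only: mult.assoc)
      also have "(1/4) ^ L v * 4 ^ L v = (1 :: real)" by (simp flip: power_mult_distrib)
      finally show ?thesis by simp
    qed
    have bJ: "real (J v) \<le> KJ * ?l v"
      unfolding J_def KJ_def by (rule nat_ceiling_affine_ln_le[OF v(1)])
    have bL: "real (L v) + 1 \<le> KL * ?l v"
    proof -
      have "real (L v) \<le> (2 * \<bar>aL\<bar> + \<bar>1 / ln 4\<bar> + 2) * ?l v"
        unfolding L_def by (rule nat_ceiling_affine_ln_le[OF v(1)])
      then show ?thesis unfolding KL_def using l1 by (simp add: distrib_right)
    qed
    have bD: "ln (256 / \<delta> v) \<le> KD * ?l v"
    proof -
      have "ln (256 / \<delta> v) = ln (4096 * real c / \<kappa>) + 1 * ln (real v)"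
        using \<kappa> c v by (simp add: \<delta>_def ln_mult ln_div)
      also have "\<dots> \<le> KD * ?l v" using affine_ln_le[OF v(1), of _ 1] unfolding KD_def by simp
      finally show ?thesis .
    qed
    have bN: "ln (4 * (2 * 2 ^ J v) ^ d) \<le> KN * ?l v"
    proof -
      have "ln (4 * (2 * 2 ^ J v) ^ d) = 2 * ln 2 + real d * (ln 2 + real (J v) * ln 2)"
        using ln_realpow[of 2 2] by (simp add: ln_mult ln_realpow distrib_left)
      also have "\<dots> \<le> 2 * 1 + real d * (1 + real (J v) * 1)"
        using ln_2_less_1 by (intro add_mono mult_left_mono) auto
      also have "\<dots> \<le> 2 * (2 * ?l v) + real d * (2 * ?l v + KJ * ?l v)"
        using l1 bJ by (intro add_mono mult_left_mono) auto
      also have "\<dots> = KN * ?l v" by (simp add: KN_def algebra_simps)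
      finally show ?thesis .
    qed
    have lnN: "0 \<le> ln (4 * (2 * 2 ^ J v) ^ d :: real)"
    proof -
      have "1 * 1 \<le> 4 * (2 * 2 ^ J v :: real) ^ d"
        by (intro mult_mono one_le_power) (auto simp: mult_ge1_I)
      then show ?thesis by simp
    qed
    have "32 * (real (L v) + 1) * (257 * ln (256 / \<delta> v) * ln (4 * (2 * 2 ^ J v) ^ d) + ln (2 * (real (L v) + 1)))
      \<le> 32 * (KL * ?l v) * (257 * (KD * ?l v) * (KN * ?l v) + 2 * (KL * ?l v))"
    proof -
      have "257 * ln (256 / \<delta> v) * ln (4 * (2 * 2 ^ J v) ^ d) \<le> 257 * (KD * ?l v) * (KN * ?l v)"
        by (rule mult_mono) (use bD bN lnN Kpos l1 in auto)
      moreover have "ln (2 * (real (L v) + 1)) \<le> 2 * (KL * ?l v)"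
        using ln_le_minus_one[of "2 * (real (L v) + 1)"] bL by simp
      ultimately have sum: "257 * ln (256 / \<delta> v) * ln (4 * (2 * 2 ^ J v) ^ d) + ln (2 * (real (L v) + 1))
        \<le> 257 * (KD * ?l v) * (KN * ?l v) + 2 * (KL * ?l v)" by linarith
      have "0 \<le> 257 * (KD * ?l v) * (KN * ?l v) + 2 * (KL * ?l v)" using Kpos l1 by simp
      with sum bL show ?thesis
        using Kpos l1
        by (intro order.trans[OF mult_left_mono[OF sum] mult_right_mono]) auto
    qed
    also have "\<dots> = 32 * KL * (257 * KD * KN * ?l v ^ 3 + 2 * KL * ?l v ^ 2)"
      by (simp add: power2_eq_square power3_eq_cube algebra_simps)
    \<comment> \<open>The levels, ln (256/\<delta>) and the logarithm of the dictionary size give a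
      cubic term; it and the quadratic one are raised to the fourth power by 1 \<le> 2 ln (2
      v).\<close>
    also have "\<dots> \<le> 32 * KL * (257 * KD * KN * (2 * ?l v ^ 4) + 2 * KL * (4 * ?l v ^ 4))"
    proof -
      have "1 * ?l v ^ 3 \<le> (2 * ?l v) * ?l v ^ 3" using l1 by (intro mult_right_mono) auto
      then have p3: "?l v ^ 3 \<le> 2 * ?l v ^ 4" by (simp add: power_eq_if)
      have "1 * ?l v ^ 2 \<le> (2 * ?l v) * ?l v ^ 2" using l1 by (intro mult_right_mono) auto
      then have "?l v ^ 2 \<le> 2 * ?l v ^ 3" by (simp add: power_eq_if)
      with p3 have "?l v ^ 2 \<le> 4 * ?l v ^ 4" by linarith
      with p3 show ?thesis using Kpos by (intro mult_left_mono add_mono) auto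
    qed
    also have "\<dots> = K * ?l v ^ 4" by (simp add: K_def algebra_simps)
    also have "\<dots> < (K + 1) * ?l v ^ 4" using l1 by simp
    also have "\<dots> = c' * real v * ?l v ^ 4 * \<delta> v"
      using c v \<kappa> by (simp add: c'_def \<delta>_def)
    also have "\<dots> \<le> real m * \<delta> v" using vm \<delta> by (intro mult_right_mono) auto
    finally have "32 * (real (L v) + 1) * (257 * ln (256 / \<delta> v) * ln (4 * (2 * 2 ^ J v) ^ d) + ln (2 * (real (L v) + 1)))
      < real m * \<delta> v" .
    with tail level show "\<exists>J L. 2 powr (- r * real J) / (1 - 2 powr (- r))
         \<le> (real (c * v) / (2 * C0)) powr (- E) * sqrt (real (c * v)) \<and>
       (1/4) ^ L \<le> \<delta> v / 4 \<and>
       32 * (real L + 1) * (257 * ln (256 / \<delta> v) * ln (4 * (2 * 2 ^ J) ^ d) + ln (2 * (real L + 1)))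
         < real m * \<delta> v" by blast
  qed
qed

section \<open>Recovery\<close>

lemma powr_product_split:
  fixes x y C E :: real
  assumes "0 < x" "0 < y" "0 < C"
  shows "(x * y / C) powr (- E) * sqrt (x * y) = C powr E * (x powr (1/2 - E) * y powr (1/2 - E))"
proof -
  define z where "z = x * y"
  have z: "0 < z" using assms by (simp add: z_def)
  have "(z / C) powr (- E) * sqrt z = z powr (- E) * C powr E * z powr (1/2)"
    using z assms by (simp add: powr_divide powr_minus_divide powr_half_sqrt)
  also have "\<dots> = C powr E * (z powr (- E) * z powr (1/2))" by (simp only: mult_ac)
  also have "z powr (- E) * z powr (1/2) = z powr (1/2 - E)" by (simp flip: powr_add)
  also have "\<dots> = x powr (1/2 - E) * y powr (1/2 - E)"
    using assms by (simp add: z_def powr_mult)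
  finally show ?thesis unfolding z_def .
qed

text \<open>Here s stands for c v. Dividing by 2 C0 in \<theta> gives every member of the class half
  of the budget s \<theta>, so that a difference of two members stays within it; the tail condition
  puts the truncation error on the scale \<theta> sqrt s of the result.\<close>

lemma rho_opt_le:
  assumes sys: "nikolskii_riesz_system \<mu> (Zd d) \<psi> R1 R2 p H u"
    and r: "0 < r" and \<beta>: "0 < \<beta>" "\<beta> \<le> 1" and d: "1 \<le> d" and s: "1 \<le> s" "s \<le> u"
  defines "C0 \<equiv> 2 * 2 ^ d + 1 / (1 - 2 powr (- (r * \<beta>)))"
  defines "\<theta> \<equiv> (real s / (2 * C0)) powr (- (1 / \<beta> + r / real d))"
  defines "\<delta> \<equiv> min 1 (R1\<^sup>2) / (16 * real s)"
  assumes tail: "2 powr (- r * real J) / (1 - 2 powr (- r)) \<le> \<theta> * sqrt s"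
    and L: "(1/4) ^ L \<le> \<delta> / 4"
    and m: "32 * (real L + 1) * (257 * ln (256 / \<delta>) * ln (4 * (2 * 2 ^ J) ^ d) + ln (2 * (real L + 1)))
         < real m * \<delta>"
  shows "rho_opt (A_class d \<psi> r \<beta>) \<mu> p m \<le> ennreal (90 * H * (1 + R2) * \<theta> * sqrt s)"
proof -
  interpret nikolskii_riesz_system \<mu> "Zd d" \<psi> R1 R2 p H u by (rule sys)
  define A where "A = A_class d \<psi> r \<beta>"
  define B where "B = dyadic_cube d J"
  define T where "T = 2 powr (- r * real J) / (1 - 2 powr (- r))"
  have B: "finite B" "B \<subseteq> Zd d" "B \<noteq> {}"
    unfolding B_def using finite_dyadic_cube dyadic_cube_subset dyadic_cube_nonempty by auto
  have "0 < 1 - 2 powr (- r)" using r by (simp add: powr_less_one)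
  then have T: "0 \<le> T" by (simp add: T_def)
  have "2 powr (- (r * \<beta>)) < 1" using r \<beta> by (intro powr_less_one) auto
  then have C0: "0 < C0" unfolding C0_def by (intro add_pos_pos) auto
  have \<theta>: "0 < \<theta>" using C0 s by (simp add: \<theta>_def)
  have H: "1 \<le> H" by (rule one_le_H)
  have \<delta>: "0 < \<delta>" "\<delta> \<le> 1" "16 * \<delta> * real s \<le> R1\<^sup>2"
  proof -
    show "0 < \<delta>" using R s by (simp add: \<delta>_def)
    have "min 1 (R1\<^sup>2) \<le> 1" by simp
    also have "1 \<le> 16 * real s" using s by simp
    finally show "\<delta> \<le> 1" unfolding \<delta>_def using s by (subst pos_divide_le_eq) auto
    have "16 * \<delta> * real s = min 1 (R1\<^sup>2)" using s by (simp add: \<delta>_def)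
    then show "16 * \<delta> * real s \<le> R1\<^sup>2" by simp
  qed
  have card: "0 < card B" using B by (simp add: card_gt_0_iff)
  have "real (card B) \<le> real ((2 * 2 ^ J) ^ d)"
    unfolding B_def using card_dyadic_cube by (simp only: of_nat_le_iff)
  then have "ln (4 * real (card B)) \<le> ln (4 * (2 * 2 ^ J) ^ d)" using card by (subst ln_le_cancel_iff) auto
  moreover have "0 \<le> ln (256 / \<delta>)" using \<delta> by simp
  ultimately have "32 * (real L + 1) * (257 * ln (256 / \<delta>) * ln (4 * real (card B)) + ln (2 * (real L + 1)))
    \<le> 32 * (real L + 1) * (257 * ln (256 / \<delta>) * ln (4 * (2 * 2 ^ J) ^ d) + ln (2 * (real L + 1)))"
    by (intro mult_left_mono add_right_mono) auto
  with m have m': "32 * (real L + 1) * (257 * ln (256 / \<delta>) * ln (4 * real (card B)) + ln (2 * (real L + 1)))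
    < real m * \<delta>" by linarith
  have "\<exists>\<xi>. length \<xi> = m \<and> set \<xi> \<subseteq> space \<mu> \<and>
    (\<forall>a A. (\<Sum>k\<in>B. cmod (a k)) \<le> A \<longrightarrow>
      expectation (\<lambda>x. (cmod (lin B a x))\<^sup>2) \<le> 43 * avg \<xi> (\<lambda>x. (cmod (lin B a x))\<^sup>2) + 8 * \<delta> * A\<^sup>2 \<and>
      avg \<xi> (\<lambda>x. (cmod (lin B a x))\<^sup>2) \<le> 43 * expectation (\<lambda>x. (cmod (lin B a x))\<^sup>2) + 8 * \<delta> * A\<^sup>2)"
    by (rule exists_points_discretization_complex[OF B(1,3) _ _ \<delta>(1,2) L m'])
      (use B(2) meas bounded in auto)
  then obtain \<xi> where \<xi>: "length \<xi> = m" "set \<xi> \<subseteq> space \<mu>"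
    and disc: "\<forall>a A. (\<Sum>k\<in>B. cmod (a k)) \<le> A \<longrightarrow>
      expectation (\<lambda>x. (cmod (lin B a x))\<^sup>2) \<le> 43 * avg \<xi> (\<lambda>x. (cmod (lin B a x))\<^sup>2) + 8 * \<delta> * A\<^sup>2 \<and>
      avg \<xi> (\<lambda>x. (cmod (lin B a x))\<^sup>2) \<le> 43 * expectation (\<lambda>x. (cmod (lin B a x))\<^sup>2) + 8 * \<delta> * A\<^sup>2"
    by (elim exE conjE)
  let ?coeffs = "\<lambda>f a. (\<lambda>k. cmod (a k)) summable_on Zd d \<and>
      (\<forall>j. (\<Sum>k\<in>dyadic_block d j. cmod (a k) powr \<beta>) powr (1 / \<beta>) \<le> 2 powr (- r * real j)) \<and>
      f = (\<lambda>x. \<Sum>\<^sub>\<infinity>k\<in>Zd d. a k * \<psi> k x)"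
  define cf where "cf = (\<lambda>f. SOME a. ?coeffs f a)"
  have cf: "?coeffs f (cf f)" if "f \<in> A" for f
  proof -
    have "\<exists>a. ?coeffs f a" using that unfolding A_def A_class_def by blast
    then show ?thesis unfolding cf_def by (rule someI_ex)
  qed
  have min_sum: "(\<Sum>k\<in>B. min (cmod (cf f k)) \<theta>) \<le> real s * \<theta> / 2" if "f \<in> A" for f
  proof -
    have "(\<Sum>k\<in>B. min (cmod (cf f k)) \<theta>) \<le> C0 * (real s / (2 * C0)) * \<theta>"
      unfolding B_def \<theta>_def C0_def
      by (rule sum_min_threshold[OF r \<beta> d]) (use cf[OF that] C0 s in \<open>auto simp: C0_def\<close>)
    also have "\<dots> = real s * \<theta> / 2" using C0 by simp
    finally show ?thesis .
  qed
  have trunc: "cmod (f x - lin B (cf f) x) \<le> T" if f: "f \<in> A" and x: "x \<in> space \<mu>" for f x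
  proof -
    have sa: "(\<lambda>k. cmod (cf f k)) summable_on Zd d" using cf[OF f] by blast
    have le: "norm (cf f k * \<psi> k x) \<le> cmod (cf f k)" if "k \<in> Zd d" for k
      using bounded[OF that x] by (simp add: norm_mult mult_left_le)
    have abs: "(\<lambda>k. norm (cf f k * \<psi> k x)) summable_on Zd d"
      by (rule Infinite_Sum.abs_summable_on_comparison_test'[OF sa le])
    have abs': "(\<lambda>k. norm (cf f k * \<psi> k x)) summable_on (Zd d - B)"
      using abs by (rule summable_on_subset_banach) auto
    have "f x = (\<Sum>\<^sub>\<infinity>k\<in>Zd d. cf f k * \<psi> k x)" using cf[OF f, THEN conjunct2, THEN conjunct2] by (rule fun_cong)
    then have "f x - lin B (cf f) x = (\<Sum>\<^sub>\<infinity>k\<in>Zd d - B. cf f k * \<psi> k x)"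
      using infsum_Diff[OF abs_summable_summable[OF abs] _ B(2)] B(1) by simp
    then have "cmod (f x - lin B (cf f) x) \<le> (\<Sum>\<^sub>\<infinity>k\<in>Zd d - B. norm (cf f k * \<psi> k x))"
      using norm_infsum_bound[OF abs'] by simp
    also have "\<dots> \<le> (\<Sum>\<^sub>\<infinity>k\<in>Zd d - B. cmod (cf f k))"
    proof (rule infsum_mono[OF abs'])
      show "(\<lambda>k. cmod (cf f k)) summable_on Zd d - B"
        using sa by (rule summable_on_subset_banach) auto
    qed (use le in auto)
    also have "\<dots> \<le> T"
      unfolding B_def T_def by (rule tail_sum[OF r \<beta> d]) (use cf[OF f] in auto)
    finally show ?thesis .
  qed
  define g where "g = (\<lambda>y. SOME g. g \<in> A \<and> map g \<xi> = y)"
  \<comment> \<open>The output is a finite sum, hence measurable. Data that no member of the class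
    produces are sent to 0.\<close>
  define R where "R = (\<lambda>y. if \<exists>g\<in>A. map g \<xi> = y then lin B (cf (g y)) else (\<lambda>_. 0))"
  have Rm: "R y \<in> borel_measurable \<mu>" for y
    using lin_measurable[OF B(2)] by (simp add: R_def)
  have error: "Lp_norm \<mu> p (\<lambda>x. f x - R (map f \<xi>) x) \<le> ennreal (90 * H * (1 + R2) * \<theta> * sqrt s)" if f: "f \<in> A" for f
  proof -
    define h where "h = g (map f \<xi>)"
    have h: "h \<in> A" "map h \<xi> = map f \<xi>"
      using someI[of "\<lambda>g. g \<in> A \<and> map g \<xi> = map f \<xi>" f] f unfolding h_def g_def by auto
    have Rf: "R (map f \<xi>) = lin B (cf h)" using f unfolding R_def h_def by auto
    define a where "a = (\<lambda>k. cf f k - cf h k)"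
    have lin_a: "lin B a x = lin B (cf f) x - lin B (cf h) x" for x
      by (simp add: a_def left_diff_distrib sum_subtractf)
    have "(\<Sum>k\<in>B. min (cmod (a k)) \<theta>) \<le> (\<Sum>k\<in>B. min (cmod (cf f k)) \<theta> + min (cmod (cf h k)) \<theta>)"
    proof (rule sum_mono)
      fix k
      have "cmod (a k) \<le> cmod (cf f k) + cmod (cf h k)" unfolding a_def by (rule norm_triangle_ineq4)
      then show "min (cmod (a k)) \<theta> \<le> min (cmod (cf f k)) \<theta> + min (cmod (cf h k)) \<theta>"
        using \<theta> norm_ge_zero[of "cf f k"] norm_ge_zero[of "cf h k"] by linarith
    qed
    also have "\<dots> \<le> real s * \<theta>"
      using min_sum[OF f] min_sum[OF h(1)] by (simp add: sum.distrib)
    finally have min_a: "(\<Sum>k\<in>B. min (cmod (a k)) \<theta>) \<le> real s * \<theta>" .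
    have small: "cmod (lin B a x) \<le> 2 * \<theta> * sqrt s" if x: "x \<in> set \<xi>" for x
    proof -
      \<comment> \<open>At the sample points the truncated difference is only the difference of two
        truncation errors.\<close>
      have "f x = h x" using h(2) x by simp
      then have "lin B a x = (h x - lin B (cf h) x) - (f x - lin B (cf f) x)"
        unfolding lin_a by simp
      then have "cmod (lin B a x) \<le> cmod (h x - lin B (cf h) x) + cmod (f x - lin B (cf f) x)"
        by (metis norm_triangle_ineq4)
      also have "\<dots> \<le> T + T" using x \<xi>(2) by (intro add_mono trunc f h(1)) auto
      finally show ?thesis using tail by (simp add: T_def)
    qed
    have main: "Lp_norm \<mu> p (lin B a) \<le> ennreal (89 * H * (1 + R2) * \<theta> * sqrt s)"
      using disc by (intro Lp_norm_le_of_small_samples[OF s B(1,2) \<delta>(1,3) \<xi>(2) _ \<theta> min_a small]) auto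
    have "Lp_norm \<mu> p (\<lambda>x. f x - R (map f \<xi>) x) \<le> ennreal (89 * H * (1 + R2) * \<theta> * sqrt s + T)"
    proof (rule Lp_norm_triangle[OF lin_measurable[OF B(2)] _ _ _ main])
      show "Lp_norm \<mu> p (\<lambda>_. complex_of_real T) \<le> ennreal T"
        using p T by (intro Lp_norm_bounded) auto
      fix x assume x: "x \<in> space \<mu>"
      have "f x - R (map f \<xi>) x = lin B a x + (f x - lin B (cf f) x)" unfolding Rf lin_a by simp
      then have "cmod (f x - R (map f \<xi>) x) \<le> cmod (lin B a x) + cmod (f x - lin B (cf f) x)"
        by (metis norm_triangle_ineq)
      with trunc[OF f x] T show "cmod (f x - R (map f \<xi>) x) \<le> cmod (lin B a x) + cmod (complex_of_real T)"
        by simp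
    qed (use p T \<theta> H R in auto)
    also have "\<dots> \<le> ennreal (90 * H * (1 + R2) * \<theta> * sqrt s)"
    proof (rule ennreal_leI)
      \<comment> \<open>The truncation error carries no factor H; H at least 1 lets it be absorbed
        and raises 89 to 90.\<close>
      have "1 * 1 \<le> H * (1 + R2)" using H R by (intro mult_mono) auto
      then have "1 * (\<theta> * sqrt s) \<le> (H * (1 + R2)) * (\<theta> * sqrt s)"
        using \<theta> by (intro mult_right_mono) auto
      then have "T \<le> H * (1 + R2) * \<theta> * sqrt s" using tail by (simp add: T_def mult.assoc)
      then show "89 * H * (1 + R2) * \<theta> * sqrt s + T \<le> 90 * H * (1 + R2) * \<theta> * sqrt s"
        by (simp add: algebra_simps)
    qed
    finally show ?thesis .
  qed
  have "rho_opt A \<mu> p m \<le> (SUP f\<in>A. Lp_norm \<mu> p (\<lambda>x. f x - R (map f \<xi>) x))"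
    unfolding rho_opt_def using \<xi> Rm by (intro INF_lower2[of \<xi>] INF_lower2[of R]) auto
  also have "\<dots> \<le> ennreal (90 * H * (1 + R2) * \<theta> * sqrt s)"
    by (intro SUP_least error)
  finally show ?thesis unfolding A_def .
qed

theorem theorem5p3:
  shows "\<exists>(c :: real \<Rightarrow> real \<Rightarrow> real \<Rightarrow> nat)
           (c' :: real \<Rightarrow> real \<Rightarrow> real \<Rightarrow> real \<Rightarrow> real \<Rightarrow> nat \<Rightarrow> real \<Rightarrow> real)
           (C' :: real \<Rightarrow> real \<Rightarrow> real \<Rightarrow> nat \<Rightarrow> real).
     \<forall>(t::real) (R1::real) (R2::real) (r::real) (\<beta>::real) (p::real) (d::nat).
       0 < t \<and> t \<le> 1 \<and> 0 < R1 \<and> R1 \<le> R2 \<and> 0 < r \<and> 0 < \<beta> \<and> \<beta> \<le> 1 \<and> 2 \<le> p \<and> 1 \<le> d \<longrightarrow>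
       1 \<le> c t R1 R2 \<and>
       (\<forall>(\<Omega> :: (nat \<Rightarrow> real) set) (\<mu> :: (nat \<Rightarrow> real) measure)
          (\<psi> :: (nat \<Rightarrow> int) \<Rightarrow> (nat \<Rightarrow> real) \<Rightarrow> complex) (H::real) (v::nat) (m::nat).
          \<Omega> \<subseteq> Rd d \<and> compact \<Omega> \<and>
          prob_space \<mu> \<and> space \<mu> = \<Omega> \<and> sets \<mu> = sets (restrict_space borel \<Omega>) \<and>
          (\<forall>k\<in>Zd d. continuous_on \<Omega> (\<psi> k)) \<and>
          unif_bounded_riesz \<mu> \<Omega> (Zd d) \<psi> R1 R2 \<and>
          1 \<le> v \<and>
          NI \<mu> (Zd d) \<psi> p H (nat \<lceil>(1 + real (c t R1 R2)) * real v\<rceil>) \<and>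
          c' r \<beta> p R1 R2 d t * real v * (ln (2 * real v)) ^ 4 \<le> real m
          \<longrightarrow> rho_opt (A_class d \<psi> r \<beta>) \<mu> p m
                \<le> ennreal (C' r \<beta> p d * H * real v powr (1 / 2 - 1 / \<beta> - r / real d)))"
proof -
  define C0 where "C0 = (\<lambda>r \<beta> (d :: nat). 2 * 2 ^ d + 1 / (1 - 2 powr (- (r * \<beta>))) :: real)"
  define c where "c = (\<lambda>(t :: real) (R1 :: real) (R2 :: real). nat \<lceil>(1 + R2)\<^sup>2\<rceil>)"
  \<comment> \<open>The power of 2 C0 is what \<theta> leaves behind at X = c v / (2 C0), once the
    powers of c and v are split off.\<close>
  define C' where "C' = (\<lambda>r \<beta> (p :: real) d. 90 * (2 * C0 r \<beta> d) powr (1 / \<beta> + r / real d))"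
  \<comment> \<open>\<open>S\<close> states for all v and m what the constant must achieve. It
    mentions only the parameters, so the later choice by \<open>SOME\<close> is independent of the
    system, of v and of m.\<close>
  define S where "S = (\<lambda>r \<beta> R1 R2 (d :: nat) c'. \<forall>v m. 1 \<le> v \<and> c' * real v * ln (2 * real v) ^ 4 \<le> real m \<longrightarrow>
    (\<exists>J L. 2 powr (- r * real J) / (1 - 2 powr (- r))
         \<le> (real (c 1 R1 R2 * v) / (2 * C0 r \<beta> d)) powr (- (1 / \<beta> + r / real d)) * sqrt (real (c 1 R1 R2 * v)) \<and>
       (1/4) ^ L \<le> min 1 (R1\<^sup>2) / (16 * real (c 1 R1 R2 * v)) / 4 \<and>
       32 * (real L + 1) * (257 * ln (256 / (min 1 (R1\<^sup>2) / (16 * real (c 1 R1 R2 * v)))) * ln (4 * (2 * 2 ^ J) ^ d)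
           + ln (2 * (real L + 1)))
         < real m * (min 1 (R1\<^sup>2) / (16 * real (c 1 R1 R2 * v)))))"
  define c' where "c' = (\<lambda>r \<beta> (p :: real) R1 R2 d (t :: real). SOME c'. S r \<beta> R1 R2 d c')"
  show ?thesis
  proof (intro exI[of _ c] exI[of _ c'] exI[of _ C'] allI impI, elim conjE, intro conjI allI impI, goal_cases)
    case (1 t R1 R2 r \<beta> p d)
    have "0 < (1 + R2)\<^sup>2" using 1 by simp
    then show ?case unfolding c_def by linarith
  next
    case (2 t R1 R2 r \<beta> p d \<Omega> \<mu> \<psi> H v m)
    note par = 2(1-9)
    from 2(10) have hyp: "compact \<Omega>" "prob_space \<mu>" "space \<mu> = \<Omega>" "sets \<mu> = sets (restrict_space borel \<Omega>)"
      "\<forall>k\<in>Zd d. continuous_on \<Omega> (\<psi> k)" "unif_bounded_riesz \<mu> \<Omega> (Zd d) \<psi> R1 R2" "1 \<le> v"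
      "NI \<mu> (Zd d) \<psi> p H (nat \<lceil>(1 + real (c t R1 R2)) * real v\<rceil>)"
      "c' r \<beta> p R1 R2 d t * real v * (ln (2 * real v)) ^ 4 \<le> real m" by auto
    let ?c = "c 1 R1 R2" and ?C = "C0 r \<beta> d" and ?E = "1 / \<beta> + r / real d"
    have ct: "c t R1 R2 = ?c" by (simp add: c_def)
    have c: "(1 + R2)\<^sup>2 \<le> real ?c" unfolding c_def by linarith
    have "1 \<le> (1 + R2)\<^sup>2" using par by simp
    with c have c1: "1 \<le> real ?c" by linarith
    have "2 powr (- (r * \<beta>)) < 1" using par by (intro powr_less_one) auto
    then have C0: "0 < ?C" unfolding C0_def by (intro add_pos_pos) auto
    have "\<exists>c'. S r \<beta> R1 R2 d c'"
      unfolding S_def by (rule sample_size_sufficient) (use par C0 c1 in auto)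
    then have "S r \<beta> R1 R2 d (c' r \<beta> p R1 R2 d t)"
      unfolding c'_def by (rule someI_ex)
    then obtain J L where JL: "2 powr (- r * real J) / (1 - 2 powr (- r))
         \<le> (real (?c * v) / (2 * ?C)) powr (- ?E) * sqrt (real (?c * v))"
       "(1/4) ^ L \<le> min 1 (R1\<^sup>2) / (16 * real (?c * v)) / 4"
       "32 * (real L + 1) * (257 * ln (256 / (min 1 (R1\<^sup>2) / (16 * real (?c * v)))) * ln (4 * (2 * 2 ^ J) ^ d)
           + ln (2 * (real L + 1)))
         < real m * (min 1 (R1\<^sup>2) / (16 * real (?c * v)))"
      using hyp(7,9) unfolding S_def by blast
    let ?u = "nat \<lceil>(1 + real ?c) * real v\<rceil>"
    have "real (?c * v) \<le> (1 + real ?c) * real v" by (simp add: distrib_right)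
    \<comment> \<open>The sparsity s = c v stays within the range of the Nikolskii
      inequality.\<close>
    then have su: "?c * v \<le> ?u" by linarith
    have s1: "1 \<le> ?c * v" using c1 hyp(7) by simp
    have sys: "nikolskii_riesz_system \<mu> (Zd d) \<psi> R1 R2 p H ?u"
    proof (intro nikolskii_riesz_system.intro nikolskii_riesz_system_axioms.intro)
      show "prob_space \<mu>" by (rule hyp(2))
      show "\<psi> k \<in> borel_measurable \<mu>" if "k \<in> Zd d" for k
        using borel_measurable_continuous_on_restrict[of \<Omega> "\<psi> k"] hyp(4,5) that
        by (simp cong: measurable_cong_sets)
      show "1 \<le> ?u" using su s1 by linarith
      have "(\<lambda>_. 0) \<in> Zd d" by (simp add: Zd_def)
      then show "Zd d \<noteq> {}" by blast
    qed (use par hyp ct in auto)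
    have "rho_opt (A_class d \<psi> r \<beta>) \<mu> p m
      \<le> ennreal (90 * H * (1 + R2) * (real (?c * v) / (2 * ?C)) powr (- ?E) * sqrt (real (?c * v)))"
      using rho_opt_le[OF sys _ _ _ _ s1 su, of r \<beta> J L m] par JL unfolding C0_def by simp
    also have "\<dots> \<le> ennreal (C' r \<beta> p d * H * real v powr (1 / 2 - 1 / \<beta> - r / real d))"
    proof (rule ennreal_leI)
      interpret nikolskii_riesz_system \<mu> "Zd d" \<psi> R1 R2 p H ?u by (rule sys)
      have v: "0 < real v" using hyp(7) by simp
      \<comment> \<open>From \<beta> \<le> 1 the exponent 1/2 - E is at most -1/2, so the power of c
        is at most 1 / sqrt c, hence at most 1 / (1 + R2); this keeps R1 and R2 out of C'.\<close>
      have E: "1 \<le> ?E"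
      proof -
        have "1 \<le> 1 / \<beta>" using par by simp
        moreover have "0 \<le> r / real d" using par by simp
        ultimately show ?thesis by linarith
      qed
      have "(real (?c * v) / (2 * ?C)) powr (- ?E) * sqrt (real (?c * v))
        = (2 * ?C) powr ?E * (real ?c powr (1/2 - ?E) * real v powr (1/2 - ?E))"
        using powr_product_split[of "real ?c" "real v" "2 * ?C" ?E] c1 v C0 by simp
      moreover have "(1 + R2) * real ?c powr (1/2 - ?E) \<le> 1"
      proof -
        have "real ?c powr (1/2 - ?E) \<le> real ?c powr (- (1/2))"
          using E c1 by (intro powr_mono) auto
        also have "\<dots> = 1 / sqrt (real ?c)" using c1 unfolding powr_minus_divide by (simp add: powr_half_sqrt)
        also have "\<dots> \<le> 1 / (1 + R2)"
          using c c1 par by (intro divide_left_mono real_le_rsqrt) (auto intro!: mult_pos_pos)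
        finally have "(1 + R2) * real ?c powr (1/2 - ?E) \<le> (1 + R2) * (1 / (1 + R2))"
          using par by (intro mult_left_mono) auto
        then show ?thesis using par by simp
      qed
      moreover have "0 \<le> 90 * H * ((2 * ?C) powr ?E * real v powr (1/2 - ?E))"
        using one_le_H by simp
      ultimately have "90 * H * ((2 * ?C) powr ?E * real v powr (1/2 - ?E)) * ((1 + R2) * real ?c powr (1/2 - ?E))
        \<le> 90 * H * ((2 * ?C) powr ?E * real v powr (1/2 - ?E)) * 1"
        by (intro mult_left_mono)
      moreover have "90 * H * (1 + R2) * (real (?c * v) / (2 * ?C)) powr (- ?E) * sqrt (real (?c * v))
        = 90 * H * ((2 * ?C) powr ?E * real v powr (1/2 - ?E)) * ((1 + R2) * real ?c powr (1/2 - ?E))"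
        unfolding mult.assoc \<open>_ = (2 * ?C) powr ?E * (real ?c powr (1/2 - ?E) * real v powr (1/2 - ?E))\<close>
        by (simp only: mult_ac)
      moreover have "C' r \<beta> p d * H * real v powr (1 / 2 - 1 / \<beta> - r / real d)
        = 90 * H * ((2 * ?C) powr ?E * real v powr (1/2 - ?E)) * 1"
        by (simp add: C'_def diff_diff_eq mult_ac)
      ultimately show "90 * H * (1 + R2) * (real (?c * v) / (2 * ?C)) powr (- ?E) * sqrt (real (?c * v))
        \<le> C' r \<beta> p d * H * real v powr (1 / 2 - 1 / \<beta> - r / real d)"
        by linarith
    qed
    finally show ?case .
  qed
qed

end
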